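(* The map $T$ has a nonzero $\sigma$-finite invariant measure $\mu$ on $U$ that is absolutely continuous with respect to Lebesgue measure, and $T$ is ergodic with respect to $\mu$: if $A\subset U$ is measurable with $T^{-1}A=A$, then $\mu(A)=0$ or $\mu(U\setminus A)=0$.
   Context: Let $\zeta=\frac{1+\sqrt{-3}}2$, $\eta=\frac{3+\sqrt{-3}}2$, $\mathfrak o(\sqrt{-3})=\mathbb Z+\mathbb Z\zeta$, $\mathcal J=\eta\cdot\mathfrak o(\sqrt{-3})$. $U$ is the fundamental domain of $\mathbb C/\mathcal J$ consisting of the open regular hexagon with vertices $\zeta^k$ ($0\le k\le 5$), together with the three open sides $\{t\zeta+(1-t)(-\overline\zeta):0<t<1\}$, $\{t(-\zeta)+(1-t)(-1):0<t<1\}$, $\{t+(1-t)\overline\zeta:0<t<1\}$ and the two vertices $-\zeta,\overline\zeta$. For $z\in\mathbb C$, $[z]$ is the unique $a\in\mathcal J$ with $z\in a+U$. The map $T:U\to U$ is $T(z)=\frac1z-[\frac1z]$ for $z\ne0$, $T(0)=0$. *)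

theory Defs
  imports "HOL-Analysis.Analysis"
begin

definition zeta :: complex where
  "zeta = (1 + \<i> * of_real (sqrt 3)) / 2"

definition eta :: complex where
  "eta = (3 + \<i> * of_real (sqrt 3)) / 2"

definition eisenstein_integers :: "complex set" where
  "eisenstein_integers = {of_int m + of_int n * zeta | m n :: int. True}"

definition J_ideal :: "complex set" where
  "J_ideal = (\<lambda>x. eta * x) ` eisenstein_integers"

definition open_hexagon :: "complex set" where
  "open_hexagon = interior (convex hull {zeta ^ k | k :: nat. k \<le> 5})"

definition U_dom :: "complex set" where
  "U_dom = open_hexagon
     \<union> open_segment zeta (- cnj zeta)
     \<union> open_segment (- zeta) (- 1)
     \<union> open_segment 1 (cnj zeta)
     \<union> {- zeta, cnj zeta}"

definition J_part :: "complex \<Rightarrow> complex" where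
  "J_part z = (THE a. a \<in> J_ideal \<and> z \<in> (\<lambda>u. a + u) ` U_dom)"

(* Only the values on U_dom are relevant; the function is total for typing reasons. *)
definition T_map :: "complex \<Rightarrow> complex" where
  "T_map z = (if z = 0 then 0 else 1 / z - J_part (1 / z))"

end

theory Submission
  imports Defs "HOL-Analysis.Analysis"
begin

text \<open>
  In the coordinates of \<open>z = y + x \<zeta>\<close> the ideal is \<open>{x \<equiv> y mod 3}\<close> and \<open>\<zeta> / z\<close> is the swap of the
  coordinates divided by \<open>|z|\<^sup>2\<close>. Cutting \<open>U\<close> along its three diagonals and along the circumcircles of
  the triangles of the hexagonal lattice around it gives a finite Markov structure: every inverse
  branch of \<open>T\<^sup>n\<close> is defined on one of finitely many cells. Its pole stays outside the open unit disc,
  so its distortion is bounded on every disc \<open>|w| \<le> r < 1\<close>.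

  An orbit cannot converge to the unit circle, because near a vertex \<open>v\<close> of \<open>U\<close> one has
  \<open>|1/y - 1/v| = |y - v| / |y| > |y - v|\<close>. Hence almost every point has arbitrarily small neighbourhoods
  that are mapped with bounded distortion onto a whole cell, and the Vitali covering theorem gives
  ergodicity with respect to Lebesgue measure.

  The invariant density is \<open>h = liminf\<close> of the normalised Abel sums \<open>\<Sum>n. s\<^sup>n PF\<^sup>n 1\<close> of the transfer
  operator \<open>PF\<close> as \<open>s \<rightarrow> 1\<close>. Fatou's lemma gives \<open>PF h \<le> h\<close>, bounded distortion gives \<open>h > 0\<close>, and since
  almost every orbit returns infinitely often to a disc on which \<open>h\<close> is integrable, \<open>PF h = h\<close>.
\<close>

section \<open>Measures of holomorphic images\<close>

text \<open>The obstacle is the six vertices of \<open>U_dom\<close>. They lie on the unit circle,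
  where z -> 1/z has a derivative of modulus 1, so T is not uniformly expanding, the distortion
  constants blow up as r tends to 1, and nothing here bounds the total mass of the density. Hence
  every estimate is made on a disc |w| <= r, and the density is normalised by its mass on such a
  disc.

  The circles in the cells are forced by inversion: 1/z turns the straight outer side of a sector
  into a circle, and a shortest digit moves an arc of it back into the hexagon. Besides the full
  sector, three cut sectors close the family. The poles obey a dual rule: a further digit a replaces
  q = 1 / cnj p by 1 / (q - cnj a), and |q| <= 1 alone is not inductive, so each type needs its own
  condition.

  No single digit sends all six sectors into a cell of type 2 or 3. This is why lower bounds use two
  steps and constants carry eighth powers.

  Ergodicity for Lebesgue measure comes before the density because it supplies one radius r whose
  disc almost every orbit visits infinitely often.\<close>

abbreviation leb :: "'a::euclidean_space set \<Rightarrow> ennreal" where "leb \<equiv> emeasure lebesgue"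

text \<open>The change of variables theorem used below lives on \<open>real^2\<close>, with
  determinants of matrices; these mutually inverse linear maps carry it to
  \<open>complex\<close>.\<close>

definition cvec :: "real^2 \<Rightarrow> complex" where "cvec v = Complex (v $ 1) (v $ 2)"
definition vecc :: "complex \<Rightarrow> real^2" where "vecc z = (\<chi> i. if i = 1 then Re z else Im z)"

lemma cvec_vecc [simp]: "cvec (vecc z) = z"
  by (simp add: cvec_def vecc_def)

lemma vecc_cvec [simp]: "vecc (cvec v) = v"
  by (simp add: cvec_def vecc_def vec_eq_iff forall_2)

lemma linear_cvec: "linear cvec"
  by (rule linearI) (simp_all add: cvec_def complex_eq_iff)

lemma linear_vecc: "linear vecc"
  by (rule linearI) (simp_all add: vecc_def vec_eq_iff)

lemma bounded_linear_cvec: "bounded_linear cvec"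
  using linear_cvec linear_conv_bounded_linear by blast

lemma bounded_linear_vecc: "bounded_linear vecc"
  using linear_vecc linear_conv_bounded_linear by blast

lemma cvec_borel [measurable]: "cvec \<in> borel \<rightarrow>\<^sub>M borel"
  using linear_continuous_on[OF bounded_linear_cvec] borel_measurable_continuous_onI by blast

lemma vecc_borel [measurable]: "vecc \<in> borel \<rightarrow>\<^sub>M borel"
  using linear_continuous_on[OF bounded_linear_vecc] borel_measurable_continuous_onI by blast

lemma distr_cvec_lborel: "distr lborel borel cvec = lborel"
proof (rule lborel_eqI[symmetric])
  fix l u :: complex
  assume le: "\<And>b. b \<in> Basis \<Longrightarrow> l \<bullet> b \<le> u \<bullet> b"
  have "cvec -` box l u = box (vecc l) (vecc u)"
    by (auto simp: cvec_def vecc_def box_def Basis_complex_def Basis_vec_def inner_axis forall_2 inner_complex_def)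
  moreover have "\<And>b. b \<in> Basis \<Longrightarrow> vecc l \<bullet> b \<le> vecc u \<bullet> b"
    using le[of 1] le[of \<i>] by (auto simp: vecc_def Basis_complex_def Basis_vec_def inner_axis inner_complex_def)
  moreover have "(\<Prod>b\<in>Basis. (vecc u - vecc l) \<bullet> b) = (\<Prod>b\<in>Basis. (u - l) \<bullet> b)"
  proof -
    have B: "(Basis :: (real^2) set) = {axis 1 1, axis 2 1}"
      by (auto simp: Basis_vec_def) (metis exhaust_2)+
    have "axis 1 1 \<noteq> (axis 2 1 :: real^2)" by (simp add: axis_eq_axis)
    then show ?thesis
      by (simp add: B Basis_complex_def inner_axis vecc_def inner_complex_def)
  qed
  ultimately show "emeasure (distr lborel borel cvec) (box l u) = (\<Prod>b\<in>Basis. (u - l) \<bullet> b)"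
    by (simp add: emeasure_distr)
qed simp

lemma distr_vecc_lborel: "distr lborel borel vecc = lborel"
proof -
  have "distr lborel borel vecc = distr (distr lborel borel cvec) borel vecc"
    by (simp add: distr_cvec_lborel)
  also have "\<dots> = distr lborel borel (vecc \<circ> cvec)"
    by (rule distr_distr) auto
  also have "\<dots> = lborel" by (simp add: o_def distr_id2)
  finally show ?thesis .
qed

text \<open>\<open>distr_cvec_lborel\<close> settles Borel sets. A Lebesgue set has a Borel superset
  that exceeds it by a null set, and a linear map, being differentiable, keeps null sets
  null.\<close>

lemma emeasure_cvec_image:
  assumes "S \<in> sets lebesgue"
  shows "cvec ` S \<in> sets lebesgue" "leb (cvec ` S) = leb S"
proof -
  have *: "cvec ` A = vecc -` A" for A
    by (auto simp: image_iff) (metis cvec_vecc)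
  have b: "emeasure lborel (cvec ` A) = emeasure lborel A" if "A \<in> sets borel" for A
  proof -
    have "emeasure lborel A = emeasure (distr lborel borel vecc) A" by (simp add: distr_vecc_lborel)
    also have "\<dots> = emeasure lborel (cvec ` A)" using that by (simp add: emeasure_distr *)
    finally show ?thesis by simp
  qed
  have bs: "cvec ` A \<in> sets borel" if "A \<in> sets borel" for A
    unfolding * using measurable_sets[OF vecc_borel that] by simp
  show 1: "cvec ` S \<in> sets lebesgue"
    by (rule differentiable_image_in_sets_lebesgue[OF assms])
      (auto intro: linear_imp_differentiable_on[OF linear_cvec])
  obtain B where B: "S \<subseteq> B" "B \<in> sets lborel" "B - S \<in> null_sets lebesgue" "leb S = emeasure lborel B"
    using completion_upper[OF assms] by blast
  have "cvec ` (B - S) \<in> null_sets lebesgue"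
  proof -
    have "negligible (cvec ` (B - S))"
      by (rule negligible_differentiable_image_negligible)
        (use B in \<open>auto simp: negligible_iff_null_sets intro: linear_imp_differentiable_on[OF linear_cvec]\<close>)
    then show ?thesis by (simp add: negligible_iff_null_sets)
  qed
  moreover have "cvec ` B = cvec ` S \<union> cvec ` (B - S)" using B by auto
  ultimately have "leb (cvec ` S) = leb (cvec ` B)"
    using emeasure_Un_null_set[OF 1] by auto
  also have "\<dots> = emeasure lborel (cvec ` B)" using bs B by simp
  finally show "leb (cvec ` S) = leb S" using b B by simp
qed

text \<open>Hence the real Jacobian of a holomorphic map is the squared modulus of its
  derivative.\<close>

lemma det_matrix_mult_complex:
  "det (matrix (\<lambda>v. vecc (d * cvec v))) = (cmod d)\<^sup>2"
  unfolding cmod_power2 by (simp add: det_2 matrix_def vecc_def cvec_def axis_def power2_eq_square)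

text \<open>The bound \<open>B\<close> and the finite measure of \<open>S\<close> make the Jacobian
  integrable over \<open>S\<close>, as the real change of variables formula requires.\<close>

lemma holomorphic_image_emeasure:
  fixes f :: "complex \<Rightarrow> complex"
  assumes S: "S \<in> lmeasurable"
    and der: "\<And>z. z \<in> S \<Longrightarrow> (f has_field_derivative f' z) (at z)"
    and inj: "inj_on f S"
    and bd: "\<And>z. z \<in> S \<Longrightarrow> cmod (f' z) \<le> B"
    and meas: "f' \<in> borel_measurable borel"
  shows "f ` S \<in> sets lebesgue"
    "leb (f ` S) = (\<integral>\<^sup>+z. ennreal ((cmod (f' z))\<^sup>2) * indicator S z \<partial>lebesgue)"
proof -
  let ?g = "\<lambda>v. vecc (f (cvec v))" and ?g' = "\<lambda>v w. vecc (f' (cvec v) * cvec w)"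
  let ?S = "vecc ` S"
  have Sl: "S \<in> sets lebesgue" using S by (simp add: fmeasurableD)
  have cS: "cvec ` ?S = S" by (simp add: image_image)
  have SS: "?S \<in> sets lebesgue"
    by (rule differentiable_image_in_sets_lebesgue[OF Sl])
      (auto intro: linear_imp_differentiable_on[OF linear_vecc])
  have eS: "leb ?S = leb S"
    using emeasure_cvec_image(2)[OF SS] cS by simp
  have SSm: "?S \<in> lmeasurable" using S eS SS by (auto simp: fmeasurable_def simp del: emeasure_completion)
  have d: "(?g has_derivative ?g' v) (at v within ?S)" if "v \<in> ?S" for v
  proof -
    have "(f has_derivative (*) (f' (cvec v))) (at (cvec v))"
      using der that by (auto simp: has_field_derivative_def)
    then have "((\<lambda>v. f (cvec v)) has_derivative (\<lambda>w. f' (cvec v) * cvec w)) (at v)"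
      using has_derivative_compose[OF bounded_linear_imp_has_derivative[OF bounded_linear_cvec]] by blast
    then have "(?g has_derivative ?g' v) (at v)"
      by (rule bounded_linear.has_derivative[OF bounded_linear_vecc])
    then show ?thesis by (rule has_derivative_at_withinI)
  qed
  have in': "inj_on ?g ?S"
    using inj by (auto simp: inj_on_def) (metis cvec_vecc)
  define D where "D = (\<lambda>v. (cmod (f' (cvec v)))\<^sup>2)"
  have Dm: "D \<in> borel_measurable borel" unfolding D_def using meas by measurable
  have det: "\<bar>det (matrix (?g' v))\<bar> = D v" for v
    by (simp add: det_matrix_mult_complex D_def)
  have Dle: "D v \<le> B\<^sup>2" if "v \<in> ?S" for v
    using that bd unfolding D_def by (auto intro!: power_mono)
  have Dlm: "D \<in> borel_measurable (lebesgue_on ?S)"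
    using Dm by (intro measurable_restrict_space1 measurable_completion) simp
  have int: "D absolutely_integrable_on ?S"
  proof (rule measurable_bounded_by_integrable_imp_absolutely_integrable)
    show "(\<lambda>x. B\<^sup>2) integrable_on ?S" using SSm integrable_on_const by blast
  qed (use Dlm SS Dle in \<open>auto simp: D_def\<close>)
  then have int': "(\<lambda>v. \<bar>det (matrix (?g' v))\<bar>) integrable_on ?S"
    unfolding det using absolutely_integrable_on_def by blast
  have gm: "?g ` ?S \<in> lmeasurable"
    using measurable_differentiable_image_eq[OF SS d in'] int' by blast
  have gS: "cvec ` (?g ` ?S) = f ` S" by (simp add: image_image)
  show "f ` S \<in> sets lebesgue"
    using emeasure_cvec_image(1)[of "?g ` ?S"] gm gS by (simp add: fmeasurableD)
  have "leb (f ` S) = leb (?g ` ?S)"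
    using emeasure_cvec_image(2)[of "?g ` ?S"] gm gS by (simp add: fmeasurableD)
  also have "\<dots> = ennreal (measure lebesgue (?g ` ?S))"
    using gm by (rule emeasure_eq_measure2)
  also have "measure lebesgue (?g ` ?S) = integral ?S D"
    using measure_differentiable_image_eq[OF SS d in' int'] det by simp
  also have "ennreal (integral ?S D) = (\<integral>\<^sup>+v. ennreal (D v * indicator ?S v) \<partial>lebesgue)"
  proof -
    have "((\<lambda>x. if x \<in> ?S then D x else 0) has_integral integral ?S D) UNIV"
      using int absolutely_integrable_on_def has_integral_restrict_UNIV by blast
    then have "integral\<^sup>N lebesgue (\<lambda>x. ennreal (if x \<in> ?S then D x else 0)) = ennreal (integral ?S D)"
      by (subst (asm) has_integral_iff_nn_integral_lebesgue) (auto simp: D_def)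
    moreover have "(\<lambda>x. ennreal (if x \<in> ?S then D x else 0)) = (\<lambda>v. ennreal (D v * indicator ?S v))"
      by (auto simp: indicator_def)
    ultimately show ?thesis by metis
  qed
  also have "\<dots> = (\<integral>\<^sup>+v. ennreal (D v) * indicator ?S v \<partial>lebesgue)"
    by (intro nn_integral_cong) (auto simp: indicator_def)
  \<comment> \<open>Pushing forward along \<open>cvec\<close> is done for Borel integrands, so
    \<open>S\<close> is replaced by its Borel part \<open>C\<close> before and restored
    after.\<close>
  also have "\<dots> = (\<integral>\<^sup>+z. ennreal ((cmod (f' z))\<^sup>2) * indicator S z \<partial>lebesgue)"
  proof -
    obtain C N where C: "S = C \<union> N" "C \<in> sets borel" "negligible N"
      using sets_lebesgue_almost_borel[OF Sl] by metis
    have nN: "N \<in> null_sets lebesgue" using C by (simp add: negligible_iff_null_sets)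
    have "negligible (vecc ` N)"
      by (rule negligible_differentiable_image_negligible)
        (use C in \<open>auto simp: negligible_iff_null_sets intro: linear_imp_differentiable_on[OF linear_vecc]\<close>)
    then have nN': "vecc ` N \<in> null_sets lebesgue" by (simp add: negligible_iff_null_sets)
    have v: "v \<in> vecc ` A \<longleftrightarrow> cvec v \<in> A" for v A
      by (metis cvec_vecc image_eqI image_iff vecc_cvec)
    have "(\<integral>\<^sup>+v. ennreal (D v) * indicator ?S v \<partial>lebesgue) = (\<integral>\<^sup>+v. ennreal (D v) * indicator C (cvec v) \<partial>lebesgue)"
      by (rule nn_integral_cong_AE, rule AE_I'[OF nN'])
         (auto simp: C(1) indicator_def v split: if_splits)
    also have "\<dots> = (\<integral>\<^sup>+v. ennreal (D v) * indicator C (cvec v) \<partial>lborel)"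
      using C Dm by (intro nn_integral_completion) 
    also have "\<dots> = (\<integral>\<^sup>+z. ennreal ((cmod (f' z))\<^sup>2) * indicator C z \<partial>distr lborel borel cvec)"
      using C meas unfolding D_def by (subst nn_integral_distr) auto
    also have "\<dots> = (\<integral>\<^sup>+z. ennreal ((cmod (f' z))\<^sup>2) * indicator C z \<partial>lborel)"
      by (simp add: distr_cvec_lborel)
    also have "\<dots> = (\<integral>\<^sup>+z. ennreal ((cmod (f' z))\<^sup>2) * indicator C z \<partial>lebesgue)"
      using C meas by (intro nn_integral_completion[symmetric])
    also have "\<dots> = (\<integral>\<^sup>+z. ennreal ((cmod (f' z))\<^sup>2) * indicator S z \<partial>lebesgue)"
      by (rule nn_integral_cong_AE, rule AE_I'[OF nN])
         (auto simp: C(1) indicator_def split: if_splits)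
    finally show ?thesis .
  qed
  finally show "leb (f ` S) = (\<integral>\<^sup>+z. ennreal ((cmod (f' z))\<^sup>2) * indicator S z \<partial>lebesgue)" .
qed

lemma holomorphic_image_emeasure_ge:
  fixes f :: "complex \<Rightarrow> complex"
  assumes S: "S \<in> lmeasurable"
    and der: "\<And>z. z \<in> S \<Longrightarrow> (f has_field_derivative f' z) (at z)"
    and inj: "inj_on f S"
    and bd: "\<And>z. z \<in> S \<Longrightarrow> cmod (f' z) \<le> B" "\<And>z. z \<in> S \<Longrightarrow> b \<le> cmod (f' z)" "0 \<le> b"
    and meas: "f' \<in> borel_measurable borel"
  shows "leb S * ennreal (b\<^sup>2) \<le> leb (f ` S)"
proof -
  have "leb S * ennreal (b\<^sup>2) = (\<integral>\<^sup>+z. ennreal (b\<^sup>2) * indicator S z \<partial>lebesgue)"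
    using nn_integral_cmult_indicator[of S lebesgue "ennreal (b\<^sup>2)"] S by (simp only: mult.commute fmeasurableD)
  also have "\<dots> \<le> (\<integral>\<^sup>+z. ennreal ((cmod (f' z))\<^sup>2) * indicator S z \<partial>lebesgue)"
    using bd(2,3) by (intro nn_integral_mono) (auto simp: indicator_def intro!: ennreal_leI power_mono)
  also have "\<dots> = leb (f ` S)"
    by (rule holomorphic_image_emeasure(2)[OF S der inj bd(1) meas, symmetric])
  finally show ?thesis .
qed

section \<open>The ideal and the hexagon in coordinates\<close>

text \<open>The coordinates of \<open>z = y + x \<zeta>\<close>.\<close>

definition Xc :: "complex \<Rightarrow> real" where "Xc z = 2 * Im z / sqrt 3"
definition Yc :: "complex \<Rightarrow> real" where "Yc z = Re z - Im z / sqrt 3"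

lemma Xc_simps [simp]: "Xc (z + w) = Xc z + Xc w" "Xc (z - w) = Xc z - Xc w" "Xc (- z) = - Xc z"
    "Xc 0 = 0" "Xc (of_real r * z) = r * Xc z" "Xc (z * of_real r) = r * Xc z"
  by (simp_all add: Xc_def add_divide_distrib diff_divide_distrib algebra_simps)

lemma Yc_simps [simp]: "Yc (z + w) = Yc z + Yc w" "Yc (z - w) = Yc z - Yc w" "Yc (- z) = - Yc z"
    "Yc 0 = 0" "Yc (of_real r * z) = r * Yc z" "Yc (z * of_real r) = r * Yc z"
  by (simp_all add: Yc_def add_divide_distrib diff_divide_distrib algebra_simps)

lemma Re_zeta [simp]: "Re zeta = 1/2" and Im_zeta [simp]: "Im zeta = sqrt 3 / 2"
  by (simp_all add: zeta_def)

lemma coords_eq: "z = of_real (Yc z) + of_real (Xc z) * zeta"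
  by (simp add: complex_eq_iff Xc_def Yc_def)

lemma Xc_of [simp]: "Xc (of_real y + of_real x * zeta) = x"
  and Yc_of [simp]: "Yc (of_real y + of_real x * zeta) = y"
  by (simp_all add: Xc_def Yc_def)

lemma Xc_of_real [simp]: "Xc (of_real r) = 0" and Yc_of_real [simp]: "Yc (of_real r) = r"
  by (simp_all add: Xc_def Yc_def)

lemma coords_inject: "z = w \<longleftrightarrow> Xc z = Xc w \<and> Yc z = Yc w"
  by (metis coords_eq)

lemma cmod_coords: "(cmod z)\<^sup>2 = (Xc z)\<^sup>2 + Xc z * Yc z + (Yc z)\<^sup>2"
proof -
  have "Im z * Im z * 3 = Im z * Im z * (sqrt 3 * sqrt 3)" by simp
  then show ?thesis
    unfolding cmod_power2 Xc_def Yc_def by (simp add: field_simps power2_eq_square)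
qed

lemma Xc_zeta_mult [simp]: "Xc (zeta * z) = Xc z + Yc z"
  and Yc_zeta_mult [simp]: "Yc (zeta * z) = - Xc z"
  by (simp_all add: Xc_def Yc_def field_simps)

lemma Xc_1 [simp]: "Xc 1 = 0" and Yc_1 [simp]: "Yc 1 = 1"
  and Xc_zeta [simp]: "Xc zeta = 1" and Yc_zeta [simp]: "Yc zeta = 0"
  by (simp_all add: Xc_def Yc_def)

lemma zeta_pow [simp]: "zeta ^ 2 = zeta - 1" "zeta ^ 3 = -1" "zeta ^ 4 = - zeta" "zeta ^ 5 = 1 - zeta" "zeta ^ 6 = 1"
  by (simp_all add: coords_inject eval_nat_numeral)

lemma cnj_zeta: "cnj zeta = 1 - zeta" by (simp add: complex_eq_iff)

lemma cmod_zeta [simp]: "cmod zeta = 1"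
  using cmod_coords[of zeta] by (simp add: power2_eq_1_iff) (smt (verit) norm_ge_zero)

lemma zeta_nonzero [simp]: "zeta \<noteq> 0" by (auto simp: complex_eq_iff)

lemma Xc_cnj [simp]: "Xc (cnj z) = - Xc z" and Yc_cnj [simp]: "Yc (cnj z) = Xc z + Yc z"
  by (simp_all add: Xc_def Yc_def)

lemma continuous_Xc [continuous_intros]: "continuous_on A f \<Longrightarrow> continuous_on A (\<lambda>x. Xc (f x))"
  and continuous_Yc [continuous_intros]: "continuous_on A f \<Longrightarrow> continuous_on A (\<lambda>x. Yc (f x))"
  unfolding Xc_def Yc_def by (intro continuous_intros; simp)+

lemma Xc_borel [measurable]: "Xc \<in> borel_measurable borel"
  and Yc_borel [measurable]: "Yc \<in> borel_measurable borel"
  by (intro borel_measurable_continuous_onI continuous_intros)+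

text \<open>The first argument is the coefficient of \<open>zeta\<close>, matching the pair
  (\<open>Xc\<close>, \<open>Yc\<close>); \<open>eisenstein_integers\<close> lists the coefficients
  in the opposite order.\<close>

definition latt :: "int \<Rightarrow> int \<Rightarrow> complex" where "latt m n = of_real (of_int n) + of_real (of_int m) * zeta"

lemma Xc_latt [simp]: "Xc (latt m n) = of_int m" and Yc_latt [simp]: "Yc (latt m n) = of_int n"
  by (simp_all only: latt_def Xc_of Yc_of)

lemma eta_eq: "eta = 1 + zeta" by (simp add: complex_eq_iff eta_def)

text \<open>Since \<open>eta\<close> = 1 + \<open>zeta\<close> has norm 3, the ideal has index 3 in
  the Eisenstein integers and one congruence describes it: multiplying m + n zeta by
  \<open>eta\<close> gives the coordinates m + 2 n and m - n, which differ by 3 n.\<close>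

lemma J_ideal_iff: "a \<in> J_ideal \<longleftrightarrow> (\<exists>m n. a = latt m n \<and> 3 dvd m - n)"
proof -
  have lin: "of_int m + of_int n * zeta = latt n m" for m n
    by (simp add: latt_def)
  have prod: "eta * latt n m = latt (m + 2 * n) (m - n)" for m n
    by (simp add: coords_inject eta_eq distrib_right)
  show ?thesis
  proof
    assume "a \<in> J_ideal"
    then obtain m n where "a = latt (m + 2 * n) (m - n)"
      unfolding J_ideal_def eisenstein_integers_def lin using prod by auto
    moreover have "m + 2 * n - (m - n) = 3 * n" by simp
    ultimately show "\<exists>m n. a = latt m n \<and> 3 dvd m - n" by (metis dvd_triv_left)
  next
    assume "\<exists>m n. a = latt m n \<and> 3 dvd m - n"
    then obtain m n k where a: "a = latt m n" "m - n = 3 * k" by (auto elim: dvdE)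
    then have "m = (n + k) + 2 * k" "n = (n + k) - k" by simp_all
    then have "a = eta * latt k (n + k)" using a prod by metis
    then show "a \<in> J_ideal" unfolding J_ideal_def eisenstein_integers_def lin by blast
  qed
qed

section \<open>The hexagon as a system of linear inequalities, and the tiling by its
  translates\<close>

definition hexo :: "complex set" where
  "hexo = {z. \<bar>Xc z\<bar> < 1 \<and> \<bar>Yc z\<bar> < 1 \<and> \<bar>Xc z + Yc z\<bar> < 1}"

lemma open_hexo: "open hexo"
  unfolding hexo_def
  by (intro open_Collect_conj open_Collect_less continuous_intros)

lemma zeta_pow_set: "{zeta ^ k | k :: nat. k \<le> 5} = {1, zeta, zeta - 1, -1, -zeta, 1 - zeta}"
proof -
  have "{k::nat. k \<le> 5} = {0,1,2,3,4,5}" by auto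
  moreover have "{zeta ^ k | k :: nat. k \<le> 5} = (\<lambda>k. zeta ^ k) ` {k::nat. k \<le> 5}" by auto
  ultimately show ?thesis by simp
qed

lemma hull_coords_le:
  assumes "z \<in> convex hull {zeta ^ k | k :: nat. k \<le> 5}"
  shows "\<bar>Xc z\<bar> \<le> 1 \<and> \<bar>Yc z\<bar> \<le> 1 \<and> \<bar>Xc z + Yc z\<bar> \<le> 1"
proof -
  let ?C = "{z. \<bar>Xc z\<bar> \<le> 1 \<and> \<bar>Yc z\<bar> \<le> 1 \<and> \<bar>Xc z + Yc z\<bar> \<le> 1}"
  have c: "\<bar>u * a + v * b\<bar> \<le> 1" if "\<bar>a\<bar> \<le> 1" "\<bar>b\<bar> \<le> 1" "0 \<le> u" "0 \<le> v" "u + v = 1" for a b u v :: real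
  proof -
    have "\<bar>u * a + v * b\<bar> \<le> u * \<bar>a\<bar> + v * \<bar>b\<bar>"
      using that abs_triangle_ineq[of "u * a" "v * b"] by (simp add: abs_mult)
    also have "\<dots> \<le> u * 1 + v * 1" using that by (intro add_mono mult_left_mono) auto
    finally show ?thesis using that by simp
  qed
  have "convex ?C"
  proof (rule convexI)
    fix x y u v assume *: "x \<in> ?C" "y \<in> ?C" "0 \<le> (u::real)" "0 \<le> v" "u + v = 1"
    have "Xc (u *\<^sub>R x + v *\<^sub>R y) + Yc (u *\<^sub>R x + v *\<^sub>R y) = u * (Xc x + Yc x) + v * (Xc y + Yc y)"
      by (simp add: scaleR_conv_of_real algebra_simps)
    then show "u *\<^sub>R x + v *\<^sub>R y \<in> ?C"
      using * by (auto simp: scaleR_conv_of_real intro!: c simp del: distrib_left)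
  qed
  then have "convex hull {zeta ^ k | k :: nat. k \<le> 5} \<subseteq> ?C"
    by (intro hull_minimal) (auto simp: zeta_pow_set)
  then show ?thesis using assms by blast
qed

text \<open>In a basis chosen by the signs of the coordinates (\<open>zeta\<close> and 1,
  \<open>zeta\<close> and \<open>zeta - 1\<close>, or 1 and \<open>zeta - 1\<close>) the
  coefficients satisfy |p| + |q| <= 1, so z lies in a triangle with corners 0 and two points of
  \<open>S\<close>.\<close>

lemma hexo_subset_hull: "hexo \<subseteq> convex hull {zeta ^ k | k :: nat. k \<le> 5}"
proof
  fix z assume z: "z \<in> hexo"
  define S where "S = {1, zeta, zeta - 1, -1, -zeta, 1 - zeta}"
  have H: "convex (convex hull S)" by (rule convex_convex_hull)
  have 0: "0 \<in> convex hull S"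
    using convexD[OF H, of 1 "-1" "1/2" "1/2"] by (auto simp: hull_inc S_def)
  have key: "of_real p * a + of_real q * b \<in> convex hull S"
    if "a \<in> S" "b \<in> S" "0 \<le> p" "0 \<le> q" "p + q \<le> 1" for a b and p q :: real
  proof -
    have "convex hull {0, a, b} \<subseteq> convex hull S"
      using that 0 by (intro hull_minimal H) (auto simp: hull_inc)
    moreover have "\<exists>u v w. 0 \<le> u \<and> 0 \<le> v \<and> 0 \<le> w \<and> u + v + w = 1 \<and>
         of_real p * a + of_real q * b = u *\<^sub>R 0 + v *\<^sub>R a + w *\<^sub>R b"
      using that by (intro exI[of _ "1 - p - q"] exI[of _ p] exI[of _ q]) (simp add: scaleR_conv_of_real)
    ultimately show ?thesis unfolding convex_hull_3 by blast
  qed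
  have key': "of_real p * a + of_real q * b \<in> convex hull S"
    if "a \<in> S" "- a \<in> S" "b \<in> S" "- b \<in> S" "\<bar>p\<bar> + \<bar>q\<bar> \<le> 1" for a b and p q :: real
    using key[of a b p q] key[of a "- b" p "- q"] key[of "- a" b "- p" q] key[of "- a" "- b" "- p" "- q"] that
    by (cases "0 \<le> p"; cases "0 \<le> q") auto
  let ?x = "Xc z" and ?y = "Yc z"
  have b: "\<bar>?x\<bar> < 1" "\<bar>?y\<bar> < 1" "\<bar>?x + ?y\<bar> < 1" using z by (auto simp: hexo_def)
  then have "\<bar>?x\<bar> + \<bar>?y\<bar> \<le> 1 \<or> \<bar>?x + ?y\<bar> + \<bar>- ?y\<bar> \<le> 1 \<or> \<bar>?x + ?y\<bar> + \<bar>?x\<bar> \<le> 1"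
    by (auto simp: abs_if split: if_splits)
  then have "z \<in> convex hull S"
    using key'[of zeta 1 ?x ?y] key'[of zeta "zeta - 1" "?x + ?y" "- ?y"] key'[of 1 "zeta - 1" "?x + ?y" ?x] coords_eq[of z]
    by (auto simp: S_def algebra_simps)
  then show "z \<in> convex hull {zeta ^ k | k :: nat. k \<le> 5}" by (simp add: zeta_pow_set S_def)
qed

lemma open_hexagon_eq: "open_hexagon = hexo"
proof
  show "hexo \<subseteq> open_hexagon"
    unfolding open_hexagon_def by (rule interior_maximal[OF hexo_subset_hull open_hexo])
  show "open_hexagon \<subseteq> hexo"
  proof
    fix z assume z: "z \<in> open_hexagon"
    then obtain e where e: "e > 0" "ball z e \<subseteq> convex hull {zeta ^ k | k :: nat. k \<le> 5}"
      unfolding open_hexagon_def mem_interior by blast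
    \<comment> \<open>Steps of length t along the vertices are enough: moving by t along plus or
      minus \<open>zeta\<close> or 1 changes a coordinate by t, which makes the weak bounds on the
      hull strict.\<close>
    define t where "t = e / 2"
    have t: "0 < t" "t < e" using e by (auto simp: t_def)
    have m: "\<bar>Xc (z + of_real t * w)\<bar> \<le> 1 \<and> \<bar>Yc (z + of_real t * w)\<bar> \<le> 1
        \<and> \<bar>Xc (z + of_real t * w) + Yc (z + of_real t * w)\<bar> \<le> 1" if "cmod w = 1" for w
    proof (rule hull_coords_le)
      have "z + of_real t * w \<in> ball z e" using t that by (simp add: dist_norm norm_mult)
      then show "z + of_real t * w \<in> convex hull {zeta ^ k | k :: nat. k \<le> 5}" using e by blast
    qed
    have sq: "\<bar>x\<bar> < 1" if "\<bar>x + t\<bar> \<le> 1" "\<bar>x - t\<bar> \<le> 1" for x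
      using that t by linarith
    have "\<bar>Xc z\<bar> < 1" using m[of zeta] m[of "-zeta"] by (intro sq) simp_all
    moreover have "\<bar>Yc z\<bar> < 1" using m[of 1] m[of "-1"] by (intro sq) simp_all
    moreover have "\<bar>Xc z + Yc z\<bar> < 1" using m[of 1] m[of "-1"] by (intro sq) (simp_all add: algebra_simps)
    ultimately show "z \<in> hexo" by (simp add: hexo_def)
  qed
qed

lemma open_segment_coords:
  "z \<in> open_segment a b \<longleftrightarrow> a \<noteq> b \<and> (\<exists>u. 0 < u \<and> u < 1 \<and> Xc z = (1 - u) * Xc a + u * Xc b \<and> Yc z = (1 - u) * Yc a + u * Yc b)"
  unfolding in_segment coords_inject[of z] by (simp add: scaleR_conv_of_real flip: of_real_diff)

text \<open>The boundary part has one side of each opposite pair and one vertex of each of the two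
  classes of vertices modulo \<open>J_ideal\<close>. In this form the tiling property is linear
  arithmetic.\<close>

lemma U_dom_iff:
  "z \<in> U_dom \<longleftrightarrow> (\<bar>Xc z\<bar> < 1 \<and> \<bar>Yc z\<bar> < 1 \<and> \<bar>Xc z + Yc z\<bar> < 1)
     \<or> (Xc z = 1 \<and> -1 < Yc z \<and> Yc z < 0)
     \<or> (Xc z + Yc z = -1 \<and> -1 < Xc z \<and> Xc z < 0)
     \<or> (Yc z = 1 \<and> -1 < Xc z \<and> Xc z < 0)
     \<or> (Xc z = -1 \<and> Yc z = 0) \<or> (Xc z = -1 \<and> Yc z = 1)"
proof -
  have 1: "z \<in> open_segment zeta (- cnj zeta) \<longleftrightarrow> Xc z = 1 \<and> -1 < Yc z \<and> Yc z < 0"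
    unfolding open_segment_coords by (auto simp: cnj_zeta coords_inject intro: exI[of _ "- Yc z"])
  have 2: "z \<in> open_segment (- zeta) (- 1) \<longleftrightarrow> Xc z + Yc z = -1 \<and> -1 < Xc z \<and> Xc z < 0"
    unfolding open_segment_coords by (auto simp: coords_inject intro: exI[of _ "1 + Xc z"])
  have 3: "z \<in> open_segment 1 (cnj zeta) \<longleftrightarrow> Yc z = 1 \<and> -1 < Xc z \<and> Xc z < 0"
    unfolding open_segment_coords by (auto simp: coords_inject cnj_zeta intro: exI[of _ "- Xc z"])
  have 4: "z \<in> {- zeta, cnj zeta} \<longleftrightarrow> (Xc z = -1 \<and> Yc z = 0) \<or> (Xc z = -1 \<and> Yc z = 1)"
    by (auto simp: coords_inject cnj_zeta)
  show ?thesis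
    unfolding U_dom_def open_hexagon_eq Un_iff 1 2 3 4 by (simp add: hexo_def)
qed

lemma U_dom_borel [measurable]: "U_dom \<in> sets borel"
proof -
  have "{z. z \<in> U_dom} \<in> sets borel" unfolding U_dom_iff by measurable
  then show ?thesis by simp
qed

lemma hexo_subset_U: "hexo \<subseteq> U_dom" by (auto simp: U_dom_iff hexo_def)

lemma U_coords_le: "z \<in> U_dom \<Longrightarrow> \<bar>Xc z\<bar> \<le> 1 \<and> \<bar>Yc z\<bar> \<le> 1 \<and> \<bar>Xc z + Yc z\<bar> \<le> 1"
  unfolding U_dom_iff by auto

text \<open>The solutions are 0 and the six elements of \<open>J_ideal\<close> of least nonzero
  norm: only these translates of the closed hexagon can touch it.\<close>

lemma hex_int: fixes p q k :: int assumes "p - q = 3 * k" "-2 \<le> p" "p \<le> 2" "-2 \<le> q" "q \<le> 2" "-2 \<le> p + q" "p + q \<le> 2"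
 shows "(p = 0 \<and> q = 0) \<or> (p = 1 \<and> q = 1) \<or> (p = -1 \<and> q = -1) \<or> (p = 2 \<and> q = -1)
    \<or> (p = -2 \<and> q = 1) \<or> (p = 1 \<and> q = -2) \<or> (p = -1 \<and> q = 2)"
proof -
  have p: "p = q + 3 * k" using assms by linarith
  have "k < 2" "k > -2" using assms by linarith+
  then consider "k = -1" | "k = 0" | "k = 1" by linarith
  then show ?thesis
  proof cases
    case 1
    have "q = 1 \<or> q = 2" using assms 1 unfolding p by presburger
    then show ?thesis using p 1 by auto
  next
    case 2
    have "q = 0 \<or> q = 1 \<or> q = -1" using assms 2 unfolding p by presburger
    then show ?thesis using p 2 by auto
  next
    case 3
    have "q = -1 \<or> q = -2" using assms 3 unfolding p by presburger
    then show ?thesis using p 3 by auto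
  qed
qed

lemma U_tiling_unique:
  assumes "z - a \<in> U_dom" "z - b \<in> U_dom" "a \<in> J_ideal" "b \<in> J_ideal"
  shows "a = b"
proof -
  obtain m n where a: "a = latt m n" "3 dvd m - n" using assms J_ideal_iff by blast
  obtain m' n' where b: "b = latt m' n'" "3 dvd m' - n'" using assms J_ideal_iff by blast
  define p q where "p = m - m'" and "q = n - n'"
  have "p - q = (m - n) - (m' - n')" by (simp add: p_def q_def)
  then have d: "3 dvd p - q" using a b by (metis dvd_diff)
  define x y where "x = Xc (z - a)" and "y = Yc (z - a)"
  have xy': "Xc (z - b) = x + of_int p" "Yc (z - b) = y + of_int q"
    by (simp_all add: a b x_def y_def p_def q_def)
  have u1: "z - a \<in> U_dom" and u2: "z - b \<in> U_dom" using assms by auto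
  have "\<bar>of_int p :: real\<bar> \<le> 2" "\<bar>of_int q :: real\<bar> \<le> 2" "\<bar>of_int p + of_int q :: real\<bar> \<le> 2"
    using U_coords_le[OF u1] U_coords_le[OF u2] unfolding xy' x_def[symmetric] y_def[symmetric] by linarith+
  then have "\<bar>p\<bar> \<le> 2" "\<bar>q\<bar> \<le> 2" "\<bar>p + q\<bar> \<le> 2" by linarith+
  moreover obtain k where k: "p - q = 3 * k" using d by (auto elim: dvdE)
  ultimately have "(p = 0 \<and> q = 0) \<or> (p = 1 \<and> q = 1) \<or> (p = -1 \<and> q = -1) \<or> (p = 2 \<and> q = -1)
    \<or> (p = -2 \<and> q = 1) \<or> (p = 1 \<and> q = -2) \<or> (p = -1 \<and> q = 2)"
    by (intro hex_int[of p q k]) linarith+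
  then consider "p = 0 \<and> q = 0" | "p = 1 \<and> q = 1" | "p = -1 \<and> q = -1" | "p = 2 \<and> q = -1"
    | "p = -2 \<and> q = 1" | "p = 1 \<and> q = -2" | "p = -1 \<and> q = 2"
    by blast
  then have "p = 0 \<and> q = 0"
    by cases (use u1 u2 in \<open>unfold U_dom_iff xy' x_def[symmetric] y_def[symmetric], auto\<close>)
  then show ?thesis by (simp add: a b p_def q_def)
qed

definition in_U :: "real \<Rightarrow> real \<Rightarrow> bool" where
  "in_U x y \<longleftrightarrow> of_real y + of_real x * zeta \<in> U_dom"

lemma U_dom_in_U: "z \<in> U_dom \<longleftrightarrow> in_U (Xc z) (Yc z)"
  unfolding in_U_def by (subst coords_eq) (rule refl)

lemmas in_U_iff = in_U_def[unfolded U_dom_iff Xc_of Yc_of]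

text \<open>After removing integer parts, z lies in a unit parallelogram and the residue of i - j
  modulo 3 decides which nearby lattice points belong to the ideal. The special cases f = 0 and g =
  0 come from the half of the boundary that \<open>U_dom\<close> lacks.\<close>

lemma U_tiling_exists: "\<exists>a \<in> J_ideal. z - a \<in> U_dom"
proof -
  define i j where "i = \<lfloor>Xc z\<rfloor>" and "j = \<lfloor>Yc z\<rfloor>"
  define f g where "f = Xc z - of_int i" and "g = Yc z - of_int j"
  have fg: "0 \<le> f" "f < 1" "0 \<le> g" "g < 1" unfolding f_def g_def i_def j_def by linarith+
  have main: ?thesis if "3 dvd (i + p) - (j + q)" "in_U (f - of_int p) (g - of_int q)" for p q
  proof
    show "latt (i + p) (j + q) \<in> J_ideal" using that(1) J_ideal_iff by blast
    have *: "Xc (z - latt (i + p) (j + q)) = f - of_int p" "Yc (z - latt (i + p) (j + q)) = g - of_int q"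
      by (simp_all add: f_def g_def)
    show "z - latt (i + p) (j + q) \<in> U_dom" unfolding U_dom_in_U * using that(2) .
  qed
  have "3 dvd i - j \<or> 3 dvd i - j - 1 \<or> 3 dvd i - j + 1" by presburger
  then consider "3 dvd i - j" | "3 dvd i - j - 1" | "3 dvd i - j + 1" by blast
  then show ?thesis
  proof cases
    case 1
    show ?thesis
    proof (cases "f + g < 1")
      case True then show ?thesis using main[of 0 0] 1 fg by (simp add: in_U_iff)
    next
      case False then show ?thesis using main[of 1 1] 1 fg by (simp add: in_U_iff) linarith
    qed
  next
    case 2
    show ?thesis
    proof (cases "g = 0")
      case True
      have "3 dvd i - j + 2" using 2 by presburger
      then show ?thesis using main[of 1 "-1"] fg True by (force simp: in_U_iff algebra_simps)
    next
      case False then show ?thesis using main[of 0 1] 2 fg by (simp add: in_U_iff algebra_simps)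
    qed
  next
    case 3
    show ?thesis
    proof (cases "f = 0 \<and> g > 0")
      case True
      have "3 dvd i - j - 2" using 3 by presburger
      then show ?thesis using main[of "-1" 1] fg True by (simp add: in_U_iff algebra_simps)
    next
      case False then show ?thesis using main[of 1 0] 3 fg by (cases "f = 0") (auto simp: in_U_iff algebra_simps abs_less_iff)
    qed
  qed
qed

lemma J_part_eqI: "a \<in> J_ideal \<Longrightarrow> z - a \<in> U_dom \<Longrightarrow> J_part z = a"
proof -
  have *: "z \<in> (\<lambda>u. b + u) ` U_dom \<longleftrightarrow> z - b \<in> U_dom" for b
    by (metis (no_types, lifting) add.commute diff_add_cancel image_iff add_diff_cancel_left')
  assume "a \<in> J_ideal" "z - a \<in> U_dom"
  then show ?thesis
    unfolding J_part_def * by (intro the_equality) (auto intro: U_tiling_unique)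
qed

lemma J_part_J: "J_part z \<in> J_ideal" and J_part_U: "z - J_part z \<in> U_dom"
  using U_tiling_exists[of z] J_part_eqI by auto

section \<open>Cells and digits\<close>

text \<open>The norm form: |z|^2 for z = y + x zeta, see \<open>nf_coords\<close>.\<close>

definition nf :: "real \<Rightarrow> real \<Rightarrow> real" where "nf x y = x\<^sup>2 + x * y + y\<^sup>2"

text \<open>The coordinates of \<open>zeta ^ i * z\<close> (see \<open>Xc_rot\<close>), tabulated so
  that every rotation evaluates to a linear expression.\<close>

definition rotx :: "nat \<Rightarrow> real \<Rightarrow> real \<Rightarrow> real" where
  "rotx i x y = [x, x + y, y, - x, - x - y, - y] ! i"
definition roty :: "nat \<Rightarrow> real \<Rightarrow> real \<Rightarrow> real" where
  "roty i x y = [y, - x, - x - y, - y, x, x + y] ! i"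

text \<open>
  \<open>cell0 0\<close> is the open sector of the hexagon between the vertices \<open>1\<close> and \<open>\<zeta>\<close>; the types 1, 2, 3 remove
  from it the disc reflected in its outer side, and the circumdiscs of the two neighbouring sectors.
  \<open>dual_cell0 t\<close> contains the inverses \<open>1 / cnj p\<close> of the poles \<open>p\<close> of the inverse branches defined on a
  cell of type \<open>t\<close>; its norm condition says \<open>|p| \<ge> 1\<close>, and the others make that condition inductive.
\<close>

definition cell0 :: "nat \<Rightarrow> real \<Rightarrow> real \<Rightarrow> bool" where
  "cell0 t x y \<longleftrightarrow> 0 < x \<and> 0 < y \<and> x + y < 1 \<and> (t = 1 \<longrightarrow> 2 * (x + y) < 1 + nf x y)
     \<and> (t = 2 \<longrightarrow> x < nf x y) \<and> (t = 3 \<longrightarrow> y < nf x y)"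

definition dual_cell0 :: "nat \<Rightarrow> real \<Rightarrow> real \<Rightarrow> bool" where
  "dual_cell0 t x y \<longleftrightarrow> nf x y \<le> 1 \<and> (t \<noteq> 1 \<longrightarrow> 3 * (x + y) \<le> 1 + 2 * nf x y) \<and> (t = 1 \<longrightarrow> 3 * (x + y) \<le> nf x y + 2)
     \<and> (t \<noteq> 2 \<longrightarrow> 3 * x \<le> nf x y + 2) \<and> (t \<noteq> 3 \<longrightarrow> 3 * y \<le> nf x y + 2)"

text \<open>
  \<open>(m, n)\<close> are the coordinates of a digit \<open>a\<close>, and \<open>i\<close> numbers the sector of \<open>w\<close> by the rotation \<open>\<zeta>\<^sup>i\<close>
  that brings it to \<open>cell0 0\<close>: then \<open>\<zeta> / (a + w)\<close> lies in the cell of type \<open>t\<close> iff \<open>adm t m n i\<close> and \<open>w\<close>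
  lies in the cell of type \<open>nxt t m n i\<close> of its sector.
\<close>

definition adm :: "nat \<Rightarrow> int \<Rightarrow> int \<Rightarrow> nat \<Rightarrow> bool" where
  "adm t m n i \<longleftrightarrow> 0 \<le> m \<and> 0 \<le> n \<and> \<not> (m = 0 \<and> n = 0) \<and> (m = 0 \<longrightarrow> i \<in> {0, 4, 5}) \<and> (n = 0 \<longrightarrow> i \<in> {0, 1, 2})
     \<and> (t = 1 \<and> m = 1 \<and> n = 1 \<longrightarrow> i \<noteq> 3) \<and> (t = 2 \<longrightarrow> n = 0 \<or> n = 1 \<and> i \<in> {3, 4, 5})
     \<and> (t = 3 \<longrightarrow> m = 0 \<or> m = 1 \<and> i \<in> {1, 2, 3})"

definition nxt :: "nat \<Rightarrow> int \<Rightarrow> int \<Rightarrow> nat \<Rightarrow> nat" where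
  "nxt t m n i = (if m = 1 \<and> n = 1 then
      (if t = 1 then (if i = 4 then 2 else if i = 2 then 3 else 0) else if i = 3 then 1 else 0) else 0)"

lemma less6_cases: "i < (6::nat) \<Longrightarrow> i = 0 \<or> i = 1 \<or> i = 2 \<or> i = 3 \<or> i = 4 \<or> i = 5" by linarith

lemma nf_rot: "i < 6 \<Longrightarrow> nf (rotx i x y) (roty i x y) = nf x y"
  by (drule less6_cases) (auto simp: rotx_def roty_def nf_def power2_eq_square algebra_simps numeral_eq_Suc)

lemma cell0_base: "cell0 t x y \<Longrightarrow> cell0 0 x y" by (simp add: cell0_def)

lemma sector_signs:
  assumes "i < 6" "cell0 0 (rotx i u v) (roty i u v)"
  shows "\<bar>u\<bar> < 1 \<and> \<bar>v\<bar> < 1 \<and> \<bar>u + v\<bar> < 1"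
    "0 < u \<longleftrightarrow> i \<in> {0, 4, 5}" "u < 0 \<longleftrightarrow> i \<in> {1, 2, 3}" "0 < v \<longleftrightarrow> i \<in> {0, 1, 2}" "v < 0 \<longleftrightarrow> i \<in> {3, 4, 5}"
  using less6_cases[OF assms(1)] assms(2)
  by (elim disjE; auto simp: cell0_def rotx_def roty_def numeral_eq_Suc)+

lemma nf_ge: "3 * (x + y)\<^sup>2 \<le> 4 * nf x y"
proof -
  have "4 * nf x y - 3 * (x + y)\<^sup>2 = (x - y)\<^sup>2" by (simp add: nf_def power2_eq_square algebra_simps)
  then show ?thesis by (metis diff_ge_0_iff_ge zero_le_power2)
qed

text \<open>Modulo 3, no other nonnegative pair with sum at most 2 survives. So (1, 1) is the only
  digit of the closed quadrant for which the disc conditions of the cells are not automatic.\<close>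

lemma digit_sum_ge_3:
  assumes "3 dvd m - (n::int)" "0 \<le> m" "0 \<le> n" "\<not> (m = 0 \<and> n = 0)" "\<not> (m = 1 \<and> n = 1)"
  shows "3 \<le> m + n"
  using assms by presburger

text \<open>For S = X + Y > 2 the estimate nf >= 3/4 S^2 and (S - 2) (3 S - 2) > 0 give the second
  inequality, and the first follows from it. No arc cuts the sector of w, so the next cell is a
  whole sector.\<close>

lemma far_digit:
  assumes "3 dvd m - (n::int)" "0 \<le> m" "0 \<le> n" "\<not> (m = 0 \<and> n = 0)" "\<not> (m = 1 \<and> n = 1)" "-1 < u + v"
  shows "of_int m + u + (of_int n + v) < nf (of_int m + u) (of_int n + v)"
    "2 * (of_int m + u + (of_int n + v)) < 1 + nf (of_int m + u) (of_int n + v)"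
proof -
  let ?S = "of_int m + u + (of_int n + v)" and ?M = "nf (of_int m + u) (of_int n + v)"
  have "real_of_int 3 \<le> of_int (m + n)" using digit_sum_ge_3[OF assms(1-5)] of_int_le_iff by blast
  then have S: "2 < ?S" using assms(6) by simp
  have "3 * (?S * ?S) \<le> 4 * ?M" using nf_ge[of "of_int m + u" "of_int n + v"] by (simp add: power2_eq_square)
  moreover have "0 < (?S - 2) * (3 * ?S - 2)" using S by (intro mult_pos_pos) auto
  then have "8 * ?S < 3 * (?S * ?S) + 4" by (simp add: algebra_simps)
  ultimately have 2: "2 * ?S < 1 + ?M" by linarith
  show "2 * ?S < 1 + ?M" by (rule 2)
  have "A < B" if "2 < A" "2 * A < 1 + B" for A B :: real using that by linarith
  from this[OF S 2] show "?S < ?M" .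
qed

text \<open>The left-hand side says that w lies outside the disc of squared radius 1/3 about -2/3 (1
  + zeta), the circumdisc of sector 3 reflected in its outer side. That disc meets no other
  sector.\<close>

lemma near_digit_D:
  assumes "i < 6" "cell0 0 (rotx i u v) (roty i u v)"
  shows "0 < 1 + nf u v + 2 * (u + v) \<longleftrightarrow> cell0 (if i = 3 then 1 else 0) (rotx i u v) (roty i u v)"
proof (cases "i = 3")
  case True
  then show ?thesis using assms by (auto simp: cell0_def rotx_def roty_def nf_def)
next
  case False
  note s = sector_signs[OF assms]
  have "0 < 1 + nf u v + 2 * (u + v)"
  proof (cases "u \<ge> 0")
    case True
    have "0 \<le> u * (u + v + 2)" using s True by (intro mult_nonneg_nonneg) auto
    moreover have "0 < (1 + v)\<^sup>2" using s by auto
    ultimately show ?thesis by (simp add: nf_def power2_eq_square algebra_simps)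
  next
    case False
    then have "v > 0" using s \<open>i \<noteq> 3\<close> by auto
    then have "0 \<le> v * (u + v + 2)" using s by (intro mult_nonneg_nonneg) auto
    moreover have "0 < (1 + u)\<^sup>2" using s by auto
    ultimately show ?thesis by (simp add: nf_def power2_eq_square algebra_simps)
  qed
  then show ?thesis using False assms by simp
qed

text \<open>The left-hand side says that w lies outside the circumdisc of sector 3. Sector 3 lies
  inside it and disappears; its neighbours 4 and 2 lose a circular segment, which is the origin of
  types 2 and 3.\<close>

lemma near_digit_E:
  assumes "i < 6" "cell0 0 (rotx i u v) (roty i u v)"
  shows "0 < nf u v + (u + v) \<longleftrightarrow> i \<noteq> 3 \<and> cell0 (if i = 4 then 2 else if i = 2 then 3 else 0) (rotx i u v) (roty i u v)"
proof -
  have "i = 3 \<Longrightarrow> nf u v + (u + v) < 0"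
  proof -
    assume "i = 3"
    then have p: "u < 0" "v < 0" "-1 < u + v" using sector_signs[OF assms] by auto
    then have "nf u v \<le> (u + v)\<^sup>2" by (simp add: nf_def power2_eq_square algebra_simps mult_nonpos_nonpos)
    moreover have "(u + v) * (u + v + 1) < 0" using p by (intro mult_neg_pos) auto
    ultimately show ?thesis by (simp add: power2_eq_square algebra_simps)
  qed
  moreover have "0 < nf u v + (u + v)" if "i = 0 \<or> i = 1 \<or> i = 5"
  proof -
    have "0 < u + v" using that assms by (auto simp: cell0_def rotx_def roty_def)
    moreover have "0 \<le> nf u v" using nf_ge[of u v] by (smt (verit) zero_le_power2)
    ultimately show ?thesis by linarith
  qed
  moreover have "i = 4 \<Longrightarrow> ?thesis" "i = 2 \<Longrightarrow> ?thesis"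
    using assms nf_rot[of i u v] by (auto simp: cell0_def rotx_def roty_def)
  ultimately show ?thesis using less6_cases[OF assms(1)] assms(2) by (elim disjE) auto
qed

lemma int_shift_signs:
  fixes u :: real
  assumes "\<bar>u\<bar> < 1"
  shows "0 < of_int m + u \<longleftrightarrow> 1 \<le> m \<or> m = 0 \<and> 0 < u" "of_int m + u < 1 \<longleftrightarrow> m \<le> 0 \<or> m = 1 \<and> u < 0"
proof -
  consider "m \<le> -1" | "m = 0" | "m = 1" | "2 \<le> m" by linarith
  then have "(0 < of_int m + u \<longleftrightarrow> 1 \<le> m \<or> m = 0 \<and> 0 < u) \<and> (of_int m + u < 1 \<longleftrightarrow> m \<le> 0 \<or> m = 1 \<and> u < 0)"
  proof cases
    case 1
    then have "real_of_int m \<le> -1" by linarith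
    with 1 assms show ?thesis by auto
  next
    case 4
    then have "2 \<le> real_of_int m" by linarith
    with 4 assms show ?thesis by auto
  qed (use assms in auto)
  then show "0 < of_int m + u \<longleftrightarrow> 1 \<le> m \<or> m = 0 \<and> 0 < u" "of_int m + u < 1 \<longleftrightarrow> m \<le> 0 \<or> m = 1 \<and> u < 0"
    by blast+
qed

lemma cell0_transition:
  assumes i: "i < 6" "cell0 0 (rotx i u v) (roty i u v)" and d: "3 dvd m - n" "\<not> (m = 0 \<and> n = 0)" and t: "t < 4"
  defines "X \<equiv> of_int m + u" and "Y \<equiv> of_int n + v"
  shows "0 < nf X Y" and
    "cell0 t (Y / nf X Y) (X / nf X Y) \<longleftrightarrow> adm t m n i \<and> cell0 (nxt t m n i) (rotx i u v) (roty i u v)"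
proof -
  note s = sector_signs[OF i]
  define M where "M = nf X Y"
  have sq: "x\<^sup>2 = 0 \<Longrightarrow> x = 0" for x :: real by simp
  have M4: "4 * M = (2 * X + Y)\<^sup>2 + 3 * Y\<^sup>2" by (simp add: M_def nf_def power2_eq_square algebra_simps)
  have nz: "\<not> (X = 0 \<and> Y = 0)"
  proof
    assume "X = 0 \<and> Y = 0"
    then have "of_int m = - u" "of_int n = - v" by (auto simp: X_def Y_def)
    then have "\<bar>of_int m :: real\<bar> < 1" "\<bar>of_int n :: real\<bar> < 1" using s(1) by auto
    then show False using d(2) by linarith
  qed
  have "M \<ge> 0" using M4 by (smt (verit) zero_le_power2)
  moreover have "M \<noteq> 0"
  proof
    assume "M = 0"
    then have "Y\<^sup>2 = 0" "(2 * X + Y)\<^sup>2 = 0" using M4 by (smt (verit) zero_le_power2)+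
    then show False using nz sq by fastforce
  qed
  ultimately show Mpos: "0 < nf X Y" unfolding M_def by simp
  then have M: "0 < M" by (simp add: M_def)
  have "nf (Y / M) (X / M) = nf X Y / M\<^sup>2"
    by (simp add: nf_def power_divide power2_eq_square add_divide_distrib mult.commute)
  then have NM: "nf (Y / M) (X / M) = 1 / M"
    using M by (simp add: M_def power2_eq_square)
  \<comment> \<open>Inversion in algebraic form: since \<open>nf\<close> becomes 1 / M, clearing M
    turns the outer side into a disc condition, keeps the disc of type 1 a disc and makes the discs
    through 0 of types 2 and 3 into half planes.\<close>
  have cell: "cell0 t (Y / M) (X / M) \<longleftrightarrow> 0 < X \<and> 0 < Y \<and> X + Y < M \<and> (t = 1 \<longrightarrow> 2 * (X + Y) < 1 + M)
      \<and> (t = 2 \<longrightarrow> Y < 1) \<and> (t = 3 \<longrightarrow> X < 1)"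
  proof -
    have e: "Y / M + X / M = (X + Y) / M" "2 * ((X + Y) / M) = (2 * (X + Y)) / M" "1 + 1 / M = (1 + M) / M"
      using M by (simp_all add: add_divide_distrib)
    show ?thesis unfolding cell0_def NM e using M by (auto simp: divide_less_cancel divide_less_eq zero_less_divide_iff)
  qed
  note X0 = int_shift_signs(1)[of u m, folded X_def] and X1 = int_shift_signs(2)[of u m, folded X_def]
    and Y0 = int_shift_signs(1)[of v n, folded Y_def] and Y1 = int_shift_signs(2)[of v n, folded Y_def]
  have uv: "\<bar>u\<bar> < 1" "\<bar>v\<bar> < 1" using s(1) by auto
  note X0 = X0[OF uv(1)] and X1 = X1[OF uv(1)] and Y0 = Y0[OF uv(2)] and Y1 = Y1[OF uv(2)]
  show "cell0 t (Y / nf X Y) (X / nf X Y) \<longleftrightarrow> adm t m n i \<and> cell0 (nxt t m n i) (rotx i u v) (roty i u v)"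
  proof (cases "m = 1 \<and> n = 1")
    case True
    have e: "M = 3 + 3 * (u + v) + nf u v" "X + Y = 2 + (u + v)"
      using True by (simp_all add: M_def X_def Y_def nf_def power2_eq_square algebra_simps)
    show ?thesis
    proof (cases "t = 1")
      case t1: True
      have "X + Y < M \<and> 2 * (X + Y) < 1 + M \<longleftrightarrow> 0 < nf u v + (u + v)"
        unfolding e using s(1) by auto
      then show ?thesis unfolding M_def[symmetric] cell X0 Y0 X1 Y1 using near_digit_E[OF i] True t1
        by (auto simp: adm_def nxt_def)
    next
      case t1: False
      have "X + Y < M \<longleftrightarrow> 0 < 1 + nf u v + 2 * (u + v)" unfolding e by auto
      then show ?thesis unfolding M_def[symmetric] cell X0 Y0 X1 Y1 using near_digit_D[OF i] True t1 s(3,5)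
        by (auto simp: adm_def nxt_def)
    qed
  next
    case False
    have f: "X + Y < M" "2 * (X + Y) < 1 + M" if "0 \<le> m" "0 \<le> n"
      using far_digit[of m n u v] that d False s(1) unfolding M_def X_def Y_def by auto
    have "cell0 t (Y / M) (X / M) \<longleftrightarrow> (1 \<le> m \<or> m = 0 \<and> 0 < u) \<and> (1 \<le> n \<or> n = 0 \<and> 0 < v)
       \<and> (t = 2 \<longrightarrow> n \<le> 0 \<or> n = 1 \<and> v < 0) \<and> (t = 3 \<longrightarrow> m \<le> 0 \<or> m = 1 \<and> u < 0)"
      unfolding cell X0 Y0 X1 Y1 using f by auto
    also have "\<dots> \<longleftrightarrow> adm t m n i"
    proof -
      have A: "(1 \<le> k \<or> k = 0 \<and> B) \<longleftrightarrow> 0 \<le> k \<and> (k = 0 \<longrightarrow> B)" for k :: int and B by auto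
      have C: "0 \<le> k \<Longrightarrow> (k \<le> 0 \<or> B) \<longleftrightarrow> (k = 0 \<or> B)" for k :: int and B by auto
      have D: "\<not> (t = 1 \<and> m = 1 \<and> n = 1)" "\<not> (m = 0 \<and> n = 0)" using False d(2) by blast+
      show ?thesis unfolding adm_def s(2-5)[symmetric] A using C[of m] C[of n] D by metis
    qed
    finally have "cell0 t (Y / M) (X / M) \<longleftrightarrow> adm t m n i" .
    moreover have "nxt t m n i = 0" using False by (auto simp: nxt_def)
    ultimately show ?thesis using i(2) unfolding M_def by simp
  qed
qed


text \<open>\<open>dual_cell0\<close> expressed in terms of the pole \<open>p\<close> instead of \<open>1 / cnj p\<close>.\<close>

definition pole_cond :: "nat \<Rightarrow> real \<Rightarrow> real \<Rightarrow> bool" where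
  "pole_cond t x y \<longleftrightarrow> 1 \<le> nf x y \<and> (t \<noteq> 1 \<longrightarrow> 3 * (x + y) \<le> nf x y + 2) \<and> (t = 1 \<longrightarrow> 3 * (x + y) \<le> 1 + 2 * nf x y)
     \<and> (t \<noteq> 2 \<longrightarrow> 3 * x \<le> 1 + 2 * nf x y) \<and> (t \<noteq> 3 \<longrightarrow> 3 * y \<le> 1 + 2 * nf x y)"

lemma nf_divide: "nf (x / P) (y / P) = nf x y / P\<^sup>2"
  by (simp add: nf_def power_divide power2_eq_square add_divide_distrib)

text \<open>Inversion in the unit circle sends \<open>nf\<close> to its reciprocal; clearing the
  denominator exchanges the two right-hand sides nf + 2 and 1 + 2 nf.\<close>

lemma dual_cell0_of_pole_cond:
  assumes "pole_cond t x y"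
  shows "dual_cell0 t (x / nf x y) (y / nf x y)"
proof -
  let ?P = "nf x y"
  have P: "1 \<le> ?P" using assms by (simp add: pole_cond_def)
  have N: "nf (x / ?P) (y / ?P) = 1 / ?P" using P by (simp add: nf_divide power2_eq_square)
  have e: "3 * (x / ?P + y / ?P) = 3 * (x + y) / ?P" "3 * (x / ?P) = 3 * x / ?P" "3 * (y / ?P) = 3 * y / ?P"
    "1 + 2 * (1 / ?P) = (?P + 2) / ?P" "1 / ?P + 2 = (1 + 2 * ?P) / ?P"
    using P by (simp_all add: add_divide_distrib)
  have c: "a / ?P \<le> b / ?P \<longleftrightarrow> a \<le> b" for a b using P by (simp add: divide_le_cancel)
  show ?thesis using assms P unfolding dual_cell0_def N pole_cond_def e c by (simp add: add.commute)
qed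

lemma rot_divide: "i < 6 \<Longrightarrow> rotx i (x / P) (y / P) = rotx i x y / P"
    "i < 6 \<Longrightarrow> roty i (x / P) (y / P) = roty i x y / P"
  by (drule less6_cases; auto simp: rotx_def roty_def numeral_eq_Suc add_divide_distrib diff_divide_distrib)+

lemma nf_linear_bounds:
  "c + 2 * d \<le> nf c d + 1" "2 * c + d \<le> nf c d + 1" "3 * (c + d) \<le> nf c d + 3"
proof -
  have n: "0 \<le> nf x y" for x y using nf_ge[of x y] by (smt (verit) zero_le_power2)
  show "c + 2 * d \<le> nf c d + 1" using n[of c "d - 1"] by (simp add: nf_def power2_eq_square algebra_simps)
  show "2 * c + d \<le> nf c d + 1" using n[of "c - 1" d] by (simp add: nf_def power2_eq_square algebra_simps)
  show "3 * (c + d) \<le> nf c d + 3" using n[of "c - 1" "d - 1"] by (simp add: nf_def power2_eq_square algebra_simps)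
qed

lemma nf_lines: "3 * x\<^sup>2 \<le> 4 * nf x y" "3 * y\<^sup>2 \<le> 4 * nf x y"
proof -
  have "4 * nf x y - 3 * x\<^sup>2 = (x + 2 * y)\<^sup>2" "4 * nf x y - 3 * y\<^sup>2 = (2 * x + y)\<^sup>2"
    by (simp_all add: nf_def power2_eq_square algebra_simps)
  then show "3 * x\<^sup>2 \<le> 4 * nf x y" "3 * y\<^sup>2 \<le> 4 * nf x y" by (metis diff_ge_0_iff_ge zero_le_power2)+
qed

text \<open>After squaring, 12 P <= (P + 2)^2 is needed, which holds from P = 8 on. Poles that far
  away meet the linear conditions automatically, so only finitely many digits need
  inspection.\<close>

lemma pole_line_bound: fixes l P :: real assumes "3 * l\<^sup>2 \<le> 4 * P" "8 \<le> P" shows "3 * l \<le> P + 2"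
proof (rule power2_le_imp_le)
  have "8 * P \<le> P * P" using assms(2) by (intro mult_right_mono) auto
  moreover have "(3 * l)\<^sup>2 = 9 * l\<^sup>2" "(P + 2)\<^sup>2 = P * P + 4 * P + 4"
    by (simp_all add: power2_eq_square algebra_simps)
  ultimately show "(3 * l)\<^sup>2 \<le> (P + 2)\<^sup>2" using assms(1) by linarith
qed (use assms in simp)

lemma pole_line_bound_weak: fixes l P :: real assumes "3 * l\<^sup>2 \<le> 4 * P" "2 \<le> P" shows "3 * l \<le> 1 + 2 * P"
proof (rule power2_le_imp_le)
  have "2 * P \<le> P * P" using assms(2) by (intro mult_right_mono) auto
  moreover have "(3 * l)\<^sup>2 = 9 * l\<^sup>2" "(1 + 2 * P)\<^sup>2 = 4 * (P * P) + 4 * P + 1"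
    by (simp_all add: power2_eq_square algebra_simps)
  ultimately show "(3 * l)\<^sup>2 \<le> (1 + 2 * P)\<^sup>2" using assms(1) by linarith
qed (use assms in simp)

text \<open>The new pole has coordinates c - m and d - n; \<open>d c\<close> appear swapped because
  z -> zeta * cnj z exchanges coordinates. Digits with m + n >= 5 push the pole far out. For (1, 1),
  (3, 0), (0, 3), (2, 2) its squared modulus is N plus an affine function of c and d, so linear
  arithmetic decides.\<close>

lemma dual_cell0_transition_pole_cond:
  assumes i: "i < 6" and v: "dual_cell0 t d c" and a: "adm t m n i" and dv: "3 dvd m - n" and t: "t < 4"
  defines "x \<equiv> c - of_int m" and "y \<equiv> d - of_int n"
  shows "pole_cond (nxt t m n i) (rotx i x y) (roty i x y)"
proof -
  define N where "N = nf c d"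
  have N': "nf d c = N" by (simp add: N_def nf_def mult.commute)
  define P where "P = nf x y"
  have NP: "nf (rotx i x y) (roty i x y) = P" using nf_rot[OF i] by (simp add: P_def)
  have mn: "0 \<le> m" "0 \<le> n" "\<not> (m = 0 \<and> n = 0)" using a by (auto simp: adm_def)
  note b = nf_linear_bounds[of c d, folded N_def]
  have v1: "N \<le> 1" "t \<noteq> 1 \<Longrightarrow> 3 * (c + d) \<le> 1 + 2 * N" "3 * (c + d) \<le> N + 2"
     "t \<noteq> 2 \<Longrightarrow> 3 * d \<le> N + 2" "t \<noteq> 3 \<Longrightarrow> 3 * c \<le> N + 2"
    using v unfolding dual_cell0_def N' by (cases "t = 1"; auto simp: algebra_simps)+
  have ic: "i = 0 \<or> i = 1 \<or> i = 2 \<or> i = 3 \<or> i = 4 \<or> i = 5" using less6_cases[OF i] .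
  have rxy: "rotx i x y \<in> {x, x + y, y, -x, -x-y, -y}" "roty i x y \<in> {x, x + y, y, -x, -x-y, -y}"
      "rotx i x y + roty i x y \<in> {x, x + y, y, -x, -x-y, -y}"
    using ic by (auto simp: rotx_def roty_def numeral_eq_Suc)
  have sq: "3 * l\<^sup>2 \<le> 4 * P" if "l \<in> {x, x + y, y, -x, -x-y, -y}" for l
    using that nf_lines(1)[of x y] nf_lines(2)[of y x] nf_ge[of x y] power2_minus[of "x + y"] unfolding P_def by auto
  show ?thesis
  proof (cases "m = 1 \<and> n = 1")
    case True
    then have xy: "x = c - 1" "y = d - 1" by (simp_all add: x_def y_def)
    have P: "P = N - 3 * (c + d) + 3"
      unfolding P_def N_def xy nf_def by (simp add: power2_eq_square algebra_simps)
    show ?thesis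
      using ic a True t b v1 unfolding pole_cond_def NP P adm_def
      by (elim disjE) (auto simp: nxt_def rotx_def roty_def numeral_eq_Suc xy)
  next
    case False
    then have s3: "3 \<le> m + n" using digit_sum_ge_3[OF dv mn] by simp
    have s3r: "(3::real) \<le> of_int m + of_int n" using s3 by (metis of_int_add of_int_le_iff of_int_numeral)
    have xys: "- (x + y) = of_int m + of_int n - (c + d)" by (simp add: x_def y_def)
    have cd: "3 * (c + d) \<le> 4" using b(3) v1(1) by linarith
    \<comment> \<open>5/3 = 3 - 4/3 and 11/3 = 5 - 4/3. Squared and inserted in 3 (x + y)^2 <= 4 P
      they give P >= 25/12 and P >= 121/12, enough for the thresholds 2 and 8.\<close>
    have aux: "3 \<le> A \<Longrightarrow> 3 * B \<le> 4 \<Longrightarrow> 5/3 \<le> A - B" "5 \<le> A \<Longrightarrow> 3 * B \<le> 4 \<Longrightarrow> 11/3 \<le> A - B" for A B :: real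
      by linarith+
    have P2: "2 \<le> P"
    proof -
      have "5/3 \<le> - (x + y)" unfolding xys using s3r cd by (rule aux(1))
      then have "(5/3)\<^sup>2 \<le> (- (x + y))\<^sup>2" by (intro power_mono) auto
      then have "25/9 \<le> (x + y)\<^sup>2" unfolding power2_minus by (simp add: power_divide)
      then show ?thesis using sq[of "x + y"] by auto
    qed
    have n0: "nxt t m n i = 0" using False by (auto simp: nxt_def)
    have "3 * (rotx i x y + roty i x y) \<le> P + 2"
    proof (cases "5 \<le> m + n")
      case True
      then have "(5::real) \<le> of_int m + of_int n" by (metis of_int_add of_int_le_iff of_int_numeral)
      then have "11/3 \<le> - (x + y)" unfolding xys using cd by (rule aux(2))
      then have "(11/3)\<^sup>2 \<le> (- (x + y))\<^sup>2" by (intro power_mono) auto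
      then have "121/9 \<le> (x + y)\<^sup>2" unfolding power2_minus by (simp add: power_divide)
      then have "8 \<le> P" using sq[of "x + y"] by auto
      then show ?thesis using pole_line_bound sq rxy(3) by blast
    next
      case F2: False
      have "(m = 3 \<and> n = 0) \<or> (m = 0 \<and> n = 3) \<or> (m = 2 \<and> n = 2)"
        using F2 s3 dv mn by presburger
      then consider "m = 3" "n = 0" | "m = 0" "n = 3" | "m = 2" "n = 2" by blast
      then show ?thesis
      proof cases
        case 1
        then have xy: "x = c - 3" "y = d" by (simp_all add: x_def y_def)
        have P: "P = N - 6 * c - 3 * d + 9"
          unfolding P_def N_def xy nf_def by (simp add: power2_eq_square algebra_simps)
        have "i = 0 \<or> i = 1 \<or> i = 2" using a 1 by (auto simp: adm_def)
        then show ?thesis unfolding P using b v1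
          by (elim disjE) (auto simp: rotx_def roty_def numeral_eq_Suc xy)
      next
        case 2
        then have xy: "x = c" "y = d - 3" by (simp_all add: x_def y_def)
        have P: "P = N - 3 * c - 6 * d + 9"
          unfolding P_def N_def xy nf_def by (simp add: power2_eq_square algebra_simps)
        have "i = 0 \<or> i = 4 \<or> i = 5" using a 2 by (auto simp: adm_def)
        then show ?thesis unfolding P using b v1
          by (elim disjE) (auto simp: rotx_def roty_def numeral_eq_Suc xy)
      next
        case 3
        then have xy: "x = c - 2" "y = d - 2" by (simp_all add: x_def y_def)
        have P: "P = N - 6 * c - 6 * d + 12"
          unfolding P_def N_def xy nf_def by (simp add: power2_eq_square algebra_simps)
        show ?thesis unfolding P using b v1 ic
          by (elim disjE) (auto simp: rotx_def roty_def numeral_eq_Suc xy)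
      qed
    qed
    moreover have "3 * rotx i x y \<le> 1 + 2 * P" "3 * roty i x y \<le> 1 + 2 * P"
      using pole_line_bound_weak sq rxy P2 by blast+
    ultimately show ?thesis using P2 unfolding pole_cond_def NP n0 by simp
  qed
qed

lemma dual_cell0_transition:
  assumes "i < 6" "dual_cell0 t d c" "adm t m n i" "3 dvd m - n" "t < 4"
  defines "x \<equiv> c - of_int m" and "y \<equiv> d - of_int n"
  shows "dual_cell0 (nxt t m n i) (rotx i (x / nf x y) (y / nf x y)) (roty i (x / nf x y) (y / nf x y))"
  using dual_cell0_of_pole_cond[OF dual_cell0_transition_pole_cond[OF assms(1-5)]] unfolding x_def[symmetric] y_def[symmetric]
  by (simp add: nf_rot[OF assms(1)] rot_divide[OF assms(1)])

section \<open>Cells and dual cells in the complex plane\<close>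

definition cell :: "nat \<Rightarrow> nat \<Rightarrow> complex set" where
  "cell t k = {z. cell0 t (Xc (zeta ^ k * z)) (Yc (zeta ^ k * z))}"
definition dual_cell :: "nat \<Rightarrow> nat \<Rightarrow> complex set" where
  "dual_cell t k = {q. dual_cell0 t (Xc (zeta ^ k * q)) (Yc (zeta ^ k * q))}"
text \<open>The six open sectors, that is \<open>U_dom\<close> up to the null set of its diagonals
  and boundary (\<open>negligible_U_minus_Sec\<close>).\<close>

definition Sec :: "complex set" where "Sec = (\<Union>k<6. cell 0 k)"

lemma nf_coords: "nf (Xc z) (Yc z) = (cmod z)\<^sup>2"
  by (simp add: nf_def cmod_coords)

lemma zeta_pow_6: "zeta ^ (6 * j) = 1" by (simp add: power_mult)

lemma Xc_rot: "i < 6 \<Longrightarrow> Xc (zeta ^ i * z) = rotx i (Xc z) (Yc z)"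
  and Yc_rot: "i < 6 \<Longrightarrow> Yc (zeta ^ i * z) = roty i (Xc z) (Yc z)"
  using less6_cases[of i] by (auto simp: rotx_def roty_def numeral_eq_Suc mult.assoc)

lemma cell_add: "z \<in> cell t (e + k) \<longleftrightarrow> zeta ^ e * z \<in> cell t k"
  by (simp add: cell_def power_add mult_ac)

text \<open>The index k is an unreduced exponent, so that frames compose by adding exponents and
  \<open>zeta ^ (5 * k)\<close> can serve as the inverse of \<open>zeta ^ k\<close>.\<close>

lemma cell_mod: "cell t k = cell t (k mod 6)"
proof -
  have "zeta ^ k = zeta ^ (6 * (k div 6) + k mod 6)" by simp
  also have "\<dots> = zeta ^ (k mod 6)" by (simp only: power_add zeta_pow_6) simp
  finally show ?thesis by (simp add: cell_def)
qed

lemma cell_subset_cell0: "cell t k \<subseteq> cell 0 k"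
  using cell0_base by (auto simp: cell_def)

lemma cell_subset_Sec: "cell t k \<subseteq> Sec"
  using cell_subset_cell0 cell_mod[of 0 k] by (fastforce simp: Sec_def)

lemma Sec_iff: "z \<in> Sec \<longleftrightarrow> (\<exists>i<6. cell0 0 (rotx i (Xc z) (Yc z)) (roty i (Xc z) (Yc z)))"
  by (auto simp: Sec_def cell_def Xc_rot Yc_rot)

lemma Sec_rot: "zeta ^ e * z \<in> Sec \<longleftrightarrow> z \<in> Sec"
proof -
  have *: "zeta ^ e * z \<in> Sec" if "z \<in> Sec" for e z
  proof -
    obtain k where k: "k < 6" "z \<in> cell 0 k" using \<open>z \<in> Sec\<close> by (auto simp: Sec_def)
    have "z = zeta ^ (6 * e) * z" by (simp add: zeta_pow_6)
    then have "z = zeta ^ (5 * e) * (zeta ^ e * z)" by (simp add: mult.assoc[symmetric] power_add[symmetric])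
    then have "zeta ^ e * z \<in> cell 0 (5 * e + k)" using k unfolding cell_add by metis
    then show ?thesis using cell_subset_Sec by blast
  qed
  have "z = zeta ^ (6 * e) * z" by (simp add: zeta_pow_6)
  then have "z = zeta ^ (5 * e) * (zeta ^ e * z)" by (simp add: mult.assoc[symmetric] power_add[symmetric])
  then show ?thesis using * by metis
qed

lemma Sec_sector: "w \<in> Sec \<Longrightarrow> \<exists>i<6. w \<in> cell 0 (e + i)"
  using Sec_rot[of e w] unfolding cell_add by (auto simp: Sec_def)

lemma sector_unique:
  assumes "i < 6" "j < 6" "w \<in> cell 0 (e + i)" "w \<in> cell 0 (e + j)"
  shows "i = j"
proof -
  define x y where "x = Xc (zeta ^ e * w)" and "y = Yc (zeta ^ e * w)"
  have "cell0 0 (rotx i x y) (roty i x y)" "cell0 0 (rotx j x y) (roty j x y)"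
    using assms unfolding cell_add x_def y_def by (simp_all add: cell_def Xc_rot Yc_rot)
  then show ?thesis using less6_cases[OF assms(1)] less6_cases[OF assms(2)]
    by (elim disjE; simp add: cell0_def rotx_def roty_def numeral_eq_Suc)
qed

lemma Sec_hexo: "Sec \<subseteq> hexo"
proof
  fix z assume "z \<in> Sec"
  then show "z \<in> hexo" unfolding Sec_iff hexo_def using sector_signs(1) by blast
qed

lemma hexo_cmod: assumes "z \<in> hexo" shows "cmod z < 1"
proof -
  have h: "\<bar>Xc z\<bar> < 1" "\<bar>Yc z\<bar> < 1" "\<bar>Xc z + Yc z\<bar> < 1" using assms by (auto simp: hexo_def)
  have "(Xc z)\<^sup>2 + Xc z * Yc z + (Yc z)\<^sup>2 < 1"
  proof (cases "Xc z * Yc z \<ge> 0")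
    case True
    have "(Xc z + Yc z)\<^sup>2 < 1" using h(3) by (simp add: abs_square_less_1)
    then show ?thesis using True by (simp add: power2_eq_square algebra_simps)
  next
    case False
    show ?thesis
    proof (cases "\<bar>Xc z\<bar> \<le> \<bar>Yc z\<bar>")
      case True
      have "(Yc z)\<^sup>2 < 1" using h(2) by (simp add: abs_square_less_1)
      moreover have "\<bar>Xc z\<bar> * \<bar>Xc z\<bar> \<le> \<bar>Xc z\<bar> * \<bar>Yc z\<bar>" using True by (intro mult_left_mono) auto
      then have "(Xc z)\<^sup>2 \<le> - (Xc z * Yc z)" using False by (simp add: power2_eq_square abs_mult[symmetric])
      ultimately show ?thesis by simp
    next
      case F: False
      have "(Xc z)\<^sup>2 < 1" using h(1) by (simp add: abs_square_less_1)
      moreover have "\<bar>Yc z\<bar> * \<bar>Yc z\<bar> \<le> \<bar>Xc z\<bar> * \<bar>Yc z\<bar>" using F by (intro mult_right_mono) auto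
      then have "(Yc z)\<^sup>2 \<le> - (Xc z * Yc z)" using False by (simp add: power2_eq_square abs_mult[symmetric])
      ultimately show ?thesis by simp
    qed
  qed
  then have "(cmod z)\<^sup>2 < 1\<^sup>2" by (simp add: cmod_coords)
  then show ?thesis by (rule power2_less_imp_less) simp
qed

lemma Sec_U: "Sec \<subseteq> U_dom" using Sec_hexo hexo_subset_U by blast

lemma Sec_cmod: "z \<in> Sec \<Longrightarrow> cmod z < 1"
  using Sec_hexo hexo_cmod by blast

lemma open_cell: "open (cell t k)"
  unfolding cell_def cell0_def nf_def disj_not1[symmetric] imp_conv_disj
  by (intro open_Collect_conj open_Collect_disj open_Collect_less open_Collect_const continuous_intros)

lemma open_Sec: "open Sec" unfolding Sec_def using open_cell by blast

lemma cell_borel [measurable]: "cell t k \<in> sets borel" using open_cell by (rule borel_open)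
lemma Sec_borel [measurable]: "Sec \<in> sets borel" using open_Sec by (rule borel_open)

lemma centroid_in_Sec: obtains z where "z \<in> Sec" "cmod z < 9/10"
proof
  let ?z = "of_real (1/3) + of_real (1/3) * zeta"
  have "?z \<in> cell 0 0" unfolding cell_def cell0_def by (simp only: mem_Collect_eq Xc_of Yc_of power_0 mult_1) simp
  then show "?z \<in> Sec" using cell_subset_Sec by blast
  have "(cmod ?z)\<^sup>2 < (9/10)\<^sup>2" unfolding cmod_coords Xc_of Yc_of by (simp add: power2_eq_square)
  then show "cmod ?z < 9/10" by (rule power2_less_imp_less) simp
qed

lemma Sec_nonempty: "Sec \<noteq> {}" using centroid_in_Sec by blast

lemma negligible_line:
  assumes "a \<noteq> 0 \<or> b \<noteq> 0" shows "negligible {z. a * Xc z + b * Yc z = c}"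
proof -
  define v where "v = Complex b ((2 * a - b) / sqrt 3)"
  have e: "a * Xc z + b * Yc z = v \<bullet> z" for z
    by (simp add: v_def inner_complex_def Xc_def Yc_def field_simps)
  have "v \<noteq> 0" using assms by (auto simp: v_def complex_eq_iff)
  then show ?thesis unfolding e by (intro negligible_hyperplane) auto
qed

lemma negligible_U_minus_Sec: "negligible (U_dom - Sec)"
proof -
  let ?line = "\<lambda>a b c. {z. a * Xc z + b * Yc z = c}"
  let ?N = "?line 1 0 0 \<union> ?line 0 1 0 \<union> ?line 1 1 0 \<union> ?line 1 0 1 \<union> ?line 1 0 (-1) \<union> ?line 0 1 1 \<union> ?line 0 1 (-1) \<union> ?line 1 1 1 \<union> ?line 1 1 (-1)"
  have "negligible ?N" by (intro negligible_Un negligible_line) auto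
  moreover have "U_dom - Sec \<subseteq> ?N"
  proof
    fix z assume z: "z \<in> U_dom - Sec"
    show "z \<in> ?N"
    proof (rule ccontr)
      assume n: "z \<notin> ?N"
      have le: "\<bar>Xc z\<bar> \<le> 1" "\<bar>Yc z\<bar> \<le> 1" "\<bar>Xc z + Yc z\<bar> \<le> 1"
        using U_coords_le z by auto
      have s: "Xc z \<noteq> 0" "Yc z \<noteq> 0" "Xc z + Yc z \<noteq> 0"
        and ne: "Xc z \<noteq> 1" "Xc z \<noteq> -1" "Yc z \<noteq> 1" "Yc z \<noteq> -1" "Xc z + Yc z \<noteq> 1" "Xc z + Yc z \<noteq> -1"
        using n by simp_all
      have strict: "\<bar>x\<bar> < 1" if "\<bar>x\<bar> \<le> 1" "x \<noteq> 1" "x \<noteq> -1" for x :: real using that by linarith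
      have b: "\<bar>Xc z\<bar> < 1" "\<bar>Yc z\<bar> < 1" "\<bar>Xc z + Yc z\<bar> < 1"
        using strict le ne by blast+
      have "\<exists>i\<in>{0,1,2,3,4,5::nat}. cell0 0 (rotx i (Xc z) (Yc z)) (roty i (Xc z) (Yc z))"
        using b s by (simp add: cell0_def rotx_def roty_def numeral_eq_Suc) linarith
      moreover have "i < 6" if "i \<in> {0,1,2,3,4,5}" for i :: nat using that by auto
      ultimately have "z \<in> Sec" unfolding Sec_iff by blast
      with z show False by blast
    qed
  qed
  ultimately show ?thesis using negligible_subset by blast
qed

lemma J_rot: "a \<in> J_ideal \<Longrightarrow> zeta ^ e * a \<in> J_ideal"
proof (induction e)
  case (Suc e)
  then obtain m n where "zeta ^ e * a = latt m n" "3 dvd m - n" using J_ideal_iff by blast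
  then have "zeta ^ Suc e * a = latt (m + n) (- m)" by (simp add: coords_inject mult.assoc)
  moreover have "3 dvd m + n - - m" using \<open>3 dvd m - n\<close> by presburger
  ultimately show ?case using J_ideal_iff by blast
qed simp

lemma zeta_div_coords:
  "Xc (zeta / b) = Yc b / (cmod b)\<^sup>2" "Yc (zeta / b) = Xc b / (cmod b)\<^sup>2"
proof -
  have "zeta / b = of_real (1 / (cmod b)\<^sup>2) * (zeta * cnj b)"
    by (simp add: complex_div_cnj[of zeta b])
  then show "Xc (zeta / b) = Yc b / (cmod b)\<^sup>2" "Yc (zeta / b) = Xc b / (cmod b)\<^sup>2"
    by (simp_all only: Xc_simps Yc_simps Xc_zeta_mult Yc_zeta_mult Xc_cnj Yc_cnj) simp_all
qed

text \<open>Since \<open>\<zeta>\<^sup>6 = 1\<close>, the factor \<open>\<zeta> ^ (1 + 5 * k)\<close> is \<open>\<zeta>\<^sup>1\<^sup>-\<^sup>k\<close>: if \<open>1 / z = a + w\<close>, then \<open>\<zeta> / (\<zeta>\<^sup>k z) = \<zeta>\<^sup>1\<^sup>-\<^sup>k (a + w)\<close>.\<close>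

definition mdig :: "nat \<Rightarrow> complex \<Rightarrow> int" where "mdig k a = \<lfloor>Xc (zeta ^ (1 + 5 * k) * a)\<rfloor>"
definition ndig :: "nat \<Rightarrow> complex \<Rightarrow> int" where "ndig k a = \<lfloor>Yc (zeta ^ (1 + 5 * k) * a)\<rfloor>"

lemma dig:
  assumes "a \<in> J_ideal"
  shows "zeta ^ (1 + 5 * k) * a = latt (mdig k a) (ndig k a)" "3 dvd mdig k a - ndig k a"
proof -
  obtain m n where mn: "zeta ^ (1 + 5 * k) * a = latt m n" "3 dvd m - n" using J_rot[OF assms] J_ideal_iff by blast
  then have "mdig k a = m" "ndig k a = n" by (simp_all add: mdig_def ndig_def del: power_Suc add_Suc plus_1_eq_Suc)
  then show "zeta ^ (1 + 5 * k) * a = latt (mdig k a) (ndig k a)" "3 dvd mdig k a - ndig k a"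
    using mn by auto
qed

lemma zeta_pow_frame: "zeta ^ k / b = zeta / (zeta ^ (1 + 5 * k) * b)"
proof -
  have "zeta ^ k * zeta ^ (1 + 5 * k) = zeta * zeta ^ (6 * k)" by (simp add: power_add[symmetric])
  then have *: "zeta ^ k * zeta ^ (1 + 5 * k) = zeta" by (simp only: zeta_pow_6) simp
  have "zeta ^ k / b = zeta ^ k * zeta ^ (1 + 5 * k) / (zeta ^ (1 + 5 * k) * b)" by simp
  then show ?thesis unfolding * .
qed

text \<open>For m = n + 3 k the norm form is divisible by 3, so a positive value is at least
  3.\<close>

lemma J_norm_ge: assumes "a \<in> J_ideal" "a \<noteq> 0" shows "sqrt 3 \<le> cmod a"
proof -
  obtain m n where a: "a = latt m n" "3 dvd m - n" using assms J_ideal_iff by blast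
  have nz: "\<not> (m = 0 \<and> n = 0)" using assms a by (auto simp: coords_inject)
  obtain k where k: "m - n = 3 * k" using a by (auto elim: dvdE)
  have "m\<^sup>2 + m * n + n\<^sup>2 = 3 * (n\<^sup>2 + 3 * n * k + 3 * k\<^sup>2)"
  proof -
    have "m = n + 3 * k" using k by simp
    then show ?thesis by (simp add: power2_eq_square algebra_simps)
  qed
  moreover have "0 < m\<^sup>2 + m * n + n\<^sup>2"
  proof -
    have "0 \<le> (2 * m + n)\<^sup>2" "0 \<le> n\<^sup>2" by simp_all
    moreover have "(2 * m + n)\<^sup>2 \<noteq> 0 \<or> n\<^sup>2 \<noteq> 0" using nz by auto
    moreover have "4 * (m\<^sup>2 + m * n + n\<^sup>2) = (2 * m + n)\<^sup>2 + 3 * n\<^sup>2" by (simp add: power2_eq_square algebra_simps)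
    ultimately show ?thesis by (smt (verit))
  qed
  ultimately have "3 \<le> m\<^sup>2 + m * n + n\<^sup>2" by presburger
  then have "3 \<le> real_of_int (m\<^sup>2 + m * n + n\<^sup>2)" by linarith
  also have "\<dots> = (cmod a)\<^sup>2" by (simp add: cmod_coords a)
  finally show ?thesis by (simp add: real_le_rsqrt real_sqrt_le_iff real_le_lsqrt)
qed

lemma J_norm_gt1: "a \<in> J_ideal \<Longrightarrow> a \<noteq> 0 \<Longrightarrow> 1.7 < cmod a"
proof -
  have "(1.7::real) < sqrt 3" by (rule real_less_rsqrt) (simp add: power2_eq_square)
  then show "a \<in> J_ideal \<Longrightarrow> a \<noteq> 0 \<Longrightarrow> 1.7 < cmod a" using J_norm_ge by fastforce
qed

text \<open>\<open>cell0_transition\<close> in an arbitrary frame: rotating a + w by the exponent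
  \<open>1 + 5 * k\<close> makes \<open>zeta ^ k / (a + w)\<close> into \<open>zeta / b\<close>, the
  standard situation.\<close>

lemma cell_transition:
  assumes t: "t < 4" and a: "a \<in> J_ideal" "a \<noteq> 0" and i: "i < 6" and w: "w \<in> cell 0 (1 + 5 * k + i)"
  shows "1 / (a + w) \<in> cell t k \<longleftrightarrow> adm t (mdig k a) (ndig k a) i \<and> w \<in> cell (nxt t (mdig k a) (ndig k a) i) (1 + 5 * k + i)"
proof -
  define e where "e = 1 + 5 * k"
  define m n where "m = mdig k a" and "n = ndig k a"
  define u v where "u = Xc (zeta ^ e * w)" and "v = Yc (zeta ^ e * w)"
  have la: "zeta ^ e * a = latt m n" "3 dvd m - n" using dig[OF a(1), of k] by (auto simp: e_def m_def n_def)
  have mn: "\<not> (m = 0 \<and> n = 0)"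
  proof
    assume "m = 0 \<and> n = 0"
    then have "zeta ^ e * a = 0" using la by (simp add: latt_def)
    then show False using a by simp
  qed
  have Qi: "w \<in> cell s (e + i) \<longleftrightarrow> cell0 s (rotx i u v) (roty i u v)" for s
    unfolding cell_add u_def v_def by (simp add: cell_def Xc_rot[OF i] Yc_rot[OF i])
  have w0: "cell0 0 (rotx i u v) (roty i u v)" using w Qi[of 0] by (simp add: e_def)
  define b where "b = zeta ^ e * (a + w)"
  have b: "Xc b = of_int m + u" "Yc b = of_int n + v" by (simp_all add: b_def distrib_left la u_def v_def)
  have "zeta ^ k * (1 / (a + w)) = zeta / b" using zeta_pow_frame[of k "a + w"] by (simp add: b_def e_def)
  then have "1 / (a + w) \<in> cell t k \<longleftrightarrow> cell0 t (Yc b / nf (Xc b) (Yc b)) (Xc b / nf (Xc b) (Yc b))"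
    by (simp only: cell_def mem_Collect_eq zeta_div_coords nf_coords)
  also have "\<dots> \<longleftrightarrow> adm t m n i \<and> cell0 (nxt t m n i) (rotx i u v) (roty i u v)"
    unfolding b by (rule cell0_transition(2)[OF i w0 la(2) mn t])
  finally show ?thesis using Qi by (simp add: e_def m_def n_def)
qed

lemma nxt_less_4: "nxt t m n i < 4" by (simp add: nxt_def)

text \<open>A branch with pole 1 / cnj q, composed with w -> 1 / (a + w), has its pole at cnj q - a;
  the conjugate inverse of this is 1 / (q - cnj a).\<close>

lemma dual_cell_transition:
  assumes t: "t < 4" and a: "a \<in> J_ideal" and i: "i < 6" and q: "q \<in> dual_cell t k"
    and ad: "adm t (mdig k a) (ndig k a) i"
  shows "1 / (q - cnj a) \<in> dual_cell (nxt t (mdig k a) (ndig k a) i) (1 + 5 * k + i)"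
proof -
  define e where "e = 1 + 5 * k"
  define m n where "m = mdig k a" and "n = ndig k a"
  have la: "zeta ^ e * a = latt m n" "3 dvd m - n" using dig[OF a(1), of k] by (auto simp: e_def m_def n_def)
  define d c where "d = Xc (zeta ^ k * q)" and "c = Yc (zeta ^ k * q)"
  define p where "p = cnj q - a"
  have cz: "cnj zeta = zeta ^ 5" by (simp add: cnj_zeta)
  have "cnj (zeta ^ k) = zeta ^ (5 * k)" by (simp only: complex_cnj_power cz power_mult)
  then have "zeta ^ e * cnj q = zeta * cnj (zeta ^ k * q)" by (simp add: e_def mult.assoc)
  then have cc: "Xc (zeta ^ e * cnj q) = c" "Yc (zeta ^ e * cnj q) = d"
    by (simp_all only: Xc_zeta_mult Yc_zeta_mult Xc_cnj Yc_cnj c_def d_def)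
  have px: "Xc (zeta ^ e * p) = c - of_int m" "Yc (zeta ^ e * p) = d - of_int n"
    by (simp_all add: p_def right_diff_distrib cc la)
  have np: "nf (c - of_int m) (d - of_int n) = (cmod p)\<^sup>2"
    unfolding px[symmetric] nf_coords by (simp add: norm_mult norm_power)
  have "1 / (q - cnj a) = of_real (1 / (cmod p)\<^sup>2) * p"
  proof -
    have "1 / (q - cnj a) = 1 / cnj p" by (simp add: p_def)
    also have "\<dots> = of_real (1 / (cmod p)\<^sup>2) * p" using complex_div_cnj[of 1 "cnj p"] by simp
    finally show ?thesis .
  qed
  then have "zeta ^ (e + i) * (1 / (q - cnj a)) = of_real (1 / (cmod p)\<^sup>2) * (zeta ^ i * (zeta ^ e * p))"
    by (simp only: power_add mult_ac)
  then have *: "Xc (zeta ^ (e + i) * (1 / (q - cnj a))) = rotx i (c - of_int m) (d - of_int n) / (cmod p)\<^sup>2"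
    "Yc (zeta ^ (e + i) * (1 / (q - cnj a))) = roty i (c - of_int m) (d - of_int n) / (cmod p)\<^sup>2"
    by (simp_all only: Xc_simps Yc_simps Xc_rot[OF i] Yc_rot[OF i] px) simp_all
  have "dual_cell0 t d c" using q by (simp add: dual_cell_def d_def c_def)
  then have "dual_cell0 (nxt t m n i) (rotx i ((c - of_int m) / (cmod p)\<^sup>2) ((d - of_int n) / (cmod p)\<^sup>2))
      (roty i ((c - of_int m) / (cmod p)\<^sup>2) ((d - of_int n) / (cmod p)\<^sup>2))"
    using dual_cell0_transition[OF i _ _ la(2) t, of d c] ad by (simp add: m_def n_def np[unfolded m_def n_def])
  then have "dual_cell0 (nxt t m n i) (Xc (zeta ^ (e + i) * (1 / (q - cnj a)))) (Yc (zeta ^ (e + i) * (1 / (q - cnj a))))"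
    unfolding * rot_divide[OF i] .
  then show ?thesis by (simp add: dual_cell_def e_def m_def n_def)
qed

lemma dual_cell_norm: "q \<in> dual_cell t k \<Longrightarrow> cmod q \<le> 1"
proof -
  assume "q \<in> dual_cell t k"
  then have "nf (Xc (zeta ^ k * q)) (Yc (zeta ^ k * q)) \<le> 1" by (simp add: dual_cell_def dual_cell0_def)
  then have "(cmod q)\<^sup>2 \<le> 1\<^sup>2" by (simp add: nf_coords norm_mult norm_power)
  then show ?thesis by (rule power2_le_imp_le) simp
qed

lemma dual_cell_zero: "0 \<in> dual_cell t k" by (simp add: dual_cell_def dual_cell0_def nf_def)

text \<open>In the frame of the cell, (2, 2) is admissible for all six sectors if t < 2. For types 2
  and 3 no digit is; (3, 0) and (0, 3) at least serve sector 0. The norms 12 and 9 give the bounds 3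
  and 4.\<close>

lemma full_digit:
  assumes "t < 4"
  obtains a where "a \<in> J_ideal" "3 \<le> cmod a" "cmod a \<le> 4"
    "t < 2 \<Longrightarrow> \<forall>w\<in>Sec. 1 / (a + w) \<in> cell t k"
    "\<not> t < 2 \<Longrightarrow> \<forall>w\<in>cell 0 (1 + 5 * k). 1 / (a + w) \<in> cell t k"
proof -
  define e where "e = 1 + 5 * k"
  define m n :: int where "m = (if t < 2 then 2 else if t = 2 then 3 else 0)" and "n = (if t < 2 then 2 else if t = 2 then 0 else 3)"
  define a where "a = zeta ^ (5 * e) * latt m n"
  have "latt m n \<in> J_ideal" unfolding J_ideal_iff by (intro exI[of _ m] exI[of _ n]) (simp add: m_def n_def)
  then have aJ: "a \<in> J_ideal" unfolding a_def by (rule J_rot)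
  have "zeta ^ e * a = zeta ^ (6 * e) * latt m n" by (simp add: a_def mult.assoc[symmetric] power_add[symmetric])
  then have ea: "zeta ^ e * a = latt m n" by (simp only: zeta_pow_6) simp
  have d: "mdig k a = m" "ndig k a = n" using ea by (simp_all add: mdig_def ndig_def e_def del: power_Suc)
  have "(cmod a)\<^sup>2 = (cmod (latt m n))\<^sup>2" by (simp add: a_def norm_mult norm_power)
  also have "\<dots> = (if t < 2 then 12 else 9)" using assms unfolding cmod_coords Xc_latt Yc_latt by (auto simp: m_def n_def power2_eq_square)
  finally have ca: "3\<^sup>2 \<le> (cmod a)\<^sup>2" "(cmod a)\<^sup>2 \<le> 4\<^sup>2" by (auto split: if_splits)
  have c34: "3 \<le> cmod a" "cmod a \<le> 4" using ca by (auto intro: power2_le_imp_le)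
  have a0: "a \<noteq> 0" using c34 by auto
  show ?thesis
  proof (rule that[OF aJ c34])
    assume t: "t < 2"
    show "\<forall>w\<in>Sec. 1 / (a + w) \<in> cell t k"
    proof
      fix w assume "w \<in> Sec"
      then obtain i where i: "i < 6" "w \<in> cell 0 (e + i)" using Sec_sector by blast
      have "nxt t m n i = 0" "adm t m n i" using t by (auto simp: nxt_def adm_def m_def n_def)
      then show "1 / (a + w) \<in> cell t k"
        using cell_transition[OF assms aJ a0 i(1) i(2)[unfolded e_def]] i by (simp add: d e_def)
    qed
  next
    assume t: "\<not> t < 2"
    show "\<forall>w\<in>cell 0 (1 + 5 * k). 1 / (a + w) \<in> cell t k"
    proof
      fix w assume w: "w \<in> cell 0 (1 + 5 * k)"
      have "nxt t m n 0 = 0" "adm t m n 0" using t assms by (auto simp: nxt_def adm_def m_def n_def)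
      then show "1 / (a + w) \<in> cell t k"
        using cell_transition[OF assms aJ a0, of 0 w k] w by (simp add: d)
    qed
  qed
qed

section \<open>The map and its transfer operator\<close>

definition J0 :: "complex set" where "J0 = J_ideal - {0}"

lemma countable_J: "countable J_ideal"
proof -
  have "J_ideal \<subseteq> range (\<lambda>p. latt (fst p) (snd p))"
  proof
    fix a assume "a \<in> J_ideal"
    then obtain m n where "a = latt (fst (m, n)) (snd (m, n))" using J_ideal_iff by auto
    then show "a \<in> range (\<lambda>p. latt (fst p) (snd p))" by blast
  qed
  then show ?thesis by (rule countable_subset) simp
qed

lemma countable_J0: "countable J0" unfolding J0_def by (rule countable_Diff[OF countable_J])

lemma infinite_J0: "infinite J0"
proof -
  have "inj (\<lambda>k::nat. latt (3 * int k + 3) 0)" by (auto simp: inj_def coords_inject)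
  then have "infinite (range (\<lambda>k::nat. latt (3 * int k + 3) 0))" by (rule range_inj_infinite)
  moreover have "range (\<lambda>k::nat. latt (3 * int k + 3) 0) \<subseteq> J0"
  proof (clarsimp simp: J0_def)
    fix k :: nat
    have "3 dvd (3 * int k + 3) - 0" by simp
    then have "latt (3 * int k + 3) 0 \<in> J_ideal" unfolding J_ideal_iff by blast
    then show "latt (3 * int k + 3) 0 \<in> J_ideal \<and> latt (3 * int k + 3) 0 \<noteq> 0"
      by (auto simp: coords_inject)
  qed
  ultimately show ?thesis using infinite_super by blast
qed

text \<open>An enumeration of the nonzero digits turns sums over them into series over
  \<open>nat\<close>.\<close>

definition digit :: "nat \<Rightarrow> complex" where "digit = from_nat_into J0"

lemma digit_bij: "bij_betw digit UNIV J0"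
  unfolding digit_def by (rule bij_betw_from_nat_into[OF countable_J0 infinite_J0])

lemma digit_J: "digit i \<in> J_ideal" "digit i \<noteq> 0"
  using digit_bij by (auto simp: J0_def bij_betw_def)

lemma digit_ex: "a \<in> J_ideal \<Longrightarrow> a \<noteq> 0 \<Longrightarrow> \<exists>i. digit i = a"
  using digit_bij by (auto simp: J0_def bij_betw_def) (metis (no_types, lifting) DiffI empty_iff image_iff insert_iff)

lemma digit_inj: "digit i = digit j \<Longrightarrow> i = j"
  using digit_bij by (auto simp: bij_betw_def inj_def)

lemma digit_add_bound: "w \<in> Sec \<Longrightarrow> a \<in> J_ideal \<Longrightarrow> a \<noteq> 0 \<Longrightarrow> 0.7 \<le> cmod (a + w)"
  using J_norm_gt1[of a] Sec_cmod[of w] norm_triangle_ineq2[of a "- w"] by simp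

lemma digit_add_nonzero: "w \<in> Sec \<Longrightarrow> a \<in> J_ideal \<Longrightarrow> a \<noteq> 0 \<Longrightarrow> a + w \<noteq> 0"
  using digit_add_bound[of w a] by auto

lemma T_map_U: "T_map z \<in> U_dom"
proof -
  have "0 \<in> U_dom" by (simp add: U_dom_iff)
  then show ?thesis using J_part_U by (simp add: T_map_def)
qed

lemma T_map_eqI: "a \<in> J_ideal \<Longrightarrow> w \<in> U_dom \<Longrightarrow> a + w \<noteq> 0 \<Longrightarrow> T_map (1 / (a + w)) = w"
  using J_part_eqI[of a "a + w"] by (simp add: T_map_def)

lemma J_part_measurable: "J_part \<in> borel_measurable borel"
proof (rule measurableI)
  fix S :: "complex set"
  have "J_part -` S = (\<Union>a\<in>J_ideal \<inter> S. (\<lambda>z. z - a) -` U_dom)"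
    using J_part_eqI J_part_J J_part_U by fastforce
  moreover have "(\<lambda>z. z - a) -` U_dom \<in> sets borel" for a
  proof -
    have "(\<lambda>z::complex. z - a) \<in> borel_measurable borel" by measurable
    then show ?thesis using measurable_sets[of "\<lambda>z. z - a" borel borel U_dom] by simp
  qed
  moreover have "countable (J_ideal \<inter> S)" using countable_J by blast
  ultimately show "J_part -` S \<inter> space borel \<in> sets borel" by auto
qed simp

lemma T_map_measurable [measurable]: "T_map \<in> borel_measurable borel"
proof -
  note J_part_measurable [measurable]
  show ?thesis unfolding T_map_def by measurable
qed

text \<open>T is nonsingular: the preimage is covered by 0 and countably many images of
  \<open>N\<close> under z -> 1 / (a + z), which is differentiable away from its pole.\<close>

lemma negligible_T_preimage:
  assumes "negligible N" shows "negligible (T_map -` N \<inter> U_dom)"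
proof -
  define M where "M = (\<Union>a\<in>J_ideal. (\<lambda>z. a + z) ` N) - {0}"
  have "negligible (\<Union>a\<in>J_ideal. (\<lambda>z. a + z) ` N)"
    by (intro negligible_countable_Union countable_image countable_J) (auto intro: negligible_translation assms)
  then have "negligible M" unfolding M_def by (rule negligible_subset) auto
  then have "negligible (inverse ` M)"
  proof (rule negligible_differentiable_image_negligible[rotated])
    have "(inverse :: complex \<Rightarrow> complex) differentiable_on M"
      unfolding differentiable_on_def M_def using field_differentiable_imp_differentiable
      by (auto intro!: field_differentiable_imp_differentiable field_differentiable_inverse field_differentiable_ident)
    then show "inverse differentiable_on M" .
  qed simp
  moreover have "T_map -` N \<inter> U_dom \<subseteq> insert 0 (inverse ` M)"
  proof
    fix z assume z: "z \<in> T_map -` N \<inter> U_dom"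
    show "z \<in> insert 0 (inverse ` M)"
    proof (cases "z = 0")
      case False
      then have "1 / z = J_part (1 / z) + T_map z" by (simp add: T_map_def)
      then have "1 / z \<in> M" using z False J_part_J unfolding M_def by force
      moreover have "z = inverse (1 / z)" using False by simp
      ultimately show ?thesis by blast
    qed simp
  qed
  ultimately show ?thesis using negligible_insert negligible_subset by blast
qed

text \<open>Only used for functions vanishing outside \<open>Sec\<close>; the digit 0 would not contribute to them.\<close>

definition PF :: "(complex \<Rightarrow> ennreal) \<Rightarrow> complex \<Rightarrow> ennreal" where
  "PF f w = indicator Sec w * (\<Sum>i. f (1 / (digit i + w)) * ennreal (1 / cmod (digit i + w) ^ 4))"

lemma PF_measurable [measurable]:
  assumes [measurable]: "f \<in> borel_measurable borel"
  shows "PF f \<in> borel_measurable borel"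
  unfolding PF_def by measurable

lemma PF_supp: "w \<notin> Sec \<Longrightarrow> PF f w = 0" by (simp add: PF_def)

lemma PF_mono: "(\<And>z. f z \<le> g z) \<Longrightarrow> PF f w \<le> PF g w"
  unfolding PF_def by (intro mult_left_mono suminf_le mult_right_mono) auto

lemma PF_cmult: "PF (\<lambda>z. c * f z) w = c * PF f w"
  unfolding PF_def by (simp add: mult.assoc mult.left_commute)

lemma PF_add: "PF (\<lambda>z. f z + g z) w = PF f w + PF g w"
  unfolding PF_def by (simp add: distrib_right distrib_left suminf_add[symmetric])

lemma suminf_ennreal_swap:
  fixes f :: "nat \<Rightarrow> nat \<Rightarrow> ennreal"
  shows "(\<Sum>i. \<Sum>j. f i j) = (\<Sum>j. \<Sum>i. f i j)"
proof -
  have "(\<Sum>i. \<Sum>j. f i j) = (\<integral>\<^sup>+i. (\<Sum>j. f i j) \<partial>count_space UNIV)" by (simp add: nn_integral_count_space_nat)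
  also have "\<dots> = (\<Sum>j. \<integral>\<^sup>+i. f i j \<partial>count_space UNIV)" by (rule nn_integral_suminf) simp
  finally show ?thesis by (simp add: nn_integral_count_space_nat)
qed

lemma PF_suminf: "PF (\<lambda>z. \<Sum>j. f j z) w = (\<Sum>j::nat. PF (f j) w)"
proof -
  have "(\<Sum>i. (\<Sum>j. f j (1 / (digit i + w))) * ennreal (1 / cmod (digit i + w) ^ 4))
    = (\<Sum>j. \<Sum>i. f j (1 / (digit i + w)) * ennreal (1 / cmod (digit i + w) ^ 4))"
    by (subst suminf_ennreal_swap) simp
  then show ?thesis unfolding PF_def by simp
qed

lemma branch_term_le_PF:
  assumes "w \<in> Sec" "a \<in> J_ideal" "a \<noteq> 0"
  shows "f (1 / (a + w)) * ennreal (1 / cmod (a + w) ^ 4) \<le> PF f w"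
proof -
  obtain i where i: "digit i = a" using digit_ex assms by blast
  have "(\<Sum>i\<in>{i}. f (1 / (digit i + w)) * ennreal (1 / cmod (digit i + w) ^ 4))
      \<le> (\<Sum>i. f (1 / (digit i + w)) * ennreal (1 / cmod (digit i + w) ^ 4))"
    by (intro sum_le_suminf) auto
  then show ?thesis using assms(1) i by (simp add: PF_def)
qed

text \<open>1 / |a + w|^4 is the Jacobian of w -> 1 / (a + w). Both sides integrate \<open>f\<close>
  against a measure, so it suffices that \<open>M1\<close> and \<open>M2\<close> agree on Borel sets
  C; this is the image formula on the part of \<open>B\<close> mapped into C.\<close>

lemma branch_change_of_variables:
  assumes a: "a \<in> J_ideal" "a \<noteq> 0" and B [measurable]: "B \<in> sets borel" and BG: "B \<subseteq> Sec"
    and f [measurable]: "f \<in> borel_measurable borel"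
  shows "(\<integral>\<^sup>+w. indicator B w * (f (1 / (a + w)) * ennreal (1 / cmod (a + w) ^ 4)) \<partial>lborel)
     = (\<integral>\<^sup>+y. f y * indicator B (1 / y - a) \<partial>lborel)"
proof -
  define M1 where "M1 = distr (density lborel (\<lambda>w. indicator B w * ennreal (1 / cmod (a + w) ^ 4))) borel (\<lambda>w. 1 / (a + w))"
  define M2 where "M2 = density lborel (\<lambda>y. indicator B (1 / y - a))"
  have eq: "M1 = M2"
  proof (rule measure_eqI)
    show "sets M1 = sets M2" by (simp add: M1_def M2_def)
    fix C assume "C \<in> sets M1"
    then have C [measurable]: "C \<in> sets borel" by (simp add: M1_def)
    define S where "S = B \<inter> (\<lambda>w. 1 / (a + w)) -` C"
    have Sb [measurable]: "S \<in> sets borel"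
    proof -
      have "(\<lambda>w. 1 / (a + w)) \<in> borel_measurable borel" by measurable
      from measurable_sets[OF this C] show ?thesis unfolding S_def using B by auto
    qed
    have SG: "S \<subseteq> Sec" using BG by (auto simp: S_def)
    have nz: "a + w \<noteq> 0" if "w \<in> S" for w using that SG digit_add_nonzero a by blast
    have "bounded S" using SG Sec_cmod by (intro boundedI[of _ 1]) force
    then have Sm: "S \<in> lmeasurable" by (intro bounded_set_imp_lmeasurable) auto
    have im: "(\<lambda>w. 1 / (a + w)) ` S = C \<inter> {y. 1 / y - a \<in> B}"
    proof
      show "(\<lambda>w. 1 / (a + w)) ` S \<subseteq> C \<inter> {y. 1 / y - a \<in> B}" by (auto simp: S_def)
      show "C \<inter> {y. 1 / y - a \<in> B} \<subseteq> (\<lambda>w. 1 / (a + w)) ` S"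
      proof
        fix y assume y: "y \<in> C \<inter> {y. 1 / y - a \<in> B}"
        then have "1 / y - a \<in> S" by (auto simp: S_def)
        \<comment> \<open>Also valid at y = 0, by the convention 1 / 0 = 0.\<close>
        moreover have "y = 1 / (a + (1 / y - a))" by simp
        ultimately show "y \<in> (\<lambda>w. 1 / (a + w)) ` S" by blast
      qed
    qed
    have "emeasure M1 C = (\<integral>\<^sup>+w. indicator B w * ennreal (1 / cmod (a + w) ^ 4) * indicator ((\<lambda>w. 1 / (a + w)) -` C) w \<partial>lborel)"
    proof -
      have m: "(\<lambda>w. 1 / (a + w)) \<in> borel_measurable borel" by measurable
      have "(\<lambda>w. 1 / (a + w)) -` C \<in> sets borel" using measurable_sets[OF m C] by simp
      then show ?thesis unfolding M1_def by (subst emeasure_distr) (use m in \<open>auto simp: emeasure_density\<close>)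
    qed
    also have "\<dots> = (\<integral>\<^sup>+w. ennreal ((cmod (- 1 / (a + w)\<^sup>2))\<^sup>2) * indicator S w \<partial>lborel)"
      by (intro nn_integral_cong) (auto simp: S_def indicator_def norm_divide norm_power power_divide simp flip: power_mult)
    also have "\<dots> = (\<integral>\<^sup>+w. ennreal ((cmod (- 1 / (a + w)\<^sup>2))\<^sup>2) * indicator S w \<partial>lebesgue)"
      by (rule nn_integral_completion[symmetric]) measurable
    also have "\<dots> = emeasure lebesgue ((\<lambda>w. 1 / (a + w)) ` S)"
    proof (rule holomorphic_image_emeasure(2)[symmetric, OF Sm])
      show "((\<lambda>w. 1 / (a + w)) has_field_derivative - 1 / (a + z)\<^sup>2) (at z)" if "z \<in> S" for z
        using nz[OF that] by (auto intro!: derivative_eq_intros simp: power2_eq_square)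
      show "inj_on (\<lambda>w. 1 / (a + w)) S" by (auto simp: inj_on_def)
      show "cmod (- 1 / (a + z)\<^sup>2) \<le> 1 / 0.7\<^sup>2" if "z \<in> S" for z
      proof -
        have b: "0.7 \<le> cmod (a + z)" using digit_add_bound[of z a] that SG a by blast
        then have "0 < cmod (a + z)" by linarith
        then have "1 / (cmod (a + z))\<^sup>2 \<le> 1 / 0.7\<^sup>2" using b by (intro divide_left_mono power_mono) auto
        then show ?thesis by (simp add: norm_divide norm_power)
      qed
      show "(\<lambda>z. - 1 / (a + z)\<^sup>2) \<in> borel_measurable borel" by measurable
    qed
    also have "\<dots> = emeasure lborel (C \<inter> {y. 1 / y - a \<in> B})"
    proof -
      have "C \<inter> {y. 1 / y - a \<in> B} \<in> sets borel" by measurable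
      then show ?thesis unfolding im by simp
    qed
    also have "\<dots> = emeasure M2 C"
      unfolding M2_def by (subst emeasure_density) (auto simp: nn_integral_indicator[symmetric] indicator_def intro!: nn_integral_cong)
    finally show "emeasure M1 C = emeasure M2 C" .
  qed
  have "(\<integral>\<^sup>+w. indicator B w * (f (1 / (a + w)) * ennreal (1 / cmod (a + w) ^ 4)) \<partial>lborel) = (\<integral>\<^sup>+y. f y \<partial>M1)"
    unfolding M1_def by (subst nn_integral_distr) (auto simp: nn_integral_density mult_ac)
  also have "\<dots> = (\<integral>\<^sup>+y. f y * indicator B (1 / y - a) \<partial>lborel)"
    unfolding eq M2_def by (subst nn_integral_density) (auto simp: mult_ac)
  finally show ?thesis .
qed

lemma zero_notin_Sec: "0 \<notin> Sec"
  by (auto simp: Sec_def cell_def cell0_def)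

text \<open>The digit 0 cannot occur, because 1 / y has modulus above 1 and T y modulus below
  1.\<close>

lemma T_digit:
  assumes "y \<in> Sec" "T_map y \<in> Sec"
  obtains a where "a \<in> J_ideal" "a \<noteq> 0" "y = 1 / (a + T_map y)"
proof
  have y0: "y \<noteq> 0" using assms zero_notin_Sec by auto
  then have Ty: "T_map y = 1 / y - J_part (1 / y)" by (simp add: T_map_def)
  show "J_part (1 / y) \<in> J_ideal" by (rule J_part_J)
  show "y = 1 / (J_part (1 / y) + T_map y)" using Ty y0 by simp
  show "J_part (1 / y) \<noteq> 0"
  proof
    assume "J_part (1 / y) = 0"
    then have "cmod (1 / y) < 1" using Ty Sec_cmod[OF assms(2)] by simp
    then show False using Sec_cmod[OF assms(1)] y0 by (simp add: norm_divide field_simps)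
  qed
qed

text \<open>Translates of \<open>U_dom\<close> are disjoint, so y has only one digit and at most one
  summand is nonzero.\<close>

lemma branch_indicator_sum:
  assumes y: "y \<in> Sec" and BG: "B \<subseteq> Sec"
  shows "(\<Sum>i. indicator B (1 / y - digit i) :: ennreal) = indicator B (T_map y)"
proof -
  have y0: "y \<noteq> 0" using y zero_notin_Sec by auto
  have T: "T_map y = 1 / y - digit i" if "1 / y - digit i \<in> B" for i
  proof -
    have "1 / y - digit i \<in> U_dom" using that BG Sec_U by blast
    then show ?thesis using J_part_eqI digit_J y0 unfolding T_map_def by metis
  qed
  show ?thesis
  proof (cases "T_map y \<in> B")
    case True
    then have "T_map y \<in> Sec" using BG by blast
    with y obtain a where a: "a \<in> J_ideal" "a \<noteq> 0" "y = 1 / (a + T_map y)" by (rule T_digit)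
    obtain j where j: "digit j = a" using digit_ex[OF a(1,2)] by blast
    have "1 / y = a + T_map y" using a(3) by (metis divide_divide_eq_right div_by_1 mult_1)
    then have Ty: "1 / y - a = T_map y" by simp
    have "indicator B (1 / y - digit i) = (if i = j then 1 else 0 :: ennreal)" for i
    proof (cases "i = j")
      case False
      then have "1 / y - digit i \<notin> B" using T[of i] Ty j digit_inj[of i j] by force
      then show ?thesis using False by simp
    qed (use True Ty j in simp)
    then have "(\<Sum>i. indicator B (1 / y - digit i) :: ennreal) = (\<Sum>i\<in>{j}. 1)"
      by (subst suminf_finite[of "{j}"]) auto
    then show ?thesis using True by simp
  next
    case False
    then have "1 / y - digit i \<notin> B" for i using T by metis
    then show ?thesis using False by simp
  qed
qed

lemma PF_dual_Sec:
  assumes f [measurable]: "f \<in> borel_measurable borel" and s: "\<And>z. z \<notin> Sec \<Longrightarrow> f z = 0"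
    and B [measurable]: "B \<in> sets borel" and BG: "B \<subseteq> Sec"
  shows "(\<integral>\<^sup>+w. PF f w * indicator B w \<partial>lborel) = (\<integral>\<^sup>+y. f y * indicator B (T_map y) \<partial>lborel)"
proof -
  have "(\<integral>\<^sup>+w. PF f w * indicator B w \<partial>lborel)
     = (\<integral>\<^sup>+w. (\<Sum>i. indicator B w * (f (1 / (digit i + w)) * ennreal (1 / cmod (digit i + w) ^ 4))) \<partial>lborel)"
    using BG by (intro nn_integral_cong) (auto simp: PF_def indicator_def)
  also have "\<dots> = (\<Sum>i. \<integral>\<^sup>+w. indicator B w * (f (1 / (digit i + w)) * ennreal (1 / cmod (digit i + w) ^ 4)) \<partial>lborel)"
    by (rule nn_integral_suminf) measurable
  also have "\<dots> = (\<Sum>i. \<integral>\<^sup>+y. f y * indicator B (1 / y - digit i) \<partial>lborel)"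
    by (intro suminf_cong branch_change_of_variables digit_J B BG f)
  also have "\<dots> = (\<integral>\<^sup>+y. (\<Sum>i. f y * indicator B (1 / y - digit i)) \<partial>lborel)"
    by (rule nn_integral_suminf[symmetric]) measurable
  also have "\<dots> = (\<integral>\<^sup>+y. f y * indicator B (T_map y) \<partial>lborel)"
  proof (rule nn_integral_cong)
    fix y
    show "(\<Sum>i. f y * indicator B (1 / y - digit i)) = f y * indicator B (T_map y)"
      using branch_indicator_sum[OF _ BG, of y] s[of y] by (cases "y \<in> Sec") auto
  qed
  finally show ?thesis .
qed

text \<open>Test sets may now leave \<open>Sec\<close>: the points of \<open>U_dom\<close> that T
  sends outside \<open>Sec\<close> form the null set \<open>N\<close>.\<close>

lemma PF_dual:
  assumes f [measurable]: "f \<in> borel_measurable borel" and s: "\<And>z. z \<notin> Sec \<Longrightarrow> f z = 0"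
    and B [measurable]: "B \<in> sets borel"
  shows "(\<integral>\<^sup>+w. PF f w * indicator B w \<partial>lborel) = (\<integral>\<^sup>+y. f y * indicator B (T_map y) \<partial>lborel)"
proof -
  define N where "N = T_map -` (U_dom - Sec) \<inter> U_dom"
  have "negligible N" unfolding N_def by (intro negligible_T_preimage negligible_U_minus_Sec)
  moreover have Nb: "N \<in> sets borel"
  proof -
    have "U_dom - Sec \<in> sets borel" by measurable
    from measurable_sets[OF T_map_measurable this] show ?thesis unfolding N_def by auto
  qed
  ultimately have N: "N \<in> null_sets lborel"
    using negligible_iff_null_sets null_sets_completion_iff[of N lborel] by auto
  have "(\<integral>\<^sup>+w. PF f w * indicator B w \<partial>lborel) = (\<integral>\<^sup>+w. PF f w * indicator (B \<inter> Sec) w \<partial>lborel)"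
    by (intro nn_integral_cong) (auto simp: indicator_def PF_supp)
  also have "\<dots> = (\<integral>\<^sup>+y. f y * indicator (B \<inter> Sec) (T_map y) \<partial>lborel)"
    by (intro PF_dual_Sec s) auto
  also have "\<dots> = (\<integral>\<^sup>+y. f y * indicator B (T_map y) \<partial>lborel)"
  proof (rule nn_integral_cong_AE, rule AE_I'[OF N])
    show "{y \<in> space lborel. f y * indicator (B \<inter> Sec) (T_map y) \<noteq> f y * indicator B (T_map y)} \<subseteq> N"
      using s Sec_U T_map_U unfolding N_def by (fastforce simp: indicator_def split: if_splits)
  qed
  finally show ?thesis .
qed

lemma PF_funpow_measurable [measurable]: "f \<in> borel_measurable borel \<Longrightarrow> (PF ^^ n) f \<in> borel_measurable borel"
  by (induction n) auto

lemma PF_funpow_supp: "(\<And>z. z \<notin> Sec \<Longrightarrow> f z = 0) \<Longrightarrow> z \<notin> Sec \<Longrightarrow> (PF ^^ n) f z = 0"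
  by (cases n) (auto simp: PF_supp)

lemma T_funpow_measurable [measurable]: "T_map ^^ n \<in> borel_measurable borel"
  by (induction n) (auto intro: measurable_comp[OF _ T_map_measurable] measurable_ident)

lemma PF_funpow_dual:
  assumes f [measurable]: "f \<in> borel_measurable borel" and s: "\<And>z. z \<notin> Sec \<Longrightarrow> f z = 0"
    and B [measurable]: "B \<in> sets borel"
  shows "(\<integral>\<^sup>+w. (PF ^^ n) f w * indicator B w \<partial>lborel) = (\<integral>\<^sup>+y. f y * indicator B ((T_map ^^ n) y) \<partial>lborel)"
  using B
proof (induction n arbitrary: B)
  case (Suc n)
  have TB: "T_map -` B \<in> sets borel" using measurable_sets[OF T_map_measurable Suc.prems] by simp
  have "(\<integral>\<^sup>+w. (PF ^^ Suc n) f w * indicator B w \<partial>lborel) = (\<integral>\<^sup>+y. (PF ^^ n) f y * indicator B (T_map y) \<partial>lborel)"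
    using PF_dual[of "(PF ^^ n) f" B] PF_funpow_supp[OF s] Suc.prems by simp
  also have "\<dots> = (\<integral>\<^sup>+y. (PF ^^ n) f y * indicator (T_map -` B) y \<partial>lborel)" by (simp add: indicator_def)
  also have "\<dots> = (\<integral>\<^sup>+y. f y * indicator (T_map -` B) ((T_map ^^ n) y) \<partial>lborel)" by (rule Suc.IH[OF TB])
  finally show ?case by (simp add: indicator_def)
qed simp

lemma liminf_cmult_le:
  fixes f :: "nat \<Rightarrow> ennreal"
  shows "liminf f * ennreal c \<le> liminf (\<lambda>k. f k * ennreal c)"
proof -
  have "liminf f * ennreal c = (SUP n. INF k\<in>{n..}. f k) * ennreal c" by (simp add: liminf_SUP_INF)
  also have "\<dots> = (SUP n. (INF k\<in>{n..}. f k) * ennreal c)" by (rule SUP_mult_right_ennreal)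
  also have "\<dots> \<le> (SUP n. INF k\<in>{n..}. f k * ennreal c)"
    by (intro SUP_mono') (auto intro!: INF_greatest mult_right_mono INF_lower)
  finally show ?thesis by (simp add: liminf_SUP_INF)
qed

text \<open>Fatou's lemma for counting measure on the digits.\<close>

lemma PF_liminf: "PF (\<lambda>z. liminf (\<lambda>k. f k z)) w \<le> liminf (\<lambda>k. PF (f k) w)"
proof (cases "w \<in> Sec")
  case True
  let ?c = "\<lambda>i. ennreal (1 / cmod (digit i + w) ^ 4)" and ?y = "\<lambda>i. 1 / (digit i + w)"
  have "PF (\<lambda>z. liminf (\<lambda>k. f k z)) w = (\<Sum>i. liminf (\<lambda>k. f k (?y i)) * ?c i)" using True by (simp add: PF_def)
  also have "\<dots> \<le> (\<Sum>i. liminf (\<lambda>k. f k (?y i) * ?c i))" by (intro suminf_le liminf_cmult_le) auto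
  also have "\<dots> = (\<integral>\<^sup>+i. liminf (\<lambda>k. f k (?y i) * ?c i) \<partial>count_space UNIV)" by (simp add: nn_integral_count_space_nat)
  also have "\<dots> \<le> liminf (\<lambda>k. \<integral>\<^sup>+i. f k (?y i) * ?c i \<partial>count_space UNIV)" by (rule nn_integral_liminf) simp
  also have "\<dots> = liminf (\<lambda>k. PF (f k) w)" using True by (simp add: PF_def nn_integral_count_space_nat)
  finally show ?thesis .
qed (simp add: PF_def)

section \<open>Distortion of the transfer operator\<close>

text \<open>Up to the factor c, the Jacobian of a Moebius map with pole 1 / cnj q, cut off to the
  cell on which an inverse branch is defined; q = 0 stands for a pole at infinity.\<close>

definition basic :: "nat \<Rightarrow> nat \<Rightarrow> complex \<Rightarrow> real \<Rightarrow> complex \<Rightarrow> ennreal" where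
  "basic t k q c z = indicator (cell t k) z * ennreal (c / cmod (1 - cnj q * z) ^ 4)"

lemma basic_supp: "z \<notin> Sec \<Longrightarrow> basic t k q c z = 0"
  using cell_subset_Sec[of t k] by (auto simp: basic_def indicator_def)

text \<open>The cone contains all \<open>PF\<^sup>n 1\<close>, which are sums of Jacobians of inverse branches on the cells where these are defined.\<close>

inductive cone :: "(complex \<Rightarrow> ennreal) \<Rightarrow> bool" where
  cone_basic: "t < 4 \<Longrightarrow> q \<in> dual_cell t k \<Longrightarrow> 0 \<le> c \<Longrightarrow> cone (basic t k q c)"
| cone_suminf: "(\<And>i::nat. cone (f i)) \<Longrightarrow> cone (\<lambda>z. \<Sum>i. f i z)"

lemma cone_zero: "cone (\<lambda>z. 0)"
proof -
  have "cone (basic 0 0 0 0)" by (rule cone_basic) (auto simp: dual_cell_zero)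
  moreover have "basic 0 0 0 0 = (\<lambda>z. 0)" by (auto simp: basic_def)
  ultimately show ?thesis by simp
qed

lemma cone_sum:
  assumes "\<And>i. i < n \<Longrightarrow> cone (f i)" shows "cone (\<lambda>z. \<Sum>i<n::nat. f i z)"
proof -
  define g where "g i = (if i < n then f i else (\<lambda>z. 0))" for i
  have "cone (\<lambda>z. \<Sum>i. g i z)" by (rule cone_suminf) (auto simp: g_def assms cone_zero)
  moreover have "(\<Sum>i. g i z) = (\<Sum>i<n. f i z)" for z
    by (subst suminf_finite[of "{..<n}"]) (auto simp: g_def)
  ultimately show ?thesis by simp
qed

lemma cone_measurable: "cone f \<Longrightarrow> f \<in> borel_measurable borel"
proof (induction rule: cone.induct)
  case (cone_basic t q k c)
  then show ?case unfolding basic_def by measurable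
next
  case (cone_suminf f)
  then show ?case by measurable
qed

text \<open>With q = 0 and c = 1 the basic density is constant 1 on its sector, and the six sectors
  are disjoint.\<close>

lemma cone_indicator_Sec: "cone (indicator Sec)"
proof -
  have "cone (\<lambda>z. \<Sum>k<6. basic 0 k 0 1 z)" by (intro cone_sum cone_basic) (auto simp: dual_cell_zero)
  moreover have "(\<Sum>k<6. basic 0 k 0 1 z) = indicator Sec z" for z
  proof (cases "z \<in> Sec")
    case True
    then obtain j where j: "j < 6" "z \<in> cell 0 j" by (auto simp: Sec_def)
    have "basic 0 k 0 1 z = (if k = j then 1 else 0)" if "k < 6" for k
    proof (cases "k = j")
      case False
      then have "z \<notin> cell 0 k" using sector_unique[of k j z 0] that j unfolding add_0 by blast
      then show ?thesis using False by (simp add: basic_def)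
    qed (use j in \<open>simp add: basic_def\<close>)
    then have "(\<Sum>k<6. basic 0 k 0 1 z) = (\<Sum>k<6. if k = j then 1 else 0)" by (intro sum.cong) auto
    then show ?thesis using j True by simp
  next
    case False
    then have "basic 0 k 0 1 z = 0" for k by (rule basic_supp)
    then show ?thesis using False by simp
  qed
  ultimately show ?thesis by (simp add: fun_eq_iff[symmetric])
qed

lemma dual_cell_pole_bound:
  assumes "q \<in> dual_cell t k" "a \<in> J_ideal" "a \<noteq> 0"
  shows "cnj q - a \<noteq> 0"
  using dual_cell_norm[OF assms(1)] J_norm_gt1[OF assms(2,3)] by auto

text \<open>Both identities evaluate |a + w - cnj q|; dividing by cnj q - a restores the normal form
  with the dual parameter 1 / (q - cnj a).\<close>

lemma mobius_step:
  assumes w: "w \<in> Sec" and a: "a \<in> J_ideal" "a \<noteq> 0" and q: "q \<in> dual_cell t k"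
  shows "cmod (1 - cnj q * (1 / (a + w))) * cmod (a + w) = cmod (a + w - cnj q)"
    "cmod (1 - cnj q * (1 / (a + w))) = cmod (cnj q - a) * cmod (1 - cnj (1 / (q - cnj a)) * w) / cmod (a + w)"
proof -
  have aw: "a + w \<noteq> 0" using digit_add_nonzero w a by blast
  have u: "cnj q - a \<noteq> 0" using dual_cell_pole_bound q a by blast
  have "(1 - cnj q * (1 / (a + w))) * (a + w) = a + w - cnj q" using aw by (simp add: field_simps)
  then show 1: "cmod (1 - cnj q * (1 / (a + w))) * cmod (a + w) = cmod (a + w - cnj q)" by (metis norm_mult)
  have "(cnj q - a) * (1 - cnj (1 / (q - cnj a)) * w) = - (a + w - cnj q)" using u by (simp add: field_simps)
  then have 2: "cmod (cnj q - a) * cmod (1 - cnj (1 / (q - cnj a)) * w) = cmod (a + w - cnj q)" by (metis norm_mult norm_minus_cancel)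
  show "cmod (1 - cnj q * (1 / (a + w))) = cmod (cnj q - a) * cmod (1 - cnj (1 / (q - cnj a)) * w) / cmod (a + w)"
    using 1 2 aw by (simp add: field_simps)
qed

lemma basic_branch:
  assumes w: "w \<in> Sec" and a: "a \<in> J_ideal" "a \<noteq> 0" and q: "q \<in> dual_cell t k"
  shows "basic t k q c (1 / (a + w)) * ennreal (1 / cmod (a + w) ^ 4)
    = indicator (cell t k) (1 / (a + w)) * ennreal (c / cmod (cnj q - a) ^ 4 / cmod (1 - cnj (1 / (q - cnj a)) * w) ^ 4)"
proof -
  have "cmod (a + w) \<noteq> 0" using digit_add_nonzero w a by simp
  then have "c / cmod (1 - cnj q * (1 / (a + w))) ^ 4 * (1 / cmod (a + w) ^ 4)
      = c / cmod (cnj q - a) ^ 4 / cmod (1 - cnj (1 / (q - cnj a)) * w) ^ 4"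
    unfolding mobius_step(2)[OF assms] by (simp add: power_divide power_mult_distrib)
  moreover have "ennreal (c / cmod (1 - cnj q * (1 / (a + w))) ^ 4) * ennreal (1 / cmod (a + w) ^ 4)
      = ennreal (c / cmod (1 - cnj q * (1 / (a + w))) ^ 4 * (1 / cmod (a + w) ^ 4))"
    by (rule ennreal_mult''[symmetric]) simp
  ultimately show ?thesis unfolding basic_def by (simp only: mult.assoc)
qed

text \<open>The cell reached through digit \<open>a\<close> depends on the sector j of w, so a basic
  density splits into up to six basic densities per digit.\<close>

definition child :: "nat \<Rightarrow> nat \<Rightarrow> complex \<Rightarrow> real \<Rightarrow> complex \<Rightarrow> nat \<Rightarrow> complex \<Rightarrow> ennreal" where
  "child t k q c a j = (let m = mdig k a; n = ndig k a in if adm t m n j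
     then basic (nxt t m n j) (1 + 5 * k + j) (1 / (q - cnj a)) (c / cmod (cnj q - a) ^ 4) else (\<lambda>z. 0))"

lemma PF_basic:
  assumes t: "t < 4" and q: "q \<in> dual_cell t k"
  shows "PF (basic t k q c) w = (\<Sum>i. \<Sum>j<6. child t k q c (digit i) j w)"
proof (cases "w \<in> Sec")
  case True
  then obtain j0 where j0: "j0 < 6" "w \<in> cell 0 (1 + 5 * k + j0)" using Sec_sector by blast
  have "basic t k q c (1 / (digit i + w)) * ennreal (1 / cmod (digit i + w) ^ 4) = (\<Sum>j<6. child t k q c (digit i) j w)" for i
  proof -
    have "child t k q c (digit i) j w = 0" if "j < 6" "j \<noteq> j0" for j
    proof -
      have "w \<notin> cell s (1 + 5 * k + j)" for s using sector_unique[OF that(1) j0(1), of w "1 + 5 * k"] j0 that cell_subset_cell0 by blast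
      then show ?thesis by (simp add: child_def Let_def basic_def)
    qed
    then have "(\<Sum>j<6. child t k q c (digit i) j w) = (\<Sum>j<6. if j = j0 then child t k q c (digit i) j0 w else 0)" by (intro sum.cong) auto
    also have "\<dots> = child t k q c (digit i) j0 w" using j0 by simp
    also have "\<dots> = indicator (cell t k) (1 / (digit i + w)) *
        ennreal (c / cmod (cnj q - digit i) ^ 4 / cmod (1 - cnj (1 / (q - cnj (digit i))) * w) ^ 4)"
      using cell_transition[OF t digit_J j0] by (auto simp: child_def Let_def basic_def indicator_def)
    finally show ?thesis using basic_branch[OF True digit_J q] by simp
  qed
  then show ?thesis using True by (simp add: PF_def)
next
  case False
  then have "basic s l q' c' w = 0" for s l q' c' by (rule basic_supp)
  then have "child t k q c (digit i) j w = 0" for i j by (simp add: child_def Let_def)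
  then show ?thesis using False by (simp add: PF_def del: if_split)
qed

lemma cone_PF: "cone f \<Longrightarrow> cone (PF f)"
proof (induction rule: cone.induct)
  case (cone_basic t q k c)
  have "cone (\<lambda>w. \<Sum>i. \<Sum>j<6. child t k q c (digit i) j w)"
  proof (intro cone_suminf cone_sum)
    fix i j :: nat assume j: "j < 6"
    show "cone (child t k q c (digit i) j)"
      using cone_basic dual_cell_transition[OF cone_basic(1) digit_J(1) j cone_basic(2)]
      by (auto simp: child_def Let_def intro!: cone.cone_basic cone_zero nxt_less_4)
  qed
  moreover have "PF (basic t k q c) = (\<lambda>w. \<Sum>i. \<Sum>j<6. child t k q c (digit i) j w)"
    using PF_basic[OF cone_basic(1,2)] by blast
  ultimately show ?case by simp
next
  case (cone_suminf f)
  have "PF (\<lambda>z. \<Sum>i. f i z) = (\<lambda>w. \<Sum>i. PF (f i) w)" by (rule ext) (rule PF_suminf)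
  then show ?case using cone.cone_suminf[of "\<lambda>i. PF (f i)"] cone_suminf by simp
qed

lemma cone_PF_funpow: "cone f \<Longrightarrow> cone ((PF ^^ n) f)"
  by (induction n) (auto intro: cone_PF)

text \<open>The single term of digit \<open>a\<close> suffices: its denominator is |a + w - cnj
  q|^4, and |a + w - cnj q| <= 4 + 1 + 1 = 6.\<close>

lemma basic_full_branch:
  assumes t: "t < 4" and q: "q \<in> dual_cell t k" and c: "0 \<le> c" and w: "w \<in> Sec" and a: "a \<in> J_ideal" "3 \<le> cmod a" "cmod a \<le> 4"
    and cell: "1 / (a + w) \<in> cell t k"
  shows "ennreal (c / 6 ^ 4) \<le> PF (basic t k q c) w"
proof -
  have a0: "a \<noteq> 0" using a by auto
  have aw: "a + w \<noteq> 0" using digit_add_nonzero w a a0 by blast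
  have "cmod (a + w - cnj q) \<le> cmod a + cmod w + cmod (cnj q)"
    by (metis norm_triangle_ineq norm_triangle_ineq4 add_right_mono order_trans)
  then have le: "cmod (a + w - cnj q) \<le> 6" using a(3) Sec_cmod[OF w] dual_cell_norm[OF q] by simp
  have ne: "a + w - cnj q \<noteq> 0"
    using norm_triangle_ineq2[of a "cnj q - w"] norm_triangle_ineq4[of "cnj q" w] a(2) Sec_cmod[OF w] dual_cell_norm[OF q] by (auto simp: algebra_simps)
  have "c / 6 ^ 4 \<le> c / cmod (a + w - cnj q) ^ 4"
    using le ne c by (intro divide_left_mono power_mono) auto
  also have "\<dots> = c / (cmod (1 - cnj q * (1 / (a + w))) * cmod (a + w)) ^ 4"
    unfolding mobius_step(1)[OF w a(1) a0 q] ..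
  also have "\<dots> = c / cmod (1 - cnj q * (1 / (a + w))) ^ 4 * (1 / cmod (a + w) ^ 4)"
    by (simp add: power_mult_distrib)
  finally have "ennreal (c / 6 ^ 4) \<le> ennreal (c / cmod (1 - cnj q * (1 / (a + w))) ^ 4 * (1 / cmod (a + w) ^ 4))"
    by (rule ennreal_leI)
  also have "\<dots> = ennreal (c / cmod (1 - cnj q * (1 / (a + w))) ^ 4) * ennreal (1 / cmod (a + w) ^ 4)"
    by (rule ennreal_mult'') simp
  also have "\<dots> = basic t k q c (1 / (a + w)) * ennreal (1 / cmod (a + w) ^ 4)" using cell by (simp add: basic_def)
  also have "\<dots> \<le> PF (basic t k q c) w" by (rule branch_term_le_PF[OF w a(1) a0])
  finally show ?thesis .
qed

text \<open>For t < 2 one full digit reaches the cell from every w. For types 2 and 3 a digit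
  reaches it only from one sector, and a second digit reaches that sector from every w; each step
  costs 6^4.\<close>

lemma basic_lower_bound:
  assumes t: "t < 4" and q: "q \<in> dual_cell t k" and c: "0 \<le> c" and w: "w \<in> Sec"
  shows "ennreal c \<le> ennreal (6 ^ 8) * (PF (basic t k q c) w + PF (PF (basic t k q c)) w)"
proof -
  obtain a where a: "a \<in> J_ideal" "3 \<le> cmod a" "cmod a \<le> 4"
    "t < 2 \<Longrightarrow> \<forall>w\<in>Sec. 1 / (a + w) \<in> cell t k" "\<not> t < 2 \<Longrightarrow> \<forall>w\<in>cell 0 (1 + 5 * k). 1 / (a + w) \<in> cell t k"
    using full_digit[OF t] by metis
  have "ennreal (c / 6 ^ 8) \<le> PF (basic t k q c) w + PF (PF (basic t k q c)) w"
  proof (cases "t < 2")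
    case True
    have "ennreal (c / 6 ^ 8) \<le> ennreal (c / 6 ^ 4)" using c by (intro ennreal_leI divide_left_mono) auto
    also have "\<dots> \<le> PF (basic t k q c) w" using basic_full_branch[OF t q c w a(1-3)] a(4)[OF True] w by blast
    finally show ?thesis by (rule order_trans) simp
  next
    case False
    let ?b = "basic 0 (1 + 5 * k) 0 (c / 6 ^ 4)"
    have b: "?b z \<le> PF (basic t k q c) z" for z
    proof (cases "z \<in> cell 0 (1 + 5 * k)")
      case True
      then show ?thesis using basic_full_branch[OF t q c _ a(1-3), of z] a(5)[OF False] cell_subset_Sec
        by (auto simp: basic_def)
    qed (simp add: basic_def)
    obtain a' where a': "a' \<in> J_ideal" "3 \<le> cmod a'" "cmod a' \<le> 4" "\<forall>w\<in>Sec. 1 / (a' + w) \<in> cell 0 (1 + 5 * k)"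
      using full_digit[of 0 "1 + 5 * k"] by (metis zero_less_numeral)
    have "ennreal (c / 6 ^ 8) = ennreal (c / 6 ^ 4 / 6 ^ 4)" by simp
    also have "\<dots> \<le> PF ?b w" using c a'(4) w by (intro basic_full_branch[OF _ dual_cell_zero _ w a'(1-3)]) auto
    also have "\<dots> \<le> PF (PF (basic t k q c)) w" by (rule PF_mono[OF b])
    finally show ?thesis by (rule order_trans) simp
  qed
  then have "ennreal (6 ^ 8) * ennreal (c / 6 ^ 8) \<le> ennreal (6 ^ 8) * (PF (basic t k q c) w + PF (PF (basic t k q c)) w)"
    by (intro mult_left_mono) auto
  moreover have "ennreal (6 ^ 8) * ennreal (c / 6 ^ 8) = ennreal c" by (subst ennreal_mult'[symmetric]) auto
  ultimately show ?thesis by simp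
qed

text \<open>The bound of 1 / |1 - cnj q z|^4 on the disc of radius r, times its area, times the
  constant of \<open>basic_lower_bound\<close>.\<close>

definition Kc :: "real \<Rightarrow> ennreal" where
  "Kc r = ennreal (1 / (1 - r) ^ 4) * emeasure lborel (cball (0::complex) r) * ennreal (6 ^ 8)"

lemma Kc_finite: "Kc r < top"
  unfolding Kc_def using emeasure_lborel_cball_finite[of "0::complex" r] by (auto simp: ennreal_mult_less_top infinity_ennreal_def)

text \<open>A Harnack inequality: mass on a disc controls later values at every point. Basic
  densities satisfy it with a constant independent of t, k, q and c, and it is linear in f, so it
  passes to countable sums.\<close>

lemma cone_harnack:
  assumes "cone f" "0 \<le> r" "r < 1" "w \<in> Sec"
  shows "(\<integral>\<^sup>+z. f z * indicator (cball 0 r) z \<partial>lborel) \<le> Kc r * (PF f w + PF (PF f) w)"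
  using assms
proof (induction rule: cone.induct)
  case (cone_basic t q k c)
  have "(\<integral>\<^sup>+z. basic t k q c z * indicator (cball 0 r) z \<partial>lborel)
     \<le> (\<integral>\<^sup>+z. ennreal (c / (1 - r) ^ 4) * indicator (cball (0::complex) r) z \<partial>lborel)"
  proof (rule nn_integral_mono)
    fix z
    have "basic t k q c z \<le> ennreal (c / (1 - r) ^ 4)" if "cmod z \<le> r"
    proof -
      have "cmod (cnj q * z) \<le> 1 * r" unfolding norm_mult using dual_cell_norm[OF cone_basic(2)] that by (intro mult_mono) auto
      then have "1 - r \<le> cmod (1 - cnj q * z)" using norm_triangle_ineq2[of 1 "cnj q * z"] by simp
      then have "c / cmod (1 - cnj q * z) ^ 4 \<le> c / (1 - r) ^ 4" using cone_basic
        by (intro divide_left_mono power_mono mult_pos_pos zero_less_power) auto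
      then show ?thesis by (auto simp: basic_def indicator_def intro: ennreal_leI)
    qed
    then show "basic t k q c z * indicator (cball 0 r) z \<le> ennreal (c / (1 - r) ^ 4) * indicator (cball 0 r) z"
      by (auto simp: indicator_def)
  qed
  also have "\<dots> = ennreal (c / (1 - r) ^ 4) * emeasure lborel (cball (0::complex) r)"
    by (rule nn_integral_cmult_indicator) simp
  also have "ennreal (c / (1 - r) ^ 4) = ennreal (1 / (1 - r) ^ 4) * ennreal c" using cone_basic by (simp flip: ennreal_mult')
  also have "ennreal (1 / (1 - r) ^ 4) * ennreal c * emeasure lborel (cball (0::complex) r)
     \<le> ennreal (1 / (1 - r) ^ 4) * (ennreal (6 ^ 8) * (PF (basic t k q c) w + PF (PF (basic t k q c)) w)) * emeasure lborel (cball (0::complex) r)"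
    using basic_lower_bound[OF cone_basic(1-3) cone_basic(6)] by (intro mult_right_mono mult_left_mono) auto
  finally show ?case by (simp add: Kc_def mult_ac)
next
  case (cone_suminf f)
  have m [measurable]: "f i \<in> borel_measurable borel" for i using cone_measurable cone_suminf by blast
  have [measurable]: "cball (0::complex) r \<in> sets borel" by simp
  have "(\<integral>\<^sup>+z. (\<Sum>i. f i z) * indicator (cball 0 r) z \<partial>lborel) = (\<integral>\<^sup>+z. (\<Sum>i. f i z * indicator (cball 0 r) z) \<partial>lborel)" by simp
  also have "\<dots> = (\<Sum>i. \<integral>\<^sup>+z. f i z * indicator (cball 0 r) z \<partial>lborel)"
    by (rule nn_integral_suminf) measurable
  also have "\<dots> \<le> (\<Sum>i. Kc r * (PF (f i) w + PF (PF (f i)) w))" using cone_suminf by (intro suminf_le) auto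
  also have "\<dots> = Kc r * ((\<Sum>i. PF (f i) w) + (\<Sum>i. PF (PF (f i)) w))" by (simp add: suminf_add)
  also have "\<dots> = Kc r * (PF (\<lambda>z. \<Sum>i. f i z) w + PF (PF (\<lambda>z. \<Sum>i. f i z)) w)"
  proof -
    have "PF (\<lambda>z. \<Sum>i. f i z) = (\<lambda>w. \<Sum>i. PF (f i) w)" by (rule ext) (rule PF_suminf)
    then show ?thesis by (simp add: PF_suminf)
  qed
  finally show ?case .
qed

section \<open>Inverse branches along orbits\<close>

definition Reg :: "complex set" where "Reg = {x \<in> U_dom. \<forall>n. (T_map ^^ n) x \<in> Sec}"

lemma T_funpow_U: "x \<in> U_dom \<Longrightarrow> (T_map ^^ n) x \<in> U_dom"
  by (cases n) (auto simp: T_map_U)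

lemma negligible_T_funpow_preimage:
  assumes "negligible N" shows "negligible ((T_map ^^ n) -` N \<inter> U_dom)"
proof (induction n)
  case 0
  show ?case using assms by (auto intro: negligible_subset)
next
  case (Suc n)
  have "(T_map ^^ Suc n) -` N \<inter> U_dom = T_map -` ((T_map ^^ n) -` N \<inter> U_dom) \<inter> U_dom"
    using T_map_U by (auto simp: funpow_swap1)
  then show ?case using negligible_T_preimage[OF Suc.IH] by (simp only:)
qed

lemma negligible_U_minus_Reg: "negligible (U_dom - Reg)"
proof -
  have "negligible (\<Union>n. (T_map ^^ n) -` (U_dom - Sec) \<inter> U_dom)"
    by (intro negligible_countable_Union) (auto intro: negligible_T_funpow_preimage negligible_U_minus_Sec)
  moreover have "U_dom - Reg \<subseteq> (\<Union>n. (T_map ^^ n) -` (U_dom - Sec) \<inter> U_dom)"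
    using T_funpow_U by (auto simp: Reg_def)
  ultimately show ?thesis by (rule negligible_subset)
qed

lemma Reg_Sec: "x \<in> Reg \<Longrightarrow> (T_map ^^ n) x \<in> Sec"
  by (auto simp: Reg_def)

text \<open>The inverse branch of the n-th iterate through x. The exact distance formula of Moebius
  maps replaces integration of the derivative over cells, which need not be convex. The last
  conjunct is the chain rule at the orbit point, as 1/z has derivative of modulus 1 / |z|^2.\<close>

definition branch :: "nat \<Rightarrow> complex \<Rightarrow> nat \<Rightarrow> nat \<Rightarrow> complex \<Rightarrow> (complex \<Rightarrow> complex) \<Rightarrow> real \<Rightarrow> bool" where
  "branch n x t k q \<psi> C \<longleftrightarrow> t < 4 \<and> q \<in> dual_cell t k \<and> 0 < C \<and> (T_map ^^ n) x \<in> cell t k \<and> \<psi> ((T_map ^^ n) x) = x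
    \<and> (\<forall>w\<in>cell t k. \<psi> w \<in> Sec \<and> (T_map ^^ n) (\<psi> w) = w)
    \<and> (\<exists>c. cmod c = C \<and> (\<forall>w\<in>cell t k. (\<psi> has_field_derivative c / (1 - cnj q * w)\<^sup>2) (at w)))
    \<and> (\<forall>w\<in>cell t k. \<forall>w'\<in>cell t k. cmod (\<psi> w - \<psi> w') = C * cmod (w - w') / (cmod (1 - cnj q * w) * cmod (1 - cnj q * w')))
    \<and> C / (cmod (1 - cnj q * (T_map ^^ n) x))\<^sup>2 = (\<Prod>j<n. (cmod ((T_map ^^ j) x))\<^sup>2)"

lemma one_minus_pole_nonzero:
  assumes "q \<in> dual_cell t k" "w \<in> Sec" shows "0 < cmod (1 - cnj q * w)"
proof -
  have "cmod (cnj q * w) < 1" using dual_cell_norm[OF assms(1)] Sec_cmod[OF assms(2)]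
    by (simp add: norm_mult) (metis mult_left_le_one_le norm_ge_zero order_le_less_trans)
  then show ?thesis by auto
qed

lemma branch_exists:
  assumes "x \<in> Reg" shows "\<exists>t k q \<psi> C. branch n x t k q \<psi> C"
proof (induction n)
  case 0
  obtain k where k: "k < 6" "x \<in> cell 0 k" using Reg_Sec[OF assms, of 0] by (auto simp: Sec_def)
  \<comment> \<open>The identity has its pole at infinity, hence q = 0.\<close>
  have "branch 0 x 0 k 0 (\<lambda>w. w) 1"
    unfolding branch_def using k dual_cell_zero
    by (auto intro!: exI[of _ 1] derivative_eq_intros intro: cell_subset_Sec[THEN subsetD])
  then show ?case by blast
next
  case (Suc n)
  then obtain t k q \<psi> C where b: "branch n x t k q \<psi> C" by blast
  define y w where "y = (T_map ^^ n) x" and "w = (T_map ^^ Suc n) x"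
  have wT: "w = T_map y" by (simp add: w_def y_def)
  have yG: "y \<in> Sec" and wG: "w \<in> Sec" unfolding y_def w_def using Reg_Sec[OF assms] by blast+
  obtain a where a: "a \<in> J_ideal" "a \<noteq> 0" "y = 1 / (a + w)" using T_digit[of y] yG wG wT by metis
  define e where "e = 1 + 5 * k"
  obtain j where j: "j < 6" "w \<in> cell 0 (e + j)" using Sec_sector[OF wG] by blast
  have t: "t < 4" and q: "q \<in> dual_cell t k" and C: "0 < C" and yQ: "y \<in> cell t k" and \<psi>y: "\<psi> y = x"
    and inv: "\<And>w. w \<in> cell t k \<Longrightarrow> \<psi> w \<in> Sec \<and> (T_map ^^ n) (\<psi> w) = w"
    and met: "\<And>w w'. w \<in> cell t k \<Longrightarrow> w' \<in> cell t k \<Longrightarrow>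
      cmod (\<psi> w - \<psi> w') = C * cmod (w - w') / (cmod (1 - cnj q * w) * cmod (1 - cnj q * w'))"
    and prod: "C / (cmod (1 - cnj q * y))\<^sup>2 = (\<Prod>j<n. (cmod ((T_map ^^ j) x))\<^sup>2)"
    using b unfolding branch_def y_def by blast+
  obtain c where c: "cmod c = C" and der: "\<And>w. w \<in> cell t k \<Longrightarrow> (\<psi> has_field_derivative c / (1 - cnj q * w)\<^sup>2) (at w)"
    using b unfolding branch_def by blast
  define s where "s = nxt t (mdig k a) (ndig k a) j"
  have tr: "1 / (a + z) \<in> cell t k \<longleftrightarrow> adm t (mdig k a) (ndig k a) j \<and> z \<in> cell s (e + j)" if "z \<in> cell 0 (e + j)" for z
    using cell_transition[OF t a(1,2) j(1)] that unfolding s_def e_def by blast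
  have ad: "adm t (mdig k a) (ndig k a) j" and wQ: "w \<in> cell s (e + j)" using tr[OF j(2)] yQ a(3) by auto
  define p where "p = 1 / (q - cnj a)"
  have pV: "p \<in> dual_cell s (e + j)" using dual_cell_transition[OF t a(1) j(1) q ad] by (simp add: p_def s_def e_def)
  have s4: "s < 4" unfolding s_def by (rule nxt_less_4)
  have u: "cnj q - a \<noteq> 0" using dual_cell_pole_bound q a by blast
  have zG: "z \<in> Sec" and zQ: "1 / (a + z) \<in> cell t k" and zn: "a + z \<noteq> 0" if "z \<in> cell s (e + j)" for z
  proof -
    show "z \<in> Sec" using that cell_subset_Sec by blast
    then show "a + z \<noteq> 0" using digit_add_nonzero a by blast
    show "1 / (a + z) \<in> cell t k" using tr[of z] ad that cell_subset_cell0 by blast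
  qed
  have ms: "cmod (1 - cnj q * (1 / (a + z))) = cmod (cnj q - a) * cmod (1 - cnj p * z) / cmod (a + z)"
    if "z \<in> cell s (e + j)" for z using mobius_step(2)[OF zG[OF that] a(1,2) q] by (simp add: p_def)
  define C' where "C' = C / (cmod (cnj q - a))\<^sup>2"
  have "branch (Suc n) x s (e + j) p (\<lambda>z. \<psi> (1 / (a + z))) C'"
    unfolding branch_def w_def[symmetric]
  proof (intro conjI ballI)
    show "s < 4" "p \<in> dual_cell s (e + j)" "w \<in> cell s (e + j)" by (fact s4 pV wQ)+
    show "0 < C'" using C u by (simp add: C'_def)
    show "\<psi> (1 / (a + w)) = x" using a(3) \<psi>y by simp
    show "\<exists>c. cmod c = C' \<and> (\<forall>z\<in>cell s (e + j). ((\<lambda>z. \<psi> (1 / (a + z))) has_field_derivative c / (1 - cnj p * z)\<^sup>2) (at z))"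
    proof (intro exI conjI ballI)
      show "cmod (- c / (cnj q - a)\<^sup>2) = C'" by (simp add: C'_def norm_divide norm_power c)
      fix z assume z: "z \<in> cell s (e + j)"
      note zz = zG[OF z] zQ[OF z] zn[OF z]
      have "((\<lambda>z. 1 / (a + z)) has_field_derivative - 1 / (a + z)\<^sup>2) (at z)"
        using zz by (auto intro!: derivative_eq_intros simp: power2_eq_square)
      from DERIV_chain2[OF der[OF zz(2)] this]
      have d: "((\<lambda>z. \<psi> (1 / (a + z))) has_field_derivative c / (1 - cnj q * (1 / (a + z)))\<^sup>2 * (- 1 / (a + z)\<^sup>2)) (at z)" .
      \<comment> \<open>The identities of \<open>mobius_step\<close> before taking moduli, needed
        for the derivative itself.\<close>
      have "(1 - cnj q * (1 / (a + z))) * (a + z) = a + z - cnj q" using zz by (simp add: field_simps)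
      moreover have "(cnj q - a) * (1 - cnj p * z) = - (a + z - cnj q)" using u by (simp add: p_def field_simps)
      ultimately have "(1 - cnj q * (1 / (a + z))) * (a + z) = - ((cnj q - a) * (1 - cnj p * z))" by simp
      then have "(1 - cnj q * (1 / (a + z)))\<^sup>2 * (a + z)\<^sup>2 = (cnj q - a)\<^sup>2 * (1 - cnj p * z)\<^sup>2"
        by (metis power_mult_distrib power2_minus)
      then have "c / (1 - cnj q * (1 / (a + z)))\<^sup>2 * (- 1 / (a + z)\<^sup>2) = - c / (cnj q - a)\<^sup>2 / (1 - cnj p * z)\<^sup>2"
        by (simp only: times_divide_times_eq divide_divide_eq_left mult_minus_right mult_1_right)
      then show "((\<lambda>z. \<psi> (1 / (a + z))) has_field_derivative - c / (cnj q - a)\<^sup>2 / (1 - cnj p * z)\<^sup>2) (at z)"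
        using d by (simp only:)
    qed
    fix z assume z: "z \<in> cell s (e + j)"
    note zz = zG[OF z] zQ[OF z] zn[OF z]
    show "\<psi> (1 / (a + z)) \<in> Sec" using inv zz by blast
    have "T_map (1 / (a + z)) = z" using zz a Sec_U by (intro T_map_eqI) auto
    then show "(T_map ^^ Suc n) (\<psi> (1 / (a + z))) = z" using inv[OF zz(2)] by simp
    fix z' assume z': "z' \<in> cell s (e + j)"
    note zz' = zG[OF z'] zQ[OF z'] zn[OF z']
    have "1 / (a + z) - 1 / (a + z') = (z' - z) / ((a + z) * (a + z'))" using zz zz' by (simp add: field_simps)
    then have "cmod (1 / (a + z) - 1 / (a + z')) = cmod (z - z') / (cmod (a + z) * cmod (a + z'))"
      by (simp add: norm_divide norm_mult norm_minus_commute)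
    then show "cmod (\<psi> (1 / (a + z)) - \<psi> (1 / (a + z'))) = C' * cmod (z - z') / (cmod (1 - cnj p * z) * cmod (1 - cnj p * z'))"
      unfolding met[OF zz(2) zz'(2)] ms[OF z] ms[OF z'] C'_def using zz zz'
      by (simp add: power2_eq_square)
  next
    have "C' / (cmod (1 - cnj p * w))\<^sup>2 = C / (cmod (1 - cnj q * y))\<^sup>2 * (cmod y)\<^sup>2"
      unfolding a(3) ms[OF wQ] C'_def using zn[OF wQ] by (simp add: power_divide power_mult_distrib norm_divide)
    then show "C' / (cmod (1 - cnj p * w))\<^sup>2 = (\<Prod>j<Suc n. (cmod ((T_map ^^ j) x))\<^sup>2)"
      unfolding prod by (simp add: y_def)
  qed
  then show ?case by blast
qed

section \<open>Vertices as Eisenstein integers, and recurrence away from the unit circle\<close>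

definition Eis :: "complex set" where "Eis = {latt m n | m n. True}"

lemma Eis_iff: "z \<in> Eis \<longleftrightarrow> Xc z \<in> \<int> \<and> Yc z \<in> \<int>"
proof
  assume "Xc z \<in> \<int> \<and> Yc z \<in> \<int>"
  then obtain m n where "Xc z = of_int m" "Yc z = of_int n" by (auto elim!: Ints_cases)
  then have "z = latt m n" by (simp add: coords_inject)
  then show "z \<in> Eis" by (auto simp: Eis_def)
qed (auto simp: Eis_def)

lemma Eis_closed: "z \<in> Eis \<Longrightarrow> w \<in> Eis \<Longrightarrow> z - w \<in> Eis" "z \<in> Eis \<Longrightarrow> cnj z \<in> Eis" "z \<in> Eis \<Longrightarrow> zeta ^ e * z \<in> Eis"
  "a \<in> J_ideal \<Longrightarrow> a \<in> Eis"
proof -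
  show "zeta ^ e * z \<in> Eis" if "z \<in> Eis" using that by (induction e) (auto simp: Eis_iff mult.assoc)
qed (auto simp: Eis_iff J_ideal_iff)

text \<open>The norm form takes integer values, so distinct Eisenstein integers are at distance at
  least 1. Vertices of the hexagon are not in \<open>J_ideal\<close>, which is why the full ring is
  used.\<close>

lemma Eis_eq_close: assumes "z \<in> Eis" "w \<in> Eis" "cmod (z - w) < 1" shows "z = w"
proof -
  obtain m n where mn: "z - w = latt m n" using Eis_closed(1)[OF assms(1,2)] by (auto simp: Eis_def)
  have "(cmod (z - w))\<^sup>2 < 1" using assms(3) by (simp add: abs_square_less_1)
  moreover have "(cmod (z - w))\<^sup>2 = real_of_int (m\<^sup>2 + m * n + n\<^sup>2)" unfolding mn cmod_coords by simp
  ultimately have "m\<^sup>2 + m * n + n\<^sup>2 < 1" by linarith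
  moreover have "4 * (m\<^sup>2 + m * n + n\<^sup>2) = (2 * m + n)\<^sup>2 + 3 * n\<^sup>2" "4 * (m\<^sup>2 + m * n + n\<^sup>2) = (2 * n + m)\<^sup>2 + 3 * m\<^sup>2"
    by (simp_all add: power2_eq_square algebra_simps)
  moreover have "B \<le> 0" if "S < 1" "4 * S = A + 3 * B" "0 \<le> A" for A B S :: int using that by linarith
  ultimately have "n\<^sup>2 \<le> 0" "m\<^sup>2 \<le> 0" using zero_le_power2[of "2 * m + n"] zero_le_power2[of "2 * n + m"] by blast+
  then have "m = 0" "n = 0" by simp_all
  then show ?thesis using mn by (simp add: coords_inject)
qed

text \<open>3/4 is the squared norm of the midpoint of a side, so beyond it the larger sector
  coordinate \<alpha> exceeds 1/2. Then the distance to the nearer vertex is at most 1 - \<alpha>,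
  while 1 - |y|^2 >= \<alpha> (1 - \<alpha>) >= (1 - \<alpha>) / 2.\<close>

lemma near_vertex:
  assumes "y \<in> Sec" "3/4 < (cmod y)\<^sup>2"
  shows "\<exists>v\<in>Eis. cmod v = 1 \<and> cmod (y - v) \<le> 2 * (1 - (cmod y)\<^sup>2)"
proof -
  have main: "(1 - \<alpha>)\<^sup>2 - (1 - \<alpha>) * \<beta> + \<beta>\<^sup>2 \<le> (2 * (1 - (\<alpha>\<^sup>2 + \<alpha> * \<beta> + \<beta>\<^sup>2)))\<^sup>2"
    if h: "0 < \<beta>" "\<beta> \<le> \<alpha>" "\<alpha> + \<beta> < 1" "3/4 < \<alpha>\<^sup>2 + \<alpha> * \<beta> + \<beta>\<^sup>2" for \<alpha> \<beta> :: real
  proof -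
    let ?N = "\<alpha>\<^sup>2 + \<alpha> * \<beta> + \<beta>\<^sup>2"
    have a: "1/2 < \<alpha>"
    proof (rule ccontr)
      assume "\<not> 1/2 < \<alpha>"
      then have "\<alpha> * \<alpha> \<le> 1/2 * (1/2)" "\<alpha> * \<beta> \<le> 1/2 * (1/2)" "\<beta> * \<beta> \<le> 1/2 * (1/2)" using h by (intro mult_mono; simp)+
      then show False using h(4) by (simp add: power2_eq_square)
    qed
    have "\<beta> * (\<alpha> + \<beta>) \<le> (1 - \<alpha>) * 1" using h by (intro mult_mono) auto
    then have "?N \<le> 1 - \<alpha> * (1 - \<alpha>)" by (simp add: power2_eq_square algebra_simps)
    moreover have "1/2 * (1 - \<alpha>) \<le> \<alpha> * (1 - \<alpha>)" using a h by (intro mult_right_mono) auto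
    moreover have "1 - \<alpha> \<le> 2 * (1 - A)" if "A \<le> 1 - B" "1/2 * (1 - \<alpha>) \<le> B" for A B using that by simp
    ultimately have t: "1 - \<alpha> \<le> 2 * (1 - ?N)" by blast
    have "\<beta> * \<beta> \<le> (1 - \<alpha>) * \<beta>" using h by (intro mult_right_mono) auto
    then have "(1 - \<alpha>)\<^sup>2 - (1 - \<alpha>) * \<beta> + \<beta>\<^sup>2 \<le> (1 - \<alpha>)\<^sup>2" by (simp add: power2_eq_square)
    also have "\<dots> \<le> (2 * (1 - ?N))\<^sup>2" using t h by (intro power_mono) auto
    finally show ?thesis .
  qed
  obtain k where k: "k < 6" "y \<in> cell 0 k" using assms by (auto simp: Sec_def)
  define z where "z = zeta ^ k * y"
  have nz: "cmod z = cmod y" by (simp add: z_def norm_mult norm_power)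
  have zp: "0 < Xc z" "0 < Yc z" "Xc z + Yc z < 1" using k by (auto simp: cell_def cell0_def z_def)
  have near: "cmod (z - v) \<le> 2 * (1 - (cmod y)\<^sup>2)"
    if "0 < \<beta>" "\<beta> \<le> \<alpha>" "\<alpha> + \<beta> < 1" and N: "(cmod y)\<^sup>2 = \<alpha>\<^sup>2 + \<alpha> * \<beta> + \<beta>\<^sup>2"
      and d: "(cmod (z - v))\<^sup>2 = (1 - \<alpha>)\<^sup>2 - (1 - \<alpha>) * \<beta> + \<beta>\<^sup>2" for v \<alpha> \<beta>
  proof (rule power2_le_imp_le)
    show "(cmod (z - v))\<^sup>2 \<le> (2 * (1 - (cmod y)\<^sup>2))\<^sup>2" unfolding d N by (rule main) (use that assms(2) in simp_all)
  qed (use Sec_cmod[OF assms(1)] in \<open>simp add: abs_square_le_1\<close>)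
  have "\<exists>v\<in>Eis. cmod v = 1 \<and> cmod (z - v) \<le> 2 * (1 - (cmod y)\<^sup>2)"
  proof (cases "Yc z \<le> Xc z")
    case True
    have "cmod (z - zeta) \<le> 2 * (1 - (cmod y)\<^sup>2)" using zp True cmod_coords[of z] cmod_coords[of "z - zeta"] nz
      by (intro near[of "Yc z" "Xc z"]) (simp_all add: power2_eq_square algebra_simps)
    then show ?thesis by (intro bexI[of _ zeta]) (auto simp: Eis_iff)
  next
    case False
    have "cmod (z - 1) \<le> 2 * (1 - (cmod y)\<^sup>2)" using zp False cmod_coords[of z] cmod_coords[of "z - 1"] nz
      by (intro near[of "Xc z" "Yc z"]) (simp_all add: power2_eq_square algebra_simps)
    then show ?thesis by (intro bexI[of _ 1]) (auto simp: Eis_iff)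
  qed
  then obtain v where v: "v \<in> Eis" "cmod v = 1" "cmod (z - v) \<le> 2 * (1 - (cmod y)\<^sup>2)" by blast
  have "zeta ^ (5 * k) * z = zeta ^ (6 * k) * y" by (simp add: z_def mult.assoc[symmetric] power_add[symmetric])
  then have y: "zeta ^ (5 * k) * z = y" by (simp only: zeta_pow_6) simp
  have "y - zeta ^ (5 * k) * v = zeta ^ (5 * k) * (z - v)" unfolding right_diff_distrib y ..
  then have "cmod (y - zeta ^ (5 * k) * v) = cmod (z - v)" by (simp add: norm_mult norm_power)
  then show ?thesis using v Eis_closed(3)[OF v(1)] by (intro bexI[of _ "zeta ^ (5 * k) * v"]) (auto simp: norm_mult norm_power)
qed

abbreviation visits :: "real \<Rightarrow> complex \<Rightarrow> bool" where
  "visits r x \<equiv> \<exists>\<^sub>\<infinity>n. cmod ((T_map ^^ n) x) \<le> r"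

lemma visits_disc:
  assumes x: "x \<in> Reg"
  shows "\<exists>r<1. visits r x"
proof (rule ccontr)
  assume neg: "\<not> ?thesis"
  let ?y = "\<lambda>n. (T_map ^^ n) x"
  have ev: "\<exists>M. \<forall>n\<ge>M. r < cmod (?y n)" if "r < 1" for r
  proof -
    have "\<not> (\<exists>\<^sub>\<infinity>n. cmod (?y n) \<le> r)" using neg that by blast
    then show ?thesis by (auto simp: INFM_nat_le not_le) (metis not_le)
  qed
  have yG: "?y n \<in> Sec" for n using Reg_Sec[OF x] .
  \<comment> \<open>19/20 is chosen so that 2 (1 - (19/20)^2) <= 1/5: from time M on, the orbit
    stays within 1/5 of a vertex.\<close>
  obtain M where M: "\<And>n. n \<ge> M \<Longrightarrow> 19/20 < cmod (?y n)" using ev[of "19/20"] by auto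
  have sq: "(19/20)\<^sup>2 < (cmod (?y n))\<^sup>2" if "n \<ge> M" for n using M[OF that] by (intro power_strict_mono) auto
  have vert: "\<exists>v\<in>Eis. cmod v = 1 \<and> cmod (?y n - v) \<le> 2 * (1 - (cmod (?y n))\<^sup>2)" if "n \<ge> M" for n
    using near_vertex[OF yG] sq[OF that] by (simp add: power2_eq_square)
  have vert': "\<exists>v\<in>Eis. cmod v = 1 \<and> cmod (?y n - v) \<le> 1/5" if "n \<ge> M" for n
  proof -
    have "2 * (1 - (cmod (?y n))\<^sup>2) \<le> 1/5" using sq[OF that] by (simp add: power2_eq_square)
    then show ?thesis using vert[OF that] by force
  qed
  obtain e0 where e0: "e0 \<in> Eis" "cmod e0 = 1" "cmod (?y M - e0) \<le> 1/5" using vert'[of M] by auto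
  define d where "d = cmod (?y M - e0)"
  have dpos: "0 < d" unfolding d_def using Sec_cmod[OF yG[of M]] e0 by auto
  \<comment> \<open>The nearby vertex e moves with the orbit to e' = cnj e - a, and the distance
    never decreases. That e' is again a vertex is forced: it is within 4/19 + 1/5 < 1 of the vertex
    v near the next point, so e' = v.\<close>
  have track: "\<exists>e\<in>Eis. cmod e = 1 \<and> cmod (?y n - e) \<le> 1/5 \<and> d \<le> cmod (?y n - e)" if "n \<ge> M" for n
    using that
  proof (induction n rule: dec_induct)
    case base
    then show ?case using e0 d_def by auto
  next
    case (step n)
    then obtain e where e: "e \<in> Eis" "cmod e = 1" "cmod (?y n - e) \<le> 1/5" "d \<le> cmod (?y n - e)" by auto
    have Tn: "?y (Suc n) = T_map (?y n)" by simp
    obtain a where a: "a \<in> J_ideal" "a \<noteq> 0" "?y n = 1 / (a + ?y (Suc n))"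
      using T_digit[of "?y n"] yG[of n] yG[of "Suc n"] unfolding Tn by metis
    have yn0: "?y n \<noteq> 0" using yG[of n] zero_notin_Sec by auto
    have aw: "1 / ?y n = a + ?y (Suc n)" using a(3) yn0 by (metis div_by_1 divide_divide_eq_right mult_1 nonzero_eq_divide_eq divide_eq_eq)
    have en0: "e \<noteq> 0" using e by auto
    have ce: "1 / e = cnj e" using complex_div_cnj[of 1 e] e(2) by simp
    define e' where "e' = cnj e - a"
    have e'E: "e' \<in> Eis" unfolding e'_def using Eis_closed e a by blast
    have "?y (Suc n) - e' = 1 / ?y n - 1 / e" unfolding e'_def ce aw by simp
    also have "\<dots> = (e - ?y n) / (?y n * e)" using yn0 en0 by (simp add: field_simps)
    finally have D: "cmod (?y (Suc n) - e') = cmod (?y n - e) / cmod (?y n)"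
      using e(2) by (simp add: norm_divide norm_mult norm_minus_commute)
    have yn: "19/20 < cmod (?y n)" "cmod (?y n) < 1" "0 < cmod (?y n)" using M[of n] step Sec_cmod[OF yG[of n]] yn0 by auto
    have "cmod (?y n - e) / 1 \<le> cmod (?y n - e) / cmod (?y n)" using yn by (intro divide_left_mono) auto
    then have ge: "d \<le> cmod (?y (Suc n) - e')" unfolding D using e(4) by simp
    have "cmod (?y n - e) / cmod (?y n) \<le> (1/5) / (19/20)" using yn e(3) by (intro frac_le) auto
    then have le: "cmod (?y (Suc n) - e') \<le> 4/19" unfolding D by simp
    obtain v where v: "v \<in> Eis" "cmod v = 1" "cmod (?y (Suc n) - v) \<le> 1/5" using vert'[of "Suc n"] step by auto
    have "cmod (v - e') \<le> cmod (?y (Suc n) - e') + cmod (?y (Suc n) - v)"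
      using norm_triangle_ineq4[of "?y (Suc n) - e'" "?y (Suc n) - v"] by simp
    then have "v = e'" using Eis_eq_close[OF v(1) e'E] le v(3) by linarith
    then show ?case using v ge by auto
  qed
  \<comment> \<open>Once |y| > 1 - d/8, \<open>near_vertex\<close> puts y within d/2 of a vertex,
    which must be the tracked one, at distance at least d.\<close>
  define r where "r = max (19/20) (1 - d / 8)"
  have "r < 1" using dpos by (simp add: r_def)
  then obtain M' where M': "\<And>n. n \<ge> M' \<Longrightarrow> r < cmod (?y n)" using ev by blast
  define n where "n = max M M'"
  have n: "n \<ge> M" "n \<ge> M'" by (auto simp: n_def)
  obtain e where e: "e \<in> Eis" "cmod e = 1" "cmod (?y n - e) \<le> 1/5" "d \<le> cmod (?y n - e)" using track[OF n(1)] by auto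
  obtain v where v: "v \<in> Eis" "cmod v = 1" "cmod (?y n - v) \<le> 2 * (1 - (cmod (?y n))\<^sup>2)" using vert[OF n(1)] by blast
  have yr: "1 - d / 8 < cmod (?y n)" "cmod (?y n) < 1" using M'[OF n(2)] Sec_cmod[OF yG[of n]] by (auto simp: r_def)
  have "1 - (cmod (?y n))\<^sup>2 = (1 - cmod (?y n)) * (1 + cmod (?y n))" by (simp add: power2_eq_square algebra_simps)
  also have "\<dots> \<le> (d / 8) * 2" using yr by (intro mult_mono) auto
  finally have vd: "cmod (?y n - v) \<le> d / 2" using v(3) by simp
  have "cmod (v - e) \<le> cmod (?y n - e) + cmod (?y n - v)"
    using norm_triangle_ineq4[of "?y n - e" "?y n - v"] by simp
  then have "cmod (v - e) < 1" using vd e(3,4) by linarith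
  then have "v = e" using Eis_eq_close v e by blast
  then show False using vd e(4) dpos by simp
qed

section \<open>Ergodicity\<close>

text \<open>From 3 <= |a| <= 4 and |w| < 1 follows 2 <= |a + w| <= 5: the lower bound gives the disc
  of radius 1/2, the upper one the Jacobian bound 1 / 5^4.\<close>

lemma inverse_translate_image:
  assumes a: "a \<in> J_ideal" "3 \<le> cmod a" "cmod a \<le> 4" and S: "S \<in> lmeasurable" and SG: "S \<subseteq> Sec"
  shows "(\<lambda>w. 1 / (a + w)) ` S \<in> lmeasurable"
    "leb S * ennreal (1 / 5 ^ 4) \<le> leb ((\<lambda>w. 1 / (a + w)) ` S)"
    "(\<lambda>w. 1 / (a + w)) ` S \<subseteq> cball 0 (1/2)"
proof -
  let ?\<phi> = "\<lambda>w. 1 / (a + w)"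
  have b: "2 \<le> cmod (a + w)" "cmod (a + w) \<le> 5" if "w \<in> S" for w
  proof -
    have "cmod w < 1" using that SG Sec_cmod by blast
    then show "2 \<le> cmod (a + w)" "cmod (a + w) \<le> 5"
      using a norm_triangle_ineq2[of a "- w"] norm_triangle_ineq[of a w] by auto
  qed
  have nz: "a + w \<noteq> 0" if "w \<in> S" for w using b[OF that] by auto
  show sub: "?\<phi> ` S \<subseteq> cball 0 (1/2)"
  proof clarsimp
    fix w assume "w \<in> S"
    have "1 / cmod (a + w) \<le> 1 / 2" using b[OF \<open>w \<in> S\<close>] by (intro divide_left_mono) auto
    then show "cmod (1 / (a + w)) * 2 \<le> 1" by (simp add: norm_divide)
  qed
  have d: "(?\<phi> has_field_derivative - 1 / (a + z)\<^sup>2) (at z)" if "z \<in> S" for z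
    using nz[OF that] by (auto intro!: derivative_eq_intros simp: power2_eq_square)
  have i: "inj_on ?\<phi> S" by (auto simp: inj_on_def)
  have B: "cmod (- 1 / (a + z)\<^sup>2) \<le> 1 / 2\<^sup>2" "1 / 5\<^sup>2 \<le> cmod (- 1 / (a + z)\<^sup>2)" if "z \<in> S" for z
  proof -
    have "0 < cmod (a + z)" using nz[OF that] by simp
    then have "1 / (cmod (a + z))\<^sup>2 \<le> 1 / 2\<^sup>2" "1 / 5\<^sup>2 \<le> 1 / (cmod (a + z))\<^sup>2"
      using b[OF that] by (intro divide_left_mono power_mono mult_pos_pos zero_less_power; simp)+
    then show "cmod (- 1 / (a + z)\<^sup>2) \<le> 1 / 2\<^sup>2" "1 / 5\<^sup>2 \<le> cmod (- 1 / (a + z)\<^sup>2)"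
      by (simp_all add: norm_divide norm_power)
  qed
  have bm: "(\<lambda>z. - 1 / (a + z)\<^sup>2) \<in> borel_measurable borel" by measurable
  have "bounded (?\<phi> ` S)" using sub bounded_cball bounded_subset by blast
  then show "?\<phi> ` S \<in> lmeasurable"
    using holomorphic_image_emeasure(1)[OF S d i B(1) bm] by (rule bounded_set_imp_lmeasurable)
  show "leb S * ennreal (1 / 5 ^ 4) \<le> leb (?\<phi> ` S)"
    using holomorphic_image_emeasure_ge[OF S d i B _ bm] by (simp add: power_divide)
qed

text \<open>Pulling \<open>A \<inter> Sec\<close> back through a full digit stays in
  \<open>A\<close> by invariance and lands in the cell; types 2 and 3 need two digits. The share is
  the same for all cells, which is what makes proportions uniform along an orbit.\<close>

lemma invariant_set_in_states:
  assumes A: "A \<in> sets lebesgue" "A \<subseteq> U_dom" and inv: "T_map -` A \<inter> U_dom = A" and t: "t < 4"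
  shows "\<exists>E. E \<in> lmeasurable \<and> E \<subseteq> A \<inter> cell t k \<inter> cball 0 (1/2) \<and> leb (A \<inter> Sec) * ennreal (1 / 5 ^ 8) \<le> leb E"
proof -
  have Gl: "Sec \<in> sets lebesgue" using Sec_borel by simp
  have bG: "bounded Sec" using Sec_cmod by (intro boundedI[of _ 1]) force
  have pull: "(\<lambda>w. 1 / (a + w)) ` S \<subseteq> A" if "a \<in> J_ideal" "S \<subseteq> A \<inter> Sec" "(\<lambda>w. 1 / (a + w)) ` S \<subseteq> Sec" "a \<noteq> 0" for a S
  proof
    fix z assume "z \<in> (\<lambda>w. 1 / (a + w)) ` S"
    then obtain w where w: "w \<in> S" "z = 1 / (a + w)" by blast
    have "T_map z = w" unfolding w(2) using that w digit_add_nonzero Sec_U by (intro T_map_eqI) auto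
    moreover have "z \<in> U_dom" using that w Sec_U by blast
    ultimately show "z \<in> A" using inv w that by blast
  qed
  have full: "\<exists>E. E \<in> lmeasurable \<and> E \<subseteq> A \<inter> cell t k \<inter> cball 0 (1/2) \<and> leb (A \<inter> Sec) * ennreal (1 / 5 ^ 4) \<le> leb E"
    if t2: "t < 2" for t k
  proof -
    have "t < 4" using t2 by simp
    from full_digit[OF this, of k] obtain a where a: "a \<in> J_ideal" "3 \<le> cmod a" "cmod a \<le> 4" "\<forall>w\<in>Sec. 1 / (a + w) \<in> cell t k"
      using t2 by metis
    have Sm: "A \<inter> Sec \<in> lmeasurable" using A(1) Gl bG by (intro bounded_set_imp_lmeasurable bounded_Int) auto
    note im = inverse_translate_image[OF a(1-3) Sm Int_lower2]
    have Qs: "(\<lambda>w. 1 / (a + w)) ` (A \<inter> Sec) \<subseteq> cell t k" using a(4) by auto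
    have "(\<lambda>w. 1 / (a + w)) ` (A \<inter> Sec) \<subseteq> A" using a(1,2) order_trans[OF Qs cell_subset_Sec] by (intro pull) auto
    then show ?thesis using im Qs by (intro exI[of _ "(\<lambda>w. 1 / (a + w)) ` (A \<inter> Sec)"]) auto
  qed
  show ?thesis
  proof (cases "t < 2")
    case True
    have "leb (A \<inter> Sec) * ennreal (1 / 5 ^ 8) \<le> leb (A \<inter> Sec) * ennreal (1 / 5 ^ 4)"
      by (intro mult_left_mono ennreal_leI) auto
    then show ?thesis using full[OF True, of k] by (meson order_trans)
  next
    case False
    obtain a where a: "a \<in> J_ideal" "3 \<le> cmod a" "cmod a \<le> 4" "\<forall>w\<in>cell 0 (1 + 5 * k). 1 / (a + w) \<in> cell t k"
      using full_digit[OF t, of k] False by metis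
    obtain E where E: "E \<in> lmeasurable" "E \<subseteq> A \<inter> cell 0 (1 + 5 * k) \<inter> cball 0 (1/2)" "leb (A \<inter> Sec) * ennreal (1 / 5 ^ 4) \<le> leb E"
      using full[of 0 "1 + 5 * k"] by auto
    have EG: "E \<subseteq> Sec" using E(2) cell_subset_Sec by blast
    note im = inverse_translate_image[OF a(1-3) E(1) EG]
    have Qs: "(\<lambda>w. 1 / (a + w)) ` E \<subseteq> cell t k" using a(4) E(2) by blast
    have sA: "(\<lambda>w. 1 / (a + w)) ` E \<subseteq> A" using a(1,2) order_trans[OF Qs cell_subset_Sec] E(2) EG by (intro pull) auto
    have "leb (A \<inter> Sec) * ennreal (1 / 5 ^ 8) = leb (A \<inter> Sec) * ennreal (1 / 5 ^ 4) * ennreal (1 / 5 ^ 4)"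
      by (simp add: mult.assoc flip: ennreal_mult')
    also have "\<dots> \<le> leb E * ennreal (1 / 5 ^ 4)" by (intro mult_right_mono E(3)) auto
    also have "\<dots> \<le> leb ((\<lambda>w. 1 / (a + w)) ` E)" by (rule im(2))
    finally show ?thesis using im Qs sA by (intro exI[of _ "(\<lambda>w. 1 / (a + w)) ` E"]) auto
  qed
qed

text \<open>The branch carries the piece \<open>E\<close> of \<open>A\<close> in the cell close to
  x. On |w| <= r its images of two points differ by at most 2 C / (1 - r)^2; the 3 in the radius
  makes this strict. The hypothesis 1/2 <= r puts \<open>E\<close> inside that disc.\<close>

lemma branch_ball:
  assumes b: "branch n x t k q \<psi> C" and r: "1/2 \<le> r" "r < 1" and y: "cmod ((T_map ^^ n) x) \<le> r"
    and A: "A \<in> sets lebesgue" "A \<subseteq> U_dom" and inv: "T_map -` A \<inter> U_dom = A"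
  shows "leb (A \<inter> Sec) * ennreal (1 / 5 ^ 8) * ennreal ((1 - r) ^ 4 / 144 * (3 * C / (1 - r)\<^sup>2)\<^sup>2)
     \<le> leb (A \<inter> ball x (3 * C / (1 - r)\<^sup>2))"
proof -
  let ?y = "(T_map ^^ n) x"
  have t: "t < 4" and q: "q \<in> dual_cell t k" and C: "0 < C" and yQ: "?y \<in> cell t k" and \<psi>y: "\<psi> ?y = x"
    and inv': "\<And>w. w \<in> cell t k \<Longrightarrow> \<psi> w \<in> Sec \<and> (T_map ^^ n) (\<psi> w) = w"
    and met: "\<And>w w'. w \<in> cell t k \<Longrightarrow> w' \<in> cell t k \<Longrightarrow>
      cmod (\<psi> w - \<psi> w') = C * cmod (w - w') / (cmod (1 - cnj q * w) * cmod (1 - cnj q * w'))"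
    using b unfolding branch_def by blast+
  have invn: "z \<in> A" if "z \<in> U_dom" "(T_map ^^ n) z \<in> A" for z n
    using that
  proof (induction n arbitrary: z)
    case (Suc n)
    then have "T_map z \<in> A" using T_map_U by (simp add: funpow_swap1)
    then show ?case using inv Suc.prems by blast
  qed simp
  obtain E where E: "E \<in> lmeasurable" "E \<subseteq> A \<inter> cell t k \<inter> cball 0 (1/2)" "leb (A \<inter> Sec) * ennreal (1 / 5 ^ 8) \<le> leb E"
    using invariant_set_in_states[OF A inv t] by blast
  have lb: "1 - r \<le> cmod (1 - cnj q * w)" if "cmod w \<le> r" for w
  proof -
    have "cmod (cnj q * w) \<le> 1 * r" unfolding norm_mult using dual_cell_norm[OF q] that by (intro mult_mono) auto
    then show ?thesis using norm_triangle_ineq2[of 1 "cnj q * w"] by simp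
  qed
  have Er: "cmod w \<le> r" "w \<in> cell t k" "w \<in> Sec" if "w \<in> E" for w using that E(2) r cell_subset_Sec by fastforce+
  have ub: "cmod (1 - cnj q * w) \<le> 2" if "w \<in> E" for w
  proof -
    have "cmod (cnj q * w) \<le> 1 * 1" unfolding norm_mult using dual_cell_norm[OF q] Er(1)[OF that] r by (intro mult_mono) auto
    then show ?thesis using norm_triangle_ineq4[of 1 "cnj q * w"] by simp
  qed
  have sub: "\<psi> ` E \<subseteq> A \<inter> ball x (3 * C / (1 - r)\<^sup>2)"
  proof
    fix z assume "z \<in> \<psi> ` E"
    then obtain w where w: "w \<in> E" "z = \<psi> w" by blast
    have "z \<in> A" using invn[of z n] inv'[OF Er(2)[OF w(1)]] w E(2) Sec_U by auto
    moreover have "cmod (\<psi> ?y - \<psi> w) < 3 * C / (1 - r)\<^sup>2"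
    proof -
      have "cmod (?y - w) \<le> 2" using norm_triangle_ineq4[of ?y w] y Er(1)[OF w(1)] r by simp
      then have "C * cmod (?y - w) / (cmod (1 - cnj q * ?y) * cmod (1 - cnj q * w)) \<le> C * 2 / ((1 - r) * (1 - r))"
        using C r lb[OF y] lb[OF Er(1)[OF w(1)]] by (intro frac_le mult_mono mult_nonneg_nonneg mult_pos_pos) auto
      also have "\<dots> < 3 * C / (1 - r)\<^sup>2" using C r by (simp add: power2_eq_square divide_strict_right_mono)
      finally show ?thesis using met[OF yQ Er(2)[OF w(1)]] by simp
    qed
    ultimately show "z \<in> A \<inter> ball x (3 * C / (1 - r)\<^sup>2)" using \<psi>y w(2) by (simp add: dist_norm)
  qed
  obtain c where c: "cmod c = C" "\<And>w. w \<in> cell t k \<Longrightarrow> (\<psi> has_field_derivative c / (1 - cnj q * w)\<^sup>2) (at w)"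
    using b unfolding branch_def by blast
  define \<psi>' where "\<psi>' w = c / (1 - cnj q * w)\<^sup>2" for w
  have d\<psi>: "(\<psi> has_field_derivative \<psi>' w) (at w)" "cmod (\<psi>' w) = C / (cmod (1 - cnj q * w))\<^sup>2" if "w \<in> cell t k" for w
    using c that by (simp_all add: \<psi>'_def norm_divide norm_power)
  have inj: "inj_on \<psi> E" using Er inv' by (intro inj_on_inverseI[of _ "T_map ^^ n"]) blast
  have \<psi>'m: "\<psi>' \<in> borel_measurable borel" unfolding \<psi>'_def by measurable
  have bd: "cmod (\<psi>' w) \<le> C / (1 - r)\<^sup>2" if "w \<in> E" for w
  proof -
    have l: "1 - r \<le> cmod (1 - cnj q * w)" using lb[OF Er(1)[OF that]] .
    then have "0 < cmod (1 - cnj q * w)" using r by linarith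
    then show ?thesis unfolding d\<psi>(2)[OF Er(2)[OF that]] using l C r
      by (intro divide_left_mono power_mono mult_pos_pos zero_less_power) auto
  qed
  have bd': "C / 4 \<le> cmod (\<psi>' z)" if "z \<in> E" for z
  proof -
    have "0 < cmod (1 - cnj q * z)" using lb[OF Er(1)[OF that]] r by linarith
    then have "C / 2\<^sup>2 \<le> C / (cmod (1 - cnj q * z))\<^sup>2" using C ub[OF that]
      by (intro divide_left_mono power_mono mult_pos_pos zero_less_power) auto
    then show ?thesis unfolding d\<psi>(2)[OF Er(2)[OF that]] by simp
  qed
  have "leb (A \<inter> Sec) * ennreal (1 / 5 ^ 8) * ennreal ((1 - r) ^ 4 / 144 * (3 * C / (1 - r)\<^sup>2)\<^sup>2)
     \<le> leb E * ennreal ((C / 4)\<^sup>2)"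
  proof (intro mult_mono E(3) ennreal_leI)
    \<comment> \<open>144 = 9 * 16 makes the left side equal to (C / 4)^2, the least Jacobian on
      \<open>E\<close>, where |1 - cnj q w| <= 2.\<close>
    show "(1 - r) ^ 4 / 144 * (3 * C / (1 - r)\<^sup>2)\<^sup>2 \<le> (C / 4)\<^sup>2"
      using r by (simp add: power_divide power_mult_distrib flip: power_mult)
  qed auto
  also have "\<dots> \<le> leb (\<psi> ` E)"
    using C by (intro holomorphic_image_emeasure_ge[OF E(1) d\<psi>(1)[OF Er(2)] inj bd bd' _ \<psi>'m]) auto
  also have "\<dots> \<le> leb (A \<inter> ball x (3 * C / (1 - r)\<^sup>2))"
    using A(1) by (intro emeasure_mono sub) auto
  finally show ?thesis .
qed

text \<open>All factors are at most 1, and each visit to the disc contributes a factor of at most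
  r^2.\<close>

lemma orbit_contraction:
  assumes x: "x \<in> Reg" and r: "0 \<le> r" "r < 1" and inf: "visits r x" and e: "0 < (e::real)"
  shows "\<exists>n. cmod ((T_map ^^ n) x) \<le> r \<and> (\<Prod>j<n. (cmod ((T_map ^^ j) x))\<^sup>2) < e"
proof -
  let ?P = "\<lambda>n. \<Prod>j<n. (cmod ((T_map ^^ j) x))\<^sup>2"
  have le1: "(cmod ((T_map ^^ j) x))\<^sup>2 \<le> 1" for j
    using Sec_cmod[OF Reg_Sec[OF x, of j]] by (simp add: abs_square_le_1)
  have dec: "?P n \<le> ?P m" if "m \<le> n" for m n
    using that
  proof (induction n rule: dec_induct)
    case (step n)
    have "?P (Suc n) = ?P n * (cmod ((T_map ^^ n) x))\<^sup>2" by simp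
    also have "\<dots> \<le> ?P n * 1" using le1 by (intro mult_left_mono prod_nonneg) auto
    finally show ?case using step by simp
  qed simp
  have "\<exists>n. cmod ((T_map ^^ n) x) \<le> r \<and> ?P n \<le> (r\<^sup>2) ^ m" for m
  proof (induction m)
    case 0
    obtain n where "cmod ((T_map ^^ n) x) \<le> r" using inf by (auto simp: INFM_nat_le)
    moreover have "?P n \<le> 1" using dec[of 0 n] by simp
    ultimately show ?case by auto
  next
    case (Suc m)
    then obtain n where n: "cmod ((T_map ^^ n) x) \<le> r" "?P n \<le> (r\<^sup>2) ^ m" by blast
    obtain n' where n': "n' \<ge> Suc n" "cmod ((T_map ^^ n') x) \<le> r" using inf unfolding INFM_nat_le by blast
    have "?P n' \<le> ?P (Suc n)" by (rule dec[OF n'(1)])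
    also have "\<dots> = ?P n * (cmod ((T_map ^^ n) x))\<^sup>2" by simp
    also have "\<dots> \<le> (r\<^sup>2) ^ m * r\<^sup>2" using n r by (intro mult_mono power_mono) auto
    finally show ?case using n'(2) by (intro exI[of _ n']) (simp add: mult.commute)
  qed
  moreover have "r\<^sup>2 < 1" using r by (simp add: abs_square_less_1)
  then obtain m where "(r\<^sup>2) ^ m < e" using real_arch_pow_inv[OF e] by blast
  ultimately show ?thesis by (meson order_le_less_trans)
qed


lemma Reg_borel: "Reg \<in> sets borel"
proof -
  have "Reg = U_dom \<inter> (\<Inter>n. (T_map ^^ n) -` Sec)" by (auto simp: Reg_def)
  moreover have "(T_map ^^ n) -` Sec \<in> sets borel" for n
    using measurable_sets[OF T_funpow_measurable Sec_borel] by simp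
  then have "U_dom \<inter> (\<Inter>n. (T_map ^^ n) -` Sec) \<in> sets borel" by (intro sets.Int sets.countable_INT U_dom_borel) auto
  ultimately show ?thesis by simp
qed

lemma visit_set_borel: "{x. visits r x} \<in> sets borel"
proof -
  have "{x. visits r x} = (\<Inter>m. \<Union>n\<in>{m..}. (T_map ^^ n) -` cball 0 r)"
    unfolding INFM_nat_le by (simp add: set_eq_iff Bex_def)
  moreover have "(T_map ^^ n) -` cball 0 r \<in> sets borel" for n
    using measurable_sets[OF T_funpow_measurable, of "cball 0 r" n] by simp
  then have "(\<Inter>m. \<Union>n\<in>{m..}. (T_map ^^ n) -` cball 0 r) \<in> sets borel"
    by (intro sets.countable_INT sets.countable_UN'' ) auto
  ultimately show ?thesis by simp
qed

text \<open>Disjoint balls inside an open \<open>O'\<close> that exceeds \<open>S\<close> by less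
  than e cover almost all of \<open>S\<close>. Each has a fixed share in \<open>A\<close>, and these
  shares fit into \<open>O' - S\<close>. Only some arbitrarily small radii are available at a point,
  and Vitali's theorem asks for no more.\<close>

lemma null_of_ball_proportion:
  fixes S A :: "complex set"
  assumes S: "S \<in> sets lebesgue" and A: "A \<in> sets lebesgue" and disj: "S \<inter> A = {}" and \<kappa>: "0 < (\<kappa>::real)"
    and dens: "\<And>x d. x \<in> S \<Longrightarrow> 0 < d \<Longrightarrow> \<exists>\<rho>. 0 < \<rho> \<and> \<rho> < d \<and> ennreal (\<kappa> * \<rho>\<^sup>2) \<le> leb (A \<inter> ball x \<rho>)"
  shows "negligible S"
proof -
  define \<beta> where "\<beta> = measure lebesgue (ball (0::complex) 1)"
  have \<beta>: "0 < \<beta>" unfolding \<beta>_def using content_ball_pos[of 1 "0::complex"] by simp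
  have ballm: "leb (ball (x::complex) \<rho>) = ennreal (\<beta> * \<rho>\<^sup>2)" if "0 < \<rho>" for x \<rho>
  proof -
    have "leb (ball x \<rho>) = ennreal (measure lebesgue (ball x \<rho>))" by (rule emeasure_eq_measure2) simp
    also have "measure lebesgue (ball x \<rho>) = \<rho> ^ DIM(complex) * measure lebesgue (ball (0::complex) 1)"
      using content_ball_conv_unit_ball[of \<rho> x] that by simp
    finally show ?thesis by (simp add: \<beta>_def mult.commute)
  qed
  have small: "leb S \<le> ennreal (\<beta> / \<kappa> * e)" if e: "0 < e" for e
  proof -
    obtain O' where O': "open O'" "S \<subseteq> O'" "O' - S \<in> lmeasurable" "leb (O' - S) < ennreal e"
      using sets_lebesgue_outer_open[OF S e] by blast
    define K where "K = {(x, \<rho>). 0 < \<rho> \<and> ball x \<rho> \<subseteq> O' \<and> ennreal (\<kappa> * \<rho>\<^sup>2) \<le> leb (A \<inter> ball x \<rho>)}"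
    have "\<exists>i. i \<in> K \<and> x \<in> ball (fst i) (snd i) \<and> snd i < d" if xd: "x \<in> S" "0 < d" for x d
    proof -
      obtain d' where d': "0 < d'" "ball x d' \<subseteq> O'" using O' xd by (meson openE subsetD)
      obtain \<rho> where \<rho>: "0 < \<rho>" "\<rho> < min d d'" "ennreal (\<kappa> * \<rho>\<^sup>2) \<le> leb (A \<inter> ball x \<rho>)"
        using dens[of x "min d d'"] xd d' by auto
      have "ball x \<rho> \<subseteq> O'" using \<rho> d' by (meson min.strict_boundedE order_trans subset_ball less_imp_le)
      then show ?thesis using \<rho> by (intro exI[of _ "(x, \<rho>)"]) (auto simp: K_def)
    qed
    then obtain C where C: "countable C" "C \<subseteq> K"
      "pairwise (\<lambda>i j. disjnt (ball (fst i) (snd i)) (ball (fst j) (snd j))) C"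
      "negligible (S - (\<Union>i\<in>C. ball (fst i) (snd i)))"
      using Vitali_covering_theorem_balls[of S K fst snd] by blast
    have df: "disjoint_family_on (\<lambda>i. ball (fst i) (snd i)) C"
      using C(3) by (auto simp: disjoint_family_on_def pairwise_def disjnt_def)
    have df': "disjoint_family_on (\<lambda>i. A \<inter> ball (fst i) (snd i)) C"
      using df unfolding disjoint_family_on_def by blast
    have UN: "(\<Union>i\<in>C. ball (fst i) (snd i)) \<in> sets lebesgue" using C(1) by (intro sets.countable_UN'') auto
    have "leb S \<le> leb ((\<Union>i\<in>C. ball (fst i) (snd i)) \<union> (S - (\<Union>i\<in>C. ball (fst i) (snd i))))"
      using S UN by (intro emeasure_mono) auto
    also have "\<dots> = leb (\<Union>i\<in>C. ball (fst i) (snd i))"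
      using C(4) UN by (intro emeasure_Un_null_set) (auto simp: negligible_iff_null_sets)
    also have "\<dots> = (\<integral>\<^sup>+i. leb (ball (fst i) (snd i)) \<partial>count_space C)"
      using C(1) df by (intro emeasure_UN_countable) auto
    also have "\<dots> \<le> (\<integral>\<^sup>+i. ennreal (\<beta> / \<kappa>) * leb (A \<inter> ball (fst i) (snd i)) \<partial>count_space C)"
    proof (rule nn_integral_mono)
      fix i assume "i \<in> space (count_space C)"
      then have i: "0 < snd i" "ennreal (\<kappa> * (snd i)\<^sup>2) \<le> leb (A \<inter> ball (fst i) (snd i))"
        using C(2) by (auto simp: K_def)
      have "leb (ball (fst i) (snd i)) = ennreal (\<beta> / \<kappa>) * ennreal (\<kappa> * (snd i)\<^sup>2)"
        unfolding ballm[OF i(1)] using \<kappa> \<beta> by (subst ennreal_mult'[symmetric]) auto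
      also have "\<dots> \<le> ennreal (\<beta> / \<kappa>) * leb (A \<inter> ball (fst i) (snd i))"
        by (intro mult_left_mono i(2)) auto
      finally show "leb (ball (fst i) (snd i)) \<le> ennreal (\<beta> / \<kappa>) * leb (A \<inter> ball (fst i) (snd i))" .
    qed
    also have "\<dots> = ennreal (\<beta> / \<kappa>) * (\<integral>\<^sup>+i. leb (A \<inter> ball (fst i) (snd i)) \<partial>count_space C)"
      by (rule nn_integral_cmult) simp
    also have "(\<integral>\<^sup>+i. leb (A \<inter> ball (fst i) (snd i)) \<partial>count_space C) = leb (\<Union>i\<in>C. A \<inter> ball (fst i) (snd i))"
      using C(1) df' A by (intro emeasure_UN_countable[symmetric]) auto
    also have "\<dots> \<le> leb (O' - S)"
    proof (rule emeasure_mono)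
      have "ball (fst i) (snd i) \<subseteq> O'" if "i \<in> C" for i
        using subsetD[OF C(2) that] by (auto simp: K_def case_prod_unfold)
      then show "(\<Union>i\<in>C. A \<inter> ball (fst i) (snd i)) \<subseteq> O' - S" using disj by blast
      show "O' - S \<in> sets lebesgue" using O'(3) by (rule fmeasurableD)
    qed
    also have "\<dots> \<le> ennreal e" using O'(4) by simp
    finally have "leb S \<le> ennreal (\<beta> / \<kappa>) * ennreal e" by (simp add: mult_left_mono)
    moreover have "ennreal (\<beta> / \<kappa>) * ennreal e = ennreal (\<beta> / \<kappa> * e)" using \<beta> \<kappa> by (intro ennreal_mult'[symmetric]) simp
    ultimately show ?thesis by (simp only:)
  qed
  have "leb S \<le> 0"
  proof (rule ennreal_le_epsilon)
    fix e :: real assume "0 < e"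
    then have "leb S \<le> ennreal (\<beta> / \<kappa> * (e * \<kappa> / \<beta>))" using \<beta> \<kappa> by (intro small) auto
    then show "leb S \<le> 0 + ennreal e" using \<beta> \<kappa> by simp
  qed
  then show ?thesis using S by (simp add: negligible_iff_null_sets null_sets_def)
qed

lemma disjoint_from_invariant_null:
  assumes S: "S \<in> sets lebesgue" "S \<subseteq> U_dom" and A: "A \<in> sets lebesgue" "A \<subseteq> U_dom"
    and inv: "T_map -` A \<inter> U_dom = A" and disj: "S \<inter> A = {}" and pos: "\<not> negligible A"
  shows "negligible S"
proof -
  define \<delta> where "\<delta> = leb (A \<inter> Sec) * ennreal (1 / 5 ^ 8)"
  have Gl: "Sec \<in> sets lebesgue" using Sec_borel by simp
  have "leb (A \<inter> Sec) \<noteq> 0"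
  proof
    assume "leb (A \<inter> Sec) = 0"
    then have "negligible (A \<inter> Sec)" unfolding negligible_iff_null_sets using A Gl by (intro null_setsI sets.Int)
    then have "negligible ((A \<inter> Sec) \<union> (U_dom - Sec))" by (intro negligible_Un negligible_U_minus_Sec)
    then have "negligible A" by (rule negligible_subset) (use A in auto)
    then show False using pos by blast
  qed
  then have "\<delta> \<noteq> 0" unfolding \<delta>_def by simp
  then obtain \<delta>' where \<delta>': "0 < \<delta>'" "ennreal \<delta>' \<le> \<delta>"
  proof (cases \<delta>)
    case (real r)
    then show ?thesis using \<open>\<delta> \<noteq> 0\<close> by (intro that[of r]) (auto simp: less_le)
  next
    case top
    then show ?thesis by (intro that[of 1]) auto
  qed
  define Sr where "Sr r = S \<inter> Reg \<inter> {x. visits r x}" for r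
  have Srn: "negligible (Sr r)" if r: "1/2 \<le> r" "r < 1" for r
  proof (rule null_of_ball_proportion[of _ A])
    show "Sr r \<in> sets lebesgue" unfolding Sr_def using S Reg_borel visit_set_borel by (intro sets.Int) auto
    show "A \<in> sets lebesgue" by (rule A)
    show "Sr r \<inter> A = {}" using disj by (auto simp: Sr_def)
    show "0 < \<delta>' * ((1 - r) ^ 4 / 144)" using \<delta>' r by simp
    fix x and d :: real assume x: "x \<in> Sr r" and d: "0 < d"
    have xR: "x \<in> Reg" and inf: "visits r x" using x by (auto simp: Sr_def)
    \<comment> \<open>12 = 3 * 4: C is at most 4 times the orbit product because |1 - cnj q y| <= 2,
      and the radius 3 C / (1 - r)^2 has to stay below d.\<close>
    have "0 < d * (1 - r)\<^sup>2 / 12" "0 \<le> r" using d r by simp_all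
    then obtain n where n: "cmod ((T_map ^^ n) x) \<le> r" "(\<Prod>j<n. (cmod ((T_map ^^ j) x))\<^sup>2) < d * (1 - r)\<^sup>2 / 12"
      using orbit_contraction[OF xR _ r(2) inf] by blast
    obtain t k q \<psi> C where b: "branch n x t k q \<psi> C" using branch_exists[OF xR] by blast
    let ?D = "cmod (1 - cnj q * (T_map ^^ n) x)"
    have C: "0 < C" "q \<in> dual_cell t k" "C / ?D\<^sup>2 = (\<Prod>j<n. (cmod ((T_map ^^ j) x))\<^sup>2)"
      using b unfolding branch_def by blast+
    have "?D \<le> 2"
    proof -
      have "cmod (cnj q * (T_map ^^ n) x) \<le> 1 * 1" unfolding norm_mult
        using dual_cell_norm[OF C(2)] n r by (intro mult_mono) auto
      then show ?thesis using norm_triangle_ineq4[of 1 "cnj q * (T_map ^^ n) x"] by simp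
    qed
    moreover have D0: "0 < ?D" by (rule one_minus_pole_nonzero[OF C(2) Reg_Sec[OF xR]])
    ultimately have "C / 2\<^sup>2 \<le> C / ?D\<^sup>2" using C by (intro divide_left_mono power_mono mult_pos_pos zero_less_power) auto
    then have "3 * C < d * (1 - r)\<^sup>2" using n(2) C(3) by simp
    then have lt: "3 * C / (1 - r)\<^sup>2 < d" using r by (simp add: pos_divide_less_eq)
    let ?\<rho> = "3 * C / (1 - r)\<^sup>2"
    have "ennreal (\<delta>' * ((1 - r) ^ 4 / 144) * ?\<rho>\<^sup>2) = ennreal \<delta>' * ennreal ((1 - r) ^ 4 / 144 * ?\<rho>\<^sup>2)"
      using \<delta>' unfolding mult.assoc[of \<delta>'] by (intro ennreal_mult') simp
    also have "\<dots> \<le> \<delta> * ennreal ((1 - r) ^ 4 / 144 * ?\<rho>\<^sup>2)" by (intro mult_right_mono \<delta>') auto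
    also have "\<dots> \<le> leb (A \<inter> ball x ?\<rho>)" unfolding \<delta>_def by (rule branch_ball[OF b r n(1) A inv])
    finally show "\<exists>\<rho>. 0 < \<rho> \<and> \<rho> < d \<and> ennreal (\<delta>' * ((1 - r) ^ 4 / 144) * \<rho>\<^sup>2) \<le> leb (A \<inter> ball x \<rho>)"
      using lt C r by (intro exI[of _ ?\<rho>]) auto
  qed
  \<comment> \<open>The shift by 2 keeps these radii at least 1/2.\<close>
  have "negligible (\<Union>m::nat. Sr (1 - 1 / (real m + 2)))"
    by (intro negligible_countable_Union) (auto intro!: Srn simp: field_simps)
  then have "negligible ((\<Union>m::nat. Sr (1 - 1 / (real m + 2))) \<union> (U_dom - Reg))"
    by (intro negligible_Un negligible_U_minus_Reg)
  moreover have "S \<subseteq> (\<Union>m::nat. Sr (1 - 1 / (real m + 2))) \<union> (U_dom - Reg)"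
  proof
    fix x assume x: "x \<in> S"
    show "x \<in> (\<Union>m::nat. Sr (1 - 1 / (real m + 2))) \<union> (U_dom - Reg)"
    proof (cases "x \<in> Reg")
      case True
      then obtain r where r: "r < 1" "visits r x" using visits_disc by blast
      obtain m where m: "1 / real (Suc m) < 1 - r" using r(1) reals_Archimedean[of "1 - r"] by (auto simp: inverse_eq_divide)
      have "1 / (real m + 2) \<le> 1 / real (Suc m)" by (intro divide_left_mono) auto
      then have "r \<le> 1 - 1 / (real m + 2)" using m by linarith
      then have "visits (1 - 1 / (real m + 2)) x" using r(2) by (auto elim: INFM_mono)
      then show ?thesis using x True by (auto simp: Sr_def)
    qed (use x S in auto)
  qed
  ultimately show ?thesis by (rule negligible_subset)
qed

lemma T_ergodic:
  assumes A: "A \<in> sets lebesgue" "A \<subseteq> U_dom" and inv: "T_map -` A \<inter> U_dom = A"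
  shows "negligible A \<or> negligible (U_dom - A)"
proof -
  have "U_dom \<in> sets lebesgue" using U_dom_borel by simp
  then have Ul: "U_dom - A \<in> sets lebesgue" using A(1) by (rule sets.Diff)
  have "T_map -` (U_dom - A) \<inter> U_dom = U_dom - A" using inv T_map_U by auto
  then show ?thesis using disjoint_from_invariant_null[of A "U_dom - A"] A Ul by auto
qed

text \<open>Visiting a given disc infinitely often is an invariant property. Countably many discs
  account for almost every point, so one of these sets is not null, and by ergodicity it has full
  measure.\<close>

lemma visits_full:
  obtains r where "9/10 \<le> r" "r < 1" "negligible (U_dom - {x. visits r x})"
proof -
  define W where "W m = U_dom \<inter> {x. visits (1 - 1 / (real m + 1)) x}" for m :: nat
  have W: "W m \<in> sets lebesgue" "W m \<subseteq> U_dom" for m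
    unfolding W_def using visit_set_borel by (auto intro!: sets.Int)
  have inv: "T_map -` W m \<inter> U_dom = W m" for m
  proof -
    have "(\<exists>\<^sub>\<infinity>n. cmod ((T_map ^^ n) (T_map x)) \<le> s) \<longleftrightarrow> (visits s x)" for x s
    proof -
      have "(\<exists>\<^sub>\<infinity>n. cmod ((T_map ^^ Suc n) x) \<le> s) \<longleftrightarrow> (visits s x)"
        unfolding cofinite_eq_sequentially
        using eventually_sequentially_Suc[of "\<lambda>n. \<not> cmod ((T_map ^^ n) x) \<le> s"] by (simp add: frequently_def)
      then show ?thesis by (simp only: funpow_Suc_right o_apply)
    qed
    then show ?thesis unfolding W_def using T_map_U by auto
  qed
  have "\<exists>m. \<not> negligible (W m)"
  proof (rule ccontr)
    assume "\<not> ?thesis"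
    then have "negligible (\<Union>m. W m)" by (intro negligible_countable_Union) auto
    then have "negligible ((\<Union>m. W m) \<union> (U_dom - Reg))" by (intro negligible_Un negligible_U_minus_Reg)
    moreover have "Sec \<subseteq> (\<Union>m. W m) \<union> (U_dom - Reg)"
    proof
      fix x assume "x \<in> Sec"
      then have xU: "x \<in> U_dom" using Sec_U by blast
      show "x \<in> (\<Union>m. W m) \<union> (U_dom - Reg)"
      proof (cases "x \<in> Reg")
        case True
        then obtain r where r: "r < 1" "visits r x" using visits_disc by blast
        obtain m where m: "1 / real (Suc m) < 1 - r" using r(1) reals_Archimedean[of "1 - r"] by (auto simp: inverse_eq_divide)
        then have "r \<le> 1 - 1 / (real m + 1)" by (simp add: add.commute)
        then have "visits (1 - 1 / (real m + 1)) x" using r(2) by (auto elim: INFM_mono)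
        then show ?thesis using xU by (auto simp: W_def)
      qed (use xU in auto)
    qed
    ultimately have "negligible Sec" by (rule negligible_subset)
    then show False using open_not_negligible[OF open_Sec] Sec_nonempty by blast
  qed
  then obtain m where "\<not> negligible (W m)" by blast
  then have "negligible (U_dom - W m)" using T_ergodic[OF W inv] by blast
  \<comment> \<open>Radius at least 9/10 ensures that the disc meets \<open>Sec\<close>, by
    \<open>centroid_in_Sec\<close>.\<close>
  moreover define r where "r = max (9/10) (1 - 1 / (real m + 1))"
  then have "x \<in> W m \<Longrightarrow> visits r x" for x
    unfolding W_def by (auto elim!: INFM_mono)
  ultimately have "negligible (U_dom - {x. visits r x})"
    by (elim negligible_subset) auto
  then show ?thesis by (intro that[of r]) (auto simp: r_def)
qed

section \<open>The invariant density\<close>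

text \<open>\<open>PF\<close> preserves integrals, so the undamped sum has infinite mass; for 0 < s
  < 1 the total mass is finite.\<close>

definition hs :: "real \<Rightarrow> complex \<Rightarrow> ennreal" where
  "hs s z = (\<Sum>n. ennreal (s ^ n) * (PF ^^ n) (indicator Sec) z)"

lemma PF_funpow_Sec_measurable [measurable]: "(PF ^^ n) (indicator Sec) \<in> borel_measurable borel"
  by (rule PF_funpow_measurable) measurable

lemma hs_measurable [measurable]: "hs s \<in> borel_measurable borel"
  unfolding hs_def[abs_def] by measurable

lemma hs_supp: "z \<notin> Sec \<Longrightarrow> hs s z = 0"
  unfolding hs_def using PF_funpow_supp[of "indicator Sec" z] by simp

lemma PF_hs: "PF (hs s) w = (\<Sum>n. ennreal (s ^ n) * (PF ^^ Suc n) (indicator Sec) w)"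
  unfolding hs_def[abs_def] by (simp add: PF_suminf PF_cmult)

lemma suminf_shift_le: "(\<Sum>n. f (Suc n) :: ennreal) \<le> (\<Sum>n. f n)"
proof -
  have "(\<Sum>n<N. f (Suc n)) \<le> (\<Sum>n. f n)" for N
  proof -
    have "(\<Sum>n<N. f (Suc n)) = sum f (Suc ` {..<N})" by (simp add: sum.reindex)
    also have "\<dots> \<le> (\<Sum>n. f n)" by (rule sum_le_suminf) auto
    finally show ?thesis .
  qed
  then show ?thesis by (subst suminf_eq_SUP) (auto intro: SUP_least)
qed

text \<open>\<open>PF\<close> shifts the series by one index at the price of 1 / s, and the missing
  term n = 0 is nonnegative.\<close>

lemma PF_hs_le:
  assumes "0 < s" shows "PF (hs s) w \<le> ennreal (1 / s) * hs s w"
proof -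
  have "ennreal (1 / s) * (\<Sum>n. ennreal (s ^ Suc n) * (PF ^^ Suc n) (indicator Sec) w)
     = (\<Sum>n. ennreal (1 / s) * (ennreal (s ^ Suc n) * (PF ^^ Suc n) (indicator Sec) w))" by simp
  also have "\<dots> = PF (hs s) w"
    unfolding PF_hs using assms by (intro suminf_cong) (simp add: mult.assoc[symmetric] ennreal_mult'[symmetric])
  finally have "PF (hs s) w = ennreal (1 / s) * (\<Sum>n. ennreal (s ^ Suc n) * (PF ^^ Suc n) (indicator Sec) w)" by simp
  also have "\<dots> \<le> ennreal (1 / s) * hs s w"
    unfolding hs_def by (intro mult_left_mono suminf_shift_le) simp
  finally show ?thesis .
qed

lemma hs_integral_finite:
  assumes s: "0 < s" "s < 1" shows "(\<integral>\<^sup>+z. hs s z \<partial>lborel) < top"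
proof -
  have e: "(\<integral>\<^sup>+z. (PF ^^ n) (indicator Sec) z \<partial>lborel) = emeasure lborel Sec" for n
    using PF_funpow_dual[of "indicator Sec" UNIV n] by simp
  have "emeasure lborel Sec \<le> emeasure lborel (cball (0::complex) 1)"
    using Sec_cmod by (intro emeasure_mono) force+
  also have "\<dots> < top" using emeasure_lborel_cball_finite[of "0::complex" 1] by (simp add: infinity_ennreal_def)
  finally have fin: "emeasure lborel Sec < top" .
  have "(\<integral>\<^sup>+z. hs s z \<partial>lborel) = (\<Sum>n. \<integral>\<^sup>+z. ennreal (s ^ n) * (PF ^^ n) (indicator Sec) z \<partial>lborel)"
    unfolding hs_def by (rule nn_integral_suminf) measurable
  also have "\<dots> = (\<Sum>n. ennreal (s ^ n) * emeasure lborel Sec)" by (simp add: nn_integral_cmult e)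
  also have "\<dots> = (\<Sum>n. ennreal (s ^ n)) * emeasure lborel Sec" by simp
  also have "\<dots> < top"
  proof -
    have "summable (\<lambda>n. s ^ n)" using s by (intro summable_geometric) simp
    then have "(\<Sum>n. ennreal (s ^ n)) \<noteq> top" by (rule ennreal_suminf_neq_top) (use s in simp)
    then have "(\<Sum>n. ennreal (s ^ n)) < top" by (rule less_top[THEN iffD1])
    then show ?thesis using fin by (simp add: ennreal_mult_less_top)
  qed
  finally show ?thesis .
qed

text \<open>6 = 2 + 2 * 2, as each application of \<open>PF\<close> costs at most 1 / s <= 2. The
  constant does not depend on s and so survives the limit.\<close>

lemma hs_harnack:
  assumes s: "1/2 \<le> s" and r: "0 \<le> r" "r < 1" and w: "w \<in> Sec"
  shows "(\<integral>\<^sup>+z. hs s z * indicator (cball 0 r) z \<partial>lborel) \<le> Kc r * ennreal 6 * hs s w"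
proof -
  have [measurable]: "cball (0::complex) r \<in> sets borel" by simp
  have "(\<integral>\<^sup>+z. hs s z * indicator (cball 0 r) z \<partial>lborel)
     = (\<integral>\<^sup>+z. (\<Sum>n. ennreal (s ^ n) * ((PF ^^ n) (indicator Sec) z * indicator (cball 0 r) z)) \<partial>lborel)"
    unfolding hs_def by (simp add: mult.assoc flip: ennreal_suminf_multc)
  also have "\<dots> = (\<Sum>n. ennreal (s ^ n) * (\<integral>\<^sup>+z. (PF ^^ n) (indicator Sec) z * indicator (cball 0 r) z \<partial>lborel))"
    by (subst nn_integral_suminf) (auto simp: nn_integral_cmult)
  also have "\<dots> \<le> (\<Sum>n. ennreal (s ^ n) * (Kc r * (PF ((PF ^^ n) (indicator Sec)) w + PF (PF ((PF ^^ n) (indicator Sec))) w)))"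
    using r w by (intro suminf_le mult_left_mono cone_harnack cone_PF_funpow cone_indicator_Sec) auto
  also have "\<dots> = Kc r * (PF (hs s) w + PF (PF (hs s)) w)"
  proof -
    have "PF (hs s) = (\<lambda>w. \<Sum>n. ennreal (s ^ n) * (PF ^^ Suc n) (indicator Sec) w)" by (rule ext) (rule PF_hs)
    then have "PF (PF (hs s)) w = (\<Sum>n. ennreal (s ^ n) * PF ((PF ^^ Suc n) (indicator Sec)) w)" by (simp add: PF_suminf PF_cmult)
    then show ?thesis by (simp add: PF_hs distrib_left suminf_add[symmetric] mult.left_commute[of _ "Kc r"])
  qed
  also have "\<dots> \<le> Kc r * (ennreal 2 * hs s w + ennreal 2 * (ennreal 2 * hs s w))"
  proof -
    have 1: "PF (hs s) z \<le> ennreal 2 * hs s z" for z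
    proof -
      have "PF (hs s) z \<le> ennreal (1 / s) * hs s z" using s by (intro PF_hs_le) simp
      also have "\<dots> \<le> ennreal 2 * hs s z" using s by (intro mult_right_mono ennreal_leI) (auto simp: field_simps)
      finally show ?thesis .
    qed
    have "PF (PF (hs s)) w \<le> PF (\<lambda>z. ennreal 2 * hs s z) w" by (rule PF_mono[OF 1])
    also have "\<dots> = ennreal 2 * PF (hs s) w" by (rule PF_cmult)
    also have "\<dots> \<le> ennreal 2 * (ennreal 2 * hs s w)" by (intro mult_left_mono 1) simp
    finally show ?thesis using 1 by (intro mult_left_mono add_mono) auto
  qed
  also have "\<dots> = Kc r * ennreal 6 * hs s w"
  proof -
    have "ennreal 2 * hs s w + ennreal 2 * (ennreal 2 * hs s w) = (ennreal 2 + ennreal 2 * ennreal 2) * hs s w"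
      by (simp only: distrib_right mult.assoc)
    also have "ennreal 2 + ennreal 2 * ennreal 2 = ennreal 6"
      by (subst ennreal_mult'[symmetric]) (auto simp flip: ennreal_plus)
    finally show ?thesis by (simp only: mult.assoc)
  qed
  finally show ?thesis .
qed

lemma ennreal_le_of_factor:
  assumes "\<And>t. 1 < t \<Longrightarrow> x \<le> ennreal t * y" shows "x \<le> y"
proof (cases y)
  case (real b)
  show ?thesis
  proof (rule ennreal_le_epsilon)
    fix e :: real assume e: "0 < e"
    \<comment> \<open>Dividing by b + 1 instead of b covers the case b = 0.\<close>
    have "x \<le> ennreal (1 + e / (b + 1)) * ennreal b" using assms[of "1 + e / (b + 1)"] e real by simp
    also have "\<dots> = ennreal ((1 + e / (b + 1)) * b)" using e real by (intro ennreal_mult'[symmetric]) simp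
    also have "\<dots> \<le> ennreal (b + e)" using e real by (intro ennreal_leI) (simp add: field_simps)
    also have "\<dots> = y + ennreal e" using e real by simp
    finally show "x \<le> y + ennreal e" .
  qed
qed simp

lemma suminf_infinite_visits:
  assumes "\<exists>\<^sub>\<infinity>n. P n" shows "(\<Sum>n. indicator {n. P n} n :: ennreal) = top"
proof -
  have "infinite {n::nat. P n}" using assms by (simp add: frequently_cofinite)
  then have "(\<integral>\<^sup>+n. indicator {n. P n} n \<partial>count_space UNIV) = (top :: ennreal)" by simp
  then show ?thesis by (simp add: nn_integral_count_space_nat)
qed

lemma invariant_density_exists:
  "\<exists>h r. h \<in> borel_measurable borel \<and> (\<forall>z. z \<notin> Sec \<longrightarrow> h z = (0::ennreal)) \<and> (\<forall>z\<in>Sec. h z \<noteq> 0)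
    \<and> (AE z in lborel. PF h z = h z) \<and> (\<integral>\<^sup>+z. h z * indicator (cball 0 r) z \<partial>lborel) \<le> 1
    \<and> negligible (U_dom - {x. visits r x})"
proof -
  obtain r where r: "9/10 \<le> r" "r < 1" and vis: "negligible (U_dom - {x. visits r x})"
    by (rule visits_full)
  let ?K = "cball (0::complex) r"
  have [measurable]: "?K \<in> sets borel" by simp
  define s where "s k = real (Suc k) / (real (Suc k) + 1)" for k
  have s: "1/2 \<le> s k" "s k < 1" "0 < s k" for k
  proof -
    show "1/2 \<le> s k" "s k < 1" "0 < s k" by (simp_all add: s_def field_simps)
  qed
  define m where "m k = (\<integral>\<^sup>+z. hs (s k) z * indicator ?K z \<partial>lborel)" for k
  have mfin: "m k < top" for k
  proof -
    have "m k \<le> (\<integral>\<^sup>+z. hs (s k) z \<partial>lborel)" unfolding m_def by (intro nn_integral_mono) (auto simp: indicator_def)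
    also have "\<dots> < top" using s by (intro hs_integral_finite)
    finally show ?thesis .
  qed
  have mpos: "m k \<noteq> 0" for k
  proof
    assume "m k = 0"
    have "emeasure lborel (Sec \<inter> ball 0 r) \<le> m k"
    proof -
      have "indicator Sec z \<le> hs (s k) z" for z
      proof -
        have "(\<Sum>n\<in>{0}. ennreal (s k ^ n) * (PF ^^ n) (indicator Sec) z) \<le> hs (s k) z"
          unfolding hs_def by (intro sum_le_suminf) auto
        then show ?thesis by simp
      qed
      then have "(\<integral>\<^sup>+z. indicator Sec z * indicator ?K z \<partial>lborel) \<le> m k"
        unfolding m_def by (intro nn_integral_mono mult_right_mono) auto
      moreover have "emeasure lborel (Sec \<inter> ball 0 r) = (\<integral>\<^sup>+z. indicator (Sec \<inter> ball 0 r) z \<partial>lborel)" by simp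
      moreover have "\<dots> \<le> (\<integral>\<^sup>+z. indicator Sec z * indicator ?K z \<partial>lborel)"
        by (intro nn_integral_mono) (auto simp: indicator_def)
      ultimately show ?thesis by simp
    qed
    with \<open>m k = 0\<close> have "Sec \<inter> ball 0 r \<in> null_sets lborel" by (auto intro: null_setsI)
    then have "negligible (Sec \<inter> ball 0 r)"
      using null_sets_completionI negligible_iff_null_sets by blast
    moreover have "Sec \<inter> ball 0 r \<noteq> {}"
    proof -
      obtain z where "z \<in> Sec" "cmod z < 9/10" by (rule centroid_in_Sec)
      then have "z \<in> Sec \<inter> ball 0 r" using r by simp
      then show ?thesis by blast
    qed
    ultimately show False using open_not_negligible[of "Sec \<inter> ball 0 r"] open_Sec by blast
  qed
  obtain \<mu> where \<mu>: "\<And>k. m k = ennreal (\<mu> k)" "\<And>k. 0 < \<mu> k"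
  proof (rule that[of "\<lambda>k. enn2real (m k)"])
    show "m k = ennreal (enn2real (m k))" for k using mfin by simp
    show "0 < enn2real (m k)" for k using mfin mpos by (simp add: enn2real_positive_iff zero_less_iff_neq_zero)
  qed
  define g where "g k z = ennreal (1 / \<mu> k) * hs (s k) z" for k z
  have [measurable]: "g k \<in> borel_measurable borel" for k unfolding g_def[abs_def] by measurable
  define h where "h z = liminf (\<lambda>k. g k z)" for z
  have hm [measurable]: "h \<in> borel_measurable borel" unfolding h_def[abs_def] by measurable
  have hsupp: "h z = 0" if "z \<notin> Sec" for z using that by (simp add: h_def g_def hs_supp Liminf_const)
  have Lle: "PF h w \<le> h w" for w
  proof (rule ennreal_le_of_factor)
    fix t :: real assume t: "1 < t"
    have "PF h w \<le> liminf (\<lambda>k. PF (g k) w)" unfolding h_def[abs_def] by (rule PF_liminf)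
    also have "\<dots> \<le> liminf (\<lambda>k. g k w * ennreal t)"
    proof (rule Liminf_mono)
      have "(\<lambda>k. 1 / s k) \<longlonglongrightarrow> 1" 
        using LIMSEQ_inverse_real_of_nat_add[of 1] by (simp add: s_def add_divide_distrib inverse_eq_divide del: of_nat_Suc)
      then have "\<forall>\<^sub>F k in sequentially. 1 / s k < t" using t by (intro order_tendstoD)
      then show "\<forall>\<^sub>F k in sequentially. PF (g k) w \<le> g k w * ennreal t"
      proof eventually_elim
        case (elim k)
        have "PF (g k) w = ennreal (1 / \<mu> k) * PF (hs (s k)) w" unfolding g_def[abs_def] by (rule PF_cmult)
        also have "\<dots> \<le> ennreal (1 / \<mu> k) * (ennreal (1 / s k) * hs (s k) w)" using s by (intro mult_left_mono PF_hs_le) auto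
        also have "\<dots> \<le> ennreal (1 / \<mu> k) * (ennreal t * hs (s k) w)" using elim by (intro mult_left_mono mult_right_mono ennreal_leI) auto
        finally show ?case by (simp add: g_def mult_ac)
      qed
    qed
    \<comment> \<open>\<open>liminf_cmult_le\<close> moves a constant into the limit in one
      direction only; inserting t * (1 / t) uses that direction to take t out.\<close>
    also have "\<dots> = ennreal t * (liminf (\<lambda>k. g k w * ennreal t) * ennreal (1 / t))"
      using t by (simp add: mult.left_commute[of "ennreal t"] ennreal_mult'[symmetric])
    also have "\<dots> \<le> ennreal t * liminf (\<lambda>k. g k w * ennreal t * ennreal (1 / t))"
      by (intro mult_left_mono liminf_cmult_le) simp
    also have "(\<lambda>k. g k w * ennreal t * ennreal (1 / t)) = (\<lambda>k. g k w)"
      using t by (simp add: mult.assoc ennreal_mult'[symmetric])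
    finally show "PF h w \<le> ennreal t * h w" unfolding h_def[abs_def] .
  qed
  have hK: "(\<integral>\<^sup>+z. h z * indicator ?K z \<partial>lborel) \<le> 1"
  proof -
    have "(\<integral>\<^sup>+z. h z * indicator ?K z \<partial>lborel) = (\<integral>\<^sup>+z. liminf (\<lambda>k. g k z * indicator ?K z) \<partial>lborel)"
      by (intro nn_integral_cong) (auto simp: h_def indicator_def Liminf_const)
    also have "\<dots> \<le> liminf (\<lambda>k. \<integral>\<^sup>+z. g k z * indicator ?K z \<partial>lborel)" by (rule nn_integral_liminf) measurable
    also have "(\<lambda>k. \<integral>\<^sup>+z. g k z * indicator ?K z \<partial>lborel) = (\<lambda>k. 1)"
    proof
      fix k
      have "(\<integral>\<^sup>+z. g k z * indicator ?K z \<partial>lborel) = ennreal (1 / \<mu> k) * m k"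
        unfolding g_def m_def by (simp add: mult.assoc nn_integral_cmult)
      also have "\<dots> = 1" using \<mu>(2)[of k] unfolding \<mu>(1) by (simp add: ennreal_mult'[symmetric])
      finally show "(\<integral>\<^sup>+z. g k z * indicator ?K z \<partial>lborel) = 1" .
    qed
    finally show ?thesis by (simp add: Liminf_const)
  qed
  \<comment> \<open>\<open>hs_harnack\<close> bounds every normalised sum below by the same constant
    on all of \<open>Sec\<close>; so the limit does not vanish there.\<close>
  have hpos: "h z \<noteq> 0" if z: "z \<in> Sec" for z
  proof -
    have "Kc r * ennreal 6 < top" using Kc_finite[of r] by (simp add: ennreal_mult_less_top)
    then obtain \<kappa> where \<kappa>: "Kc r * ennreal 6 = ennreal \<kappa>" "0 \<le> \<kappa>" by (cases "Kc r * ennreal 6") auto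
    have "ennreal (1 / (\<kappa> + 1)) \<le> g k z" for k
    proof -
      have "ennreal (\<mu> k) \<le> ennreal \<kappa> * hs (s k) z"
        using hs_harnack[OF s(1) _ r(2) z, of k] r unfolding \<kappa>(1) m_def[symmetric] \<mu>(1) by simp
      also have "\<dots> \<le> ennreal (\<kappa> + 1) * hs (s k) z" by (intro mult_right_mono ennreal_leI) auto
      finally have "ennreal (1 / (\<kappa> + 1) * (1 / \<mu> k)) * ennreal (\<mu> k) \<le> ennreal (1 / (\<kappa> + 1) * (1 / \<mu> k)) * (ennreal (\<kappa> + 1) * hs (s k) z)"
        by (intro mult_left_mono) auto
      moreover have "ennreal (1 / (\<kappa> + 1) * (1 / \<mu> k)) * ennreal (\<mu> k) = ennreal (1 / (\<kappa> + 1))"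
        using \<mu>(2)[of k] \<kappa>(2) by (subst ennreal_mult'[symmetric]) auto
      moreover have "ennreal (1 / (\<kappa> + 1) * (1 / \<mu> k)) * (ennreal (\<kappa> + 1) * hs (s k) z) = g k z"
        unfolding mult.assoc[symmetric] g_def using \<mu>(2)[of k] \<kappa>(2) by (subst ennreal_mult'[symmetric]) auto
      ultimately show ?thesis by simp
    qed
    then have "ennreal (1 / (\<kappa> + 1)) \<le> h z" unfolding h_def by (intro Liminf_bounded) auto
    then show ?thesis using \<kappa>(2) by auto
  qed
  \<comment> \<open>The defect of invariance. By telescoping, the iterates of d sum to at most h.
    Integrated over the disc, duality turns this into the integral of d times the number of visits,
    which is finite although almost every orbit has infinitely many visits; hence d = 0 almost
    everywhere.\<close>
  define d where "d z = h z - PF h z" for z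
  have dm [measurable]: "d \<in> borel_measurable borel" unfolding d_def[abs_def] by measurable
  have dsupp: "d z = 0" if "z \<notin> Sec" for z using hsupp[OF that] by (simp add: d_def)
  have hd: "h z = d z + PF h z" for z unfolding d_def using Lle[of z] by (simp add: diff_add_cancel_ennreal)
  have expand: "(\<Sum>n<N. (PF ^^ n) d z) + (PF ^^ N) h z = h z" for N z
  proof (induction N)
    case (Suc N)
    have "(PF ^^ Suc N) h z + (PF ^^ N) d z = (PF ^^ N) h z"
    proof -
      have add: "(PF ^^ n) (\<lambda>z. f z + f' z) = (\<lambda>z. (PF ^^ n) f z + (PF ^^ n) f' z)" for n f f'
      proof (induction n)
        case (Suc n)
        have "(PF ^^ Suc n) (\<lambda>z. f z + f' z) = PF (\<lambda>z. (PF ^^ n) f z + (PF ^^ n) f' z)" by (simp add: Suc)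
        also have "\<dots> = (\<lambda>z. (PF ^^ Suc n) f z + (PF ^^ Suc n) f' z)" by (rule ext) (simp add: PF_add)
        finally show ?case .
      qed simp
      have "h = (\<lambda>z. d z + PF h z)" using hd by blast
      then have "(PF ^^ N) h = (\<lambda>z. (PF ^^ N) d z + (PF ^^ N) (PF h) z)" using add by metis
      then have "(PF ^^ N) h z = (PF ^^ N) d z + (PF ^^ N) (PF h) z" by (rule fun_cong)
      then show ?thesis by (simp only: funpow_Suc_right o_apply add.commute)
    qed
    then have "(\<Sum>n<Suc N. (PF ^^ n) d z) + (PF ^^ Suc N) h z = (\<Sum>n<N. (PF ^^ n) d z) + (PF ^^ N) h z"
      by (simp only: sum.lessThan_Suc add.assoc add.commute[of "(PF ^^ N) d z"])
    then show ?case using Suc by simp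
  qed simp
  have "(\<Sum>n. (PF ^^ n) d z) \<le> h z" for z
  proof -
    have "(\<Sum>n<N. (PF ^^ n) d z) \<le> h z" for N using expand[where N = N and z = z] by (metis le_iff_add)
    then show ?thesis by (subst suminf_eq_SUP) (auto intro: SUP_least)
  qed
  then have "(\<integral>\<^sup>+z. (\<Sum>n. (PF ^^ n) d z) * indicator ?K z \<partial>lborel) \<le> (\<integral>\<^sup>+z. h z * indicator ?K z \<partial>lborel)"
    by (intro nn_integral_mono mult_right_mono) auto
  then have le1: "(\<integral>\<^sup>+z. (\<Sum>n. (PF ^^ n) d z) * indicator ?K z \<partial>lborel) \<le> 1" using hK by simp
  have Tm: "(\<lambda>y. d y * indicator ?K ((T_map ^^ n) y)) \<in> borel_measurable lborel" for n
  proof -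
    have "(\<lambda>y. indicator ?K ((T_map ^^ n) y) :: ennreal) = indicator ((T_map ^^ n) -` ?K)" by (auto simp: indicator_def)
    moreover have "(T_map ^^ n) -` ?K \<in> sets borel" using measurable_sets[OF T_funpow_measurable, of ?K n] by simp
    ultimately show ?thesis by simp
  qed
  have "(\<integral>\<^sup>+z. (\<Sum>n. (PF ^^ n) d z) * indicator ?K z \<partial>lborel) = (\<integral>\<^sup>+z. (\<Sum>n. (PF ^^ n) d z * indicator ?K z) \<partial>lborel)" by simp
  also have "\<dots> = (\<Sum>n. \<integral>\<^sup>+z. (PF ^^ n) d z * indicator ?K z \<partial>lborel)" by (rule nn_integral_suminf) measurable
  also have "\<dots> = (\<Sum>n. \<integral>\<^sup>+y. d y * indicator ?K ((T_map ^^ n) y) \<partial>lborel)"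
    using dsupp by (intro suminf_cong PF_funpow_dual) auto
  also have "\<dots> = (\<integral>\<^sup>+y. (\<Sum>n. d y * indicator ?K ((T_map ^^ n) y)) \<partial>lborel)"
    using Tm by (intro nn_integral_suminf[symmetric])
  finally have "(\<integral>\<^sup>+y. (\<Sum>n. d y * indicator ?K ((T_map ^^ n) y)) \<partial>lborel) \<noteq> \<infinity>" using le1 by (auto simp: top_unique)
  moreover have "(\<lambda>y. \<Sum>n. d y * indicator ?K ((T_map ^^ n) y)) \<in> borel_measurable lborel"
    using Tm by measurable
  ultimately have AE1: "AE y in lborel. (\<Sum>n. d y * indicator ?K ((T_map ^^ n) y)) \<noteq> \<infinity>"
    by (intro nn_integral_PInf_AE)
  have "U_dom - {x. visits r x} \<in> null_sets lborel"
  proof -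
    have "U_dom - {x. visits r x} \<in> sets lborel" using visit_set_borel U_dom_borel by auto
    then show ?thesis using vis by (simp add: negligible_iff_null_sets null_sets_completion_iff)
  qed
  then have AE2: "AE y in lborel. y \<notin> U_dom - {x. visits r x}" by (rule AE_not_in)
  have "AE z in lborel. PF h z = h z"
    using AE1 AE2
  proof eventually_elim
    case (elim y)
    have "d y = 0"
    proof (cases "y \<in> Sec")
      case True
      then have "\<exists>\<^sub>\<infinity>n. cmod ((T_map ^^ n) y) \<le> r" using elim(2) Sec_U by blast
      then have "(\<Sum>n. indicator {n. cmod ((T_map ^^ n) y) \<le> r} n :: ennreal) = top" by (rule suminf_infinite_visits)
      moreover have "(indicator ?K ((T_map ^^ n) y) :: ennreal) = indicator {n. cmod ((T_map ^^ n) y) \<le> r} n" for n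
        by (auto simp: indicator_def)
      ultimately have "d y * top \<noteq> \<infinity>" using elim(1) by simp
      then show ?thesis by (auto simp: ennreal_mult_eq_top_iff)
    qed (rule dsupp)
    then show ?case using hd[of y] by simp
  qed
  then show ?thesis using hm hsupp hpos hK vis by blast
qed

theorem proposition1:
  "\<exists>\<mu> :: complex measure.
     sets \<mu> = sets (lebesgue_on U_dom) \<and>
     emeasure \<mu> U_dom \<noteq> 0 \<and>
     sigma_finite_measure \<mu> \<and>
     absolutely_continuous (lebesgue_on U_dom) \<mu> \<and>
     T_map \<in> measurable \<mu> \<mu> \<and>
     (\<forall>A \<in> sets \<mu>. emeasure \<mu> (T_map -` A \<inter> U_dom) = emeasure \<mu> A) \<and>
     (\<forall>A \<in> sets \<mu>. T_map -` A \<inter> U_dom = A \<longrightarrow>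
        emeasure \<mu> A = 0 \<or> emeasure \<mu> (U_dom - A) = 0)"
proof -
  obtain h r where hm [measurable]: "h \<in> borel_measurable borel" and hsupp: "\<And>z. z \<notin> Sec \<Longrightarrow> h z = (0::ennreal)"
    and hpos: "\<And>z. z \<in> Sec \<Longrightarrow> h z \<noteq> 0" and Lh: "AE z in lborel. PF h z = h z"
    and hK: "(\<integral>\<^sup>+z. h z * indicator (cball 0 r) z \<partial>lborel) \<le> 1"
    and vis: "negligible (U_dom - {x. visits r x})"
    using invariant_density_exists by blast
  define \<mu> where "\<mu> = density (lebesgue_on U_dom) h"
  have Ul: "U_dom \<in> sets lebesgue" using U_dom_borel by simp
  have smu: "sets \<mu> = sets (lebesgue_on U_dom)" and spmu: "space \<mu> = U_dom" by (simp_all add: \<mu>_def)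
  have setsmu: "A \<in> sets \<mu> \<longleftrightarrow> A \<in> sets lebesgue \<and> A \<subseteq> U_dom" for A
    unfolding smu using Ul by (auto simp: sets_restrict_space_iff)
  have hl: "h \<in> borel_measurable (lebesgue_on U_dom)"
    using hm by (intro measurable_restrict_space1 measurable_completion) simp
  have null: "emeasure \<mu> A = 0" if "negligible A" "A \<subseteq> U_dom" for A
  proof -
    have Al: "A \<in> sets lebesgue" using that negligible_imp_sets by blast
    have "A \<in> null_sets (lebesgue_on U_dom)"
      using that Ul by (simp add: null_sets_restrict_space negligible_iff_null_sets)
    then have "A \<in> null_sets \<mu>" unfolding \<mu>_def using hl
      by (subst null_sets_density_iff) (auto dest: AE_not_in)
    then show ?thesis by auto
  qed
  have emu: "emeasure \<mu> B = (\<integral>\<^sup>+z. h z * indicator B z \<partial>lborel)" if B: "B \<in> sets borel" "B \<subseteq> U_dom" for B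
  proof -
    have "B \<in> sets (lebesgue_on U_dom)" using B setsmu smu by simp
    then have "emeasure \<mu> B = (\<integral>\<^sup>+z. h z * indicator B z \<partial>lebesgue_on U_dom)"
      unfolding \<mu>_def using hl by (rule emeasure_density[rotated])
    also have "\<dots> = (\<integral>\<^sup>+z. h z * indicator B z * indicator U_dom z \<partial>lebesgue)"
      using Ul by (subst nn_integral_restrict_space) auto
    also have "\<dots> = (\<integral>\<^sup>+z. h z * indicator B z \<partial>lebesgue)"
      using B by (intro nn_integral_cong) (auto simp: indicator_def)
    also have "\<dots> = (\<integral>\<^sup>+z. h z * indicator B z \<partial>lborel)"
      by (rule nn_integral_completion)
    finally show ?thesis .
  qed
  have Tb: "T_map -` B \<inter> U_dom \<in> sets borel" if "B \<in> sets borel" for B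
    using measurable_sets[OF T_map_measurable that] U_dom_borel by auto
  have invB: "emeasure \<mu> (T_map -` B \<inter> U_dom) = emeasure \<mu> B" if B [measurable]: "B \<in> sets borel" and BU: "B \<subseteq> U_dom" for B
  proof -
    have "emeasure \<mu> (T_map -` B \<inter> U_dom) = (\<integral>\<^sup>+z. h z * indicator (T_map -` B \<inter> U_dom) z \<partial>lborel)"
      using Tb B by (intro emu) auto
    also have "\<dots> = (\<integral>\<^sup>+z. h z * indicator B (T_map z) \<partial>lborel)"
    proof (intro nn_integral_cong)
      fix z
      show "h z * indicator (T_map -` B \<inter> U_dom) z = h z * indicator B (T_map z)"
        using hsupp[of z] Sec_U by (cases "z \<in> Sec") (auto simp: indicator_def)
    qed
    also have "\<dots> = (\<integral>\<^sup>+z. PF h z * indicator B z \<partial>lborel)" by (rule PF_dual[symmetric, OF hm hsupp B])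
    also have "\<dots> = (\<integral>\<^sup>+z. h z * indicator B z \<partial>lborel)"
      using Lh by (intro nn_integral_cong_AE) (auto elim: eventually_mono)
    also have "\<dots> = emeasure \<mu> B" using B BU by (rule emu[symmetric])
    finally show ?thesis .
  qed
  have split: "T_map -` A \<inter> U_dom \<in> sets \<mu> \<and> emeasure \<mu> (T_map -` A \<inter> U_dom) = emeasure \<mu> A" if "A \<in> sets \<mu>" for A
  proof -
    have A: "A \<in> sets lebesgue" "A \<subseteq> U_dom" using that setsmu by auto
    \<comment> \<open>Duality is stated for Borel sets; the negligible remainder is controlled by
      \<open>negligible_T_preimage\<close>.\<close>
    obtain B N where BN: "B \<in> sets borel" "negligible N" "B \<union> N = A" using sets_lebesgue_almost_borel[OF A(1)] by blast
    have BU: "B \<subseteq> U_dom" and NU: "N \<subseteq> U_dom" using BN A by auto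
    have eq: "T_map -` A \<inter> U_dom = (T_map -` B \<inter> U_dom) \<union> (T_map -` N \<inter> U_dom)" using BN by auto
    have n: "negligible (T_map -` N \<inter> U_dom)" by (rule negligible_T_preimage[OF BN(2)])
    have Bs: "B \<in> sets \<mu>" "T_map -` B \<inter> U_dom \<in> sets \<mu>" using BN(1) BU Tb[OF BN(1)] by (auto simp: setsmu)
    have ns: "N \<in> null_sets \<mu>" "T_map -` N \<inter> U_dom \<in> null_sets \<mu>"
      using null[OF BN(2) NU] null[OF n] BN(2) n NU negligible_imp_sets by (auto simp: setsmu intro!: null_setsI)
    have "emeasure \<mu> (T_map -` A \<inter> U_dom) = emeasure \<mu> (T_map -` B \<inter> U_dom)"
      unfolding eq by (rule emeasure_Un_null_set[OF Bs(2) ns(2)])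
    also have "\<dots> = emeasure \<mu> B" by (rule invB[OF BN(1) BU])
    also have "\<dots> = emeasure \<mu> A" unfolding BN(3)[symmetric] by (rule emeasure_Un_null_set[OF Bs(1) ns(1), symmetric])
    finally show ?thesis using Bs ns eq by auto
  qed
  have "emeasure \<mu> U_dom \<noteq> 0"
  proof
    assume "emeasure \<mu> U_dom = 0"
    then have "(\<integral>\<^sup>+z. h z * indicator U_dom z \<partial>lborel) = 0" using emu[OF U_dom_borel] by simp
    then have "AE z in lborel. h z * indicator U_dom z = 0" by (subst (asm) nn_integral_0_iff_AE) auto
    then have "AE z in lborel. z \<notin> Sec"
    proof eventually_elim
      case (elim z)
      then show ?case using hpos[of z] Sec_U by (auto simp: indicator_def split: if_splits)
    qed
    then have "Sec \<in> null_sets lborel" by (subst AE_iff_null_sets) auto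
    then have "negligible Sec" using null_sets_completionI negligible_iff_null_sets by blast
    then show False using open_not_negligible[OF open_Sec] Sec_nonempty by blast
  qed
  moreover have "sigma_finite_measure \<mu>"
  proof
    \<comment> \<open>By invariance each preimage of the disc has measure at most 1, and almost
      every point lies in one of them because its orbit visits the disc.\<close>
    define W where "W n = (T_map ^^ n) -` cball 0 r \<inter> U_dom" for n
    define N where "N = U_dom - (\<Union>n. W n)"
    have W: "W n \<in> sets \<mu> \<and> emeasure \<mu> (W n) \<le> 1" for n
    proof (induction n)
      case 0
      have "W 0 \<in> sets borel" by (simp add: W_def)
      moreover have "W 0 \<subseteq> U_dom" by (auto simp: W_def)
      moreover have "emeasure \<mu> (W 0) \<le> (\<integral>\<^sup>+z. h z * indicator (cball 0 r) z \<partial>lborel)"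
        using calculation by (subst emu) (auto simp: W_def indicator_def intro!: nn_integral_mono)
      ultimately show ?case using hK by (auto simp: setsmu)
    next
      case (Suc n)
      have "W (Suc n) = T_map -` W n \<inter> U_dom" unfolding W_def using T_map_U by (auto simp: funpow_swap1)
      then show ?case using split[of "W n"] Suc by simp
    qed
    have "N \<subseteq> U_dom - {x. visits r x}"
      unfolding N_def W_def by (auto simp: INFM_nat_le) (metis le0)
    then have "negligible N" using vis negligible_subset by blast
    then have N: "N \<in> sets \<mu>" "emeasure \<mu> N = 0"
      using null[of N] negligible_imp_sets by (auto simp: setsmu N_def)
    show "\<exists>A. countable A \<and> A \<subseteq> sets \<mu> \<and> \<Union> A = space \<mu> \<and> (\<forall>a\<in>A. emeasure \<mu> a \<noteq> \<infinity>)"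
    proof (intro exI[of _ "insert N (range W)"] conjI ballI)
      show "\<Union> (insert N (range W)) = space \<mu>" unfolding spmu N_def using W_def by auto
      show "emeasure \<mu> a \<noteq> \<infinity>" if "a \<in> insert N (range W)" for a
        using that W N by (auto simp: top_unique) (metis ennreal_one_neq_top top_unique)
    qed (use W N in auto)
  qed
  moreover have "absolutely_continuous (lebesgue_on U_dom) \<mu>"
    unfolding absolutely_continuous_def
  proof
    fix A assume "A \<in> null_sets (lebesgue_on U_dom)"
    then have "negligible A" "A \<subseteq> U_dom" using Ul by (auto simp: null_sets_restrict_space negligible_iff_null_sets)
    then show "A \<in> null_sets \<mu>" using null negligible_imp_sets by (auto simp: setsmu intro!: null_setsI)
  qed
  moreover have "T_map \<in> measurable \<mu> \<mu>"
    using split T_map_U by (auto intro!: measurableI simp: spmu)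
  moreover have "emeasure \<mu> A = 0 \<or> emeasure \<mu> (U_dom - A) = 0" if "A \<in> sets \<mu>" "T_map -` A \<inter> U_dom = A" for A
    using T_ergodic[of A] that null[of A] null[of "U_dom - A"] by (auto simp: setsmu)
  ultimately show ?thesis using smu split by (intro exI[of _ \<mu>]) auto
qed

end
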